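(* For a complex simple Lie algebra $\mathfrak{g}_{\mathbb{C}}$, let $\mathrm{MF}(\mathfrak{g}_{\mathbb{C}})$ be its maximal flag manifold. The following hold, where dimensions of spaces of invariant spinors are over $\mathbb{C}$ and non-trivial means non-zero: \begin{enumerate} \item $\mathrm{MF}(A_n)$, $n \geq 1$, admits non-trivial invariant spinors if, and only if, $n$ is even. In this case, the dimension of the space of invariant spinors is at least $2^{\lfloor n/2 \rfloor}$. \item $\mathrm{MF}(B_n)$, $n \geq 2$, does not admit non-trivial invariant spinors for any value of $n$. \item $\mathrm{MF}(C_n)$, $n \geq 3$, admits non-trivial invariant spinors if, and only if, $n \equiv 0, 3 \bmod 4$. In this case, the dimension of the space of invariant spinors is at least $2^{\lfloor (n+1)/4 \rfloor}$. \item $\mathrm{MF}(D_n)$, $n \geq 4$, admits non-trivial invariant spinors if, and only if, $n \equiv 0, 1 \bmod 4$. In this case, the dimension of the space of invariant spinors is at least $2^{\lfloor (n+1)/4 \rfloor}$. \item $\mathrm{MF}(E_6)$ admits non-trivial invariant spinors. The space of invariant spinors has dimension exactly $13697920$. \item $\mathrm{MF}(E_7)$ does not admit non-trivial invariant spinors. \item $\mathrm{MF}(E_8)$ admits non-trivial invariant spinors. The space of invariant spinors has dimension at least $369600$. \item $\mathrm{MF}(F_4)$ admits non-trivial invariant spinors. The space of invariant spinors has dimension exactly $34432$. \item $\mathrm{MF}(G_2)$ admits a four-dimensional space of invariant spinors. \end{enumerate}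
   Context: Here $A_n, B_n, C_n, D_n, E_6, E_7, E_8, F_4, G_2$ denote the complex simple Lie algebras of the corresponding Cartan type (the subscript being the rank). Maximal flag manifold: let $\mathfrak{g}$ be the compact real form of the complex simple Lie algebra $\mathfrak{g}_{\mathbb{C}}$, let $G$ be the compact simply connected Lie group with Lie algebra $\mathfrak{g}$, and let $T \subseteq G$ be a maximal torus, with Lie algebra $\mathfrak{h}$. Then $\mathrm{MF}(\mathfrak{g}_{\mathbb{C}}) := G/T$. Let $r$ be the number of positive roots of $\mathfrak{g}_{\mathbb{C}}$, so $\dim_{\mathbb{R}} G/T = 2r$. Invariant spinors: let $\mathfrak{m}$ be the orthogonal complement of $\mathfrak{h}$ in $\mathfrak{g}$ with respect to the negative of the Killing form of $\mathfrak{g}$, with the induced inner product and a fixed orientation. The isotropy representation is $\sigma = \mathrm{Ad}|_T \colon T \to \mathrm{SO}(\mathfrak{m}) \cong \mathrm{SO}(2r)$. The manifold $G/T$ has a unique spin structure, which is $G$-invariant and corresponds to the (unique) lift $\widetilde{\sigma}\colon T \to \mathrm{Spin}(2r)$ of $\sigma$ along the double cover $\mathrm{Spin}(2r) \to \mathrm{SO}(2r)$. Let $\Delta$ be the complex spin representation of $\mathrm{Spin}(2r)$, of complex dimension $2^r$ (the restriction of the irreducible complex representation of the Clifford algebra $\mathbb{C}l(2r)$). The spinor bundle of $G/T$ is $G \times_{\widetilde{\sigma}} \Delta \to G/T$. Spinors are its sections, i.e. $T$-equivariant maps $G \to \Delta$; invariant spinors are those corresponding to constant maps, so the space of invariant spinors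 is the complex vector space of elements of $\Delta$ fixed by $\widetilde{\sigma}(T)$ (equivalently, annihilated by the differential action of $\mathfrak{h}$). *)

theory Defs
  imports "HOL-Analysis.Analysis"
begin

section \<open>Complex simple Lie algebras, compact real forms, maximal tori\<close>

text \<open>
  A finite-dimensional complex Lie algebra is a bracket on \<^typ>\<open>complex ^ 'n\<close>, where the
  index type \<open>'n\<close> is arbitrary. Complex-linear notions are those of \<open>vec\<close>
  (scalar multiplication \<open>*s\<close>); the unqualified \<open>subspace\<close>, \<open>span\<close>, \<open>independent\<close> and
  \<open>representation\<close> are over the reals.
\<close>

type_synonym 'n bracket = "complex ^ 'n \<Rightarrow> complex ^ 'n \<Rightarrow> complex ^ 'n"

definition complex_lie_algebra :: "'n::finite bracket \<Rightarrow> bool" where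
  "complex_lie_algebra br \<longleftrightarrow>
     (\<forall>x. Vector_Spaces.linear (*s) (*s) (\<lambda>y. br x y)) \<and>
     (\<forall>y. Vector_Spaces.linear (*s) (*s) (\<lambda>x. br x y)) \<and>
     (\<forall>x. br x x = 0) \<and>
     (\<forall>x y z. br x (br y z) + br y (br z x) + br z (br x y) = 0)"

definition lie_ideal :: "'n::finite bracket \<Rightarrow> (complex ^ 'n) set \<Rightarrow> bool" where
  "lie_ideal br I \<longleftrightarrow> vec.subspace I \<and> (\<forall>x. \<forall>y\<in>I. br x y \<in> I)"

definition complex_simple_lie_algebra :: "'n::finite bracket \<Rightarrow> bool" where
  "complex_simple_lie_algebra br \<longleftrightarrow>
     complex_lie_algebra br \<and> (\<exists>x y. br x y \<noteq> 0) \<and>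
     (\<forall>I. lie_ideal br I \<longrightarrow> I = {0} \<or> I = UNIV)"

definition real_subalgebra :: "'n::finite bracket \<Rightarrow> (complex ^ 'n) set \<Rightarrow> bool" where
  "real_subalgebra br g \<longleftrightarrow> subspace g \<and> (\<forall>x\<in>g. \<forall>y\<in>g. br x y \<in> g)"

text \<open>Trace of the restriction to the real subspace \<open>V\<close> of a real-linear map preserving \<open>V\<close>.\<close>

definition trace_on :: "'a::real_vector set \<Rightarrow> ('a \<Rightarrow> 'a) \<Rightarrow> real" where
  "trace_on V f =
     (let B = (SOME B. independent B \<and> span B = V)
      in \<Sum>b\<in>B. representation B (f b) b)"

definition killing_form ::
  "'n::finite bracket \<Rightarrow> (complex ^ 'n) set \<Rightarrow> complex ^ 'n \<Rightarrow> complex ^ 'n \<Rightarrow> real" where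
  "killing_form br g x y = trace_on g (\<lambda>z. br x (br y z))"

definition compact_real_form :: "'n::finite bracket \<Rightarrow> (complex ^ 'n) set \<Rightarrow> bool" where
  "compact_real_form br g \<longleftrightarrow>
     real_subalgebra br g \<and>
     (\<forall>z. \<exists>!(x, y). x \<in> g \<and> y \<in> g \<and> z = x + \<i> *s y) \<and>
     (\<forall>x\<in>g. x \<noteq> 0 \<longrightarrow> killing_form br g x x < 0)"

definition abelian_subalgebra :: "'n::finite bracket \<Rightarrow> (complex ^ 'n) set \<Rightarrow> bool" where
  "abelian_subalgebra br h \<longleftrightarrow> real_subalgebra br h \<and> (\<forall>x\<in>h. \<forall>y\<in>h. br x y = 0)"

text \<open>
  For a compact connected Lie group \<open>G\<close> with Lie algebra \<open>g\<close>, the Lie algebras of the maximal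
  tori of \<open>G\<close> are exactly the maximal abelian subalgebras of \<open>g\<close>.
\<close>

definition maximal_torus_algebra ::
  "'n::finite bracket \<Rightarrow> (complex ^ 'n) set \<Rightarrow> (complex ^ 'n) set \<Rightarrow> bool" where
  "maximal_torus_algebra br g h \<longleftrightarrow>
     abelian_subalgebra br h \<and> h \<subseteq> g \<and>
     (\<forall>h'. abelian_subalgebra br h' \<and> h \<subseteq> h' \<and> h' \<subseteq> g \<longrightarrow> h' = h)"


section \<open>Roots and Cartan type\<close>

text \<open>
  \<open>H\<close> is a Cartan subalgebra of the complex Lie algebra. A functional on \<open>H\<close> is represented by
  the function that agrees with it on \<open>H\<close> and vanishes off \<open>H\<close>. Linearity of roots on \<open>H\<close> follows
  from the existence of a nonzero root vector.
\<close>

definition root_space ::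
  "'n::finite bracket \<Rightarrow> (complex ^ 'n) set \<Rightarrow> (complex ^ 'n \<Rightarrow> complex) \<Rightarrow> (complex ^ 'n) set" where
  "root_space br H \<alpha> = {x. \<forall>t\<in>H. br t x = \<alpha> t *s x}"

definition roots ::
  "'n::finite bracket \<Rightarrow> (complex ^ 'n) set \<Rightarrow> (complex ^ 'n \<Rightarrow> complex) set" where
  "roots br H =
     {\<alpha>. (\<forall>x. x \<notin> H \<longrightarrow> \<alpha> x = 0) \<and> (\<exists>t\<in>H. \<alpha> t \<noteq> 0) \<and> root_space br H \<alpha> \<noteq> {0}}"

text \<open>The coroot of \<open>\<alpha>\<close>: the element of \<open>[g\<^sub>\<alpha>, g\<^sub>-\<^sub>\<alpha>]\<close> on which \<open>\<alpha>\<close> takes the value 2.\<close>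

definition coroot ::
  "'n::finite bracket \<Rightarrow> (complex ^ 'n) set \<Rightarrow> (complex ^ 'n \<Rightarrow> complex) \<Rightarrow> complex ^ 'n" where
  "coroot br H \<alpha> =
     (THE t. t \<in> vec.span {br x y | x y. x \<in> root_space br H \<alpha> \<and> y \<in> root_space br H (\<lambda>t. - \<alpha> t)}
             \<and> \<alpha> t = 2)"

definition root_base ::
  "'n::finite bracket \<Rightarrow> (complex ^ 'n) set \<Rightarrow> nat \<Rightarrow> (nat \<Rightarrow> complex ^ 'n \<Rightarrow> complex) \<Rightarrow> bool" where
  "root_base br H n \<alpha> \<longleftrightarrow>
     (\<forall>i\<in>{1..n}. \<alpha> i \<in> roots br H) \<and>
     (\<forall>a :: nat \<Rightarrow> real.
        (\<forall>t. (\<Sum>i=1..n. of_real (a i) * \<alpha> i t) = 0) \<longrightarrow> (\<forall>i\<in>{1..n}. a i = 0)) \<and>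
     (\<forall>\<beta>\<in>roots br H. \<exists>k :: nat \<Rightarrow> nat.
        (\<forall>t. \<beta> t = (\<Sum>i=1..n. of_nat (k i) * \<alpha> i t)) \<or>
        (\<forall>t. \<beta> t = - (\<Sum>i=1..n. of_nat (k i) * \<alpha> i t)))"

datatype cartan_type =
    Type_A nat | Type_B nat | Type_C nat | Type_D nat
  | Type_E6 | Type_E7 | Type_E8 | Type_F4 | Type_G2

fun cartan_rank :: "cartan_type \<Rightarrow> nat" where
  "cartan_rank (Type_A n) = n"
| "cartan_rank (Type_B n) = n"
| "cartan_rank (Type_C n) = n"
| "cartan_rank (Type_D n) = n"
| "cartan_rank Type_E6 = 6"
| "cartan_rank Type_E7 = 7"
| "cartan_rank Type_E8 = 8"
| "cartan_rank Type_F4 = 4"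
| "cartan_rank Type_G2 = 2"

text \<open>
  Cartan matrices with entries \<open>\<alpha>\<^sub>i(\<alpha>\<^sub>j\<^sup>\<or>) = 2 (\<alpha>\<^sub>i, \<alpha>\<^sub>j) / (\<alpha>\<^sub>j, \<alpha>\<^sub>j)\<close>, nodes numbered from 1 as in Bourbaki.
  Only the indices from 1 to the rank are meaningful.
\<close>

definition chain_matrix :: "nat \<Rightarrow> nat \<Rightarrow> int" where
  "chain_matrix i j = (if i = j then 2 else if i = Suc j \<or> j = Suc i then -1 else 0)"

definition e_matrix :: "nat \<Rightarrow> nat \<Rightarrow> int" where
  "e_matrix i j =
     (if i = j then 2
      else if {i, j} \<in> {{1,3}, {2,4}, {3,4}, {4,5}, {5,6}, {6,7}, {7,8}} then -1 else 0)"

fun cartan_matrix :: "cartan_type \<Rightarrow> nat \<Rightarrow> nat \<Rightarrow> int" where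
  "cartan_matrix (Type_A n) i j = chain_matrix i j"
| "cartan_matrix (Type_B n) i j = (if Suc i = n \<and> j = n then -2 else chain_matrix i j)"
| "cartan_matrix (Type_C n) i j = (if i = n \<and> Suc j = n then -2 else chain_matrix i j)"
| "cartan_matrix (Type_D n) i j =
     (if {i, j} = {n - 2, n} then -1 else if {i, j} = {n - 1, n} then 0 else chain_matrix i j)"
| "cartan_matrix Type_E6 i j = e_matrix i j"
| "cartan_matrix Type_E7 i j = e_matrix i j"
| "cartan_matrix Type_E8 i j = e_matrix i j"
| "cartan_matrix Type_F4 i j = (if i = 2 \<and> j = 3 then -2 else chain_matrix i j)"
| "cartan_matrix Type_G2 i j = (if i = 2 \<and> j = 1 then -3 else chain_matrix i j)"

definition has_cartan_type ::
  "'n::finite bracket \<Rightarrow> (complex ^ 'n) set \<Rightarrow> cartan_type \<Rightarrow> bool" where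
  "has_cartan_type br H X \<longleftrightarrow>
     (\<exists>\<alpha>. root_base br H (cartan_rank X) \<alpha> \<and>
       (\<forall>i\<in>{1..cartan_rank X}. \<forall>j\<in>{1..cartan_rank X}.
          \<alpha> i (coroot br H (\<alpha> j)) = of_int (cartan_matrix X i j)))"


section \<open>Invariant spinors on the maximal flag manifold\<close>

definition isotropy_module ::
  "'n::finite bracket \<Rightarrow> (complex ^ 'n) set \<Rightarrow> (complex ^ 'n) set \<Rightarrow> (complex ^ 'n) set" where
  "isotropy_module br g h = {x \<in> g. \<forall>y\<in>h. - killing_form br g x y = 0}"

text \<open>
  \<open>c x \<psi>\<close> is the Clifford product of \<open>x \<in> m\<close> with \<open>\<psi>\<close>, for the inner product \<open>Q\<close> on \<open>m\<close>, with the
  convention \<open>x \<cdot> x = - Q x x\<close>. As \<open>m\<close> is even-dimensional, the irreducible complex Clifford module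
  is unique up to isomorphism and has complex dimension \<open>2\<^sup>r\<close> with \<open>dim m = 2r\<close>.
\<close>

definition clifford_module ::
  "'a::real_vector set \<Rightarrow> ('a \<Rightarrow> 'a \<Rightarrow> real) \<Rightarrow> ('a \<Rightarrow> complex ^ 's::finite \<Rightarrow> complex ^ 's) \<Rightarrow> bool" where
  "clifford_module m Q c \<longleftrightarrow>
     (\<forall>x\<in>m. Vector_Spaces.linear (*s) (*s) (c x)) \<and>
     (\<forall>x\<in>m. \<forall>y\<in>m. \<forall>\<psi>. c (x + y) \<psi> = c x \<psi> + c y \<psi>) \<and>
     (\<forall>a. \<forall>x\<in>m. \<forall>\<psi>. c (a *\<^sub>R x) \<psi> = a *\<^sub>R c x \<psi>) \<and>
     (\<forall>x\<in>m. \<forall>\<psi>. c x (c x \<psi>) = - Q x x *\<^sub>R \<psi>)"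

definition irreducible_clifford_module ::
  "'a::real_vector set \<Rightarrow> ('a \<Rightarrow> 'a \<Rightarrow> real) \<Rightarrow> ('a \<Rightarrow> complex ^ 's::finite \<Rightarrow> complex ^ 's) \<Rightarrow> bool" where
  "irreducible_clifford_module m Q c \<longleftrightarrow>
     clifford_module m Q c \<and>
     (\<forall>W. vec.subspace W \<and> (\<forall>x\<in>m. \<forall>\<psi>\<in>W. c x \<psi> \<in> W) \<longrightarrow> W = {0} \<or> W = UNIV)"

definition spinor_module ::
  "'n::finite bracket \<Rightarrow> (complex ^ 'n) set \<Rightarrow> (complex ^ 'n) set
    \<Rightarrow> (complex ^ 'n \<Rightarrow> complex ^ 's::finite \<Rightarrow> complex ^ 's) \<Rightarrow> bool" where
  "spinor_module br g h c \<longleftrightarrow>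
     irreducible_clifford_module (isotropy_module br g h) (\<lambda>x y. - killing_form br g x y) c"

text \<open>
  The Lie algebra of the spin group of \<open>m\<close>, acting on spinors: the real span of the Clifford
  commutators \<open>x \<cdot> y - y \<cdot> x\<close> with \<open>x, y \<in> m\<close>.
\<close>

definition spin_lie_algebra ::
  "'a::real_vector set \<Rightarrow> ('a \<Rightarrow> complex ^ 's::finite \<Rightarrow> complex ^ 's)
    \<Rightarrow> (complex ^ 's \<Rightarrow> complex ^ 's) set" where
  "spin_lie_algebra m c =
     {S. \<exists>(N::nat) (a :: nat \<Rightarrow> real) x y. (\<forall>k<N. x k \<in> m \<and> y k \<in> m) \<and>
         S = (\<lambda>\<psi>. \<Sum>k<N. a k *\<^sub>R (c (x k) (c (y k) \<psi>) - c (y k) (c (x k) \<psi>)))}"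

text \<open>
  The differential at \<open>t \<in> h\<close> of the lift of the isotropy representation to the spin group. The
  covering \<open>Spin(m) \<rightarrow> SO(m)\<close> is \<open>u \<mapsto> (v \<mapsto> u \<cdot> v \<cdot> u\<^sup>-\<^sup>1)\<close>, with differential
  \<open>S \<mapsto> (v \<mapsto> S \<cdot> v - v \<cdot> S)\<close>, an isomorphism onto \<open>so(m)\<close>; the lift of \<open>v \<mapsto> [t, v]\<close> is its preimage.
\<close>

definition spin_isotropy ::
  "'n::finite bracket \<Rightarrow> (complex ^ 'n) set \<Rightarrow> (complex ^ 'n) set
    \<Rightarrow> (complex ^ 'n \<Rightarrow> complex ^ 's::finite \<Rightarrow> complex ^ 's)
    \<Rightarrow> complex ^ 'n \<Rightarrow> complex ^ 's \<Rightarrow> complex ^ 's" where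
  "spin_isotropy br g h c t =
     (THE S. S \<in> spin_lie_algebra (isotropy_module br g h) c \<and>
        (\<forall>v\<in>isotropy_module br g h. \<forall>\<psi>. S (c v \<psi>) - c v (S \<psi>) = c (br t v) \<psi>))"

text \<open>
  Since the torus is connected, a spinor is fixed by the lifted isotropy representation iff it is
  annihilated by its differential.
\<close>

definition invariant_spinors ::
  "'n::finite bracket \<Rightarrow> (complex ^ 'n) set \<Rightarrow> (complex ^ 'n) set
    \<Rightarrow> (complex ^ 'n \<Rightarrow> complex ^ 's::finite \<Rightarrow> complex ^ 's) \<Rightarrow> (complex ^ 's) set" where
  "invariant_spinors br g h c = {\<psi>. \<forall>t\<in>h. spin_isotropy br g h c t \<psi> = 0}"

definition admits_invariant_spinors ::
  "'n::finite bracket \<Rightarrow> (complex ^ 'n) set \<Rightarrow> (complex ^ 'n) set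
    \<Rightarrow> (complex ^ 'n \<Rightarrow> complex ^ 's::finite \<Rightarrow> complex ^ 's) \<Rightarrow> bool" where
  "admits_invariant_spinors br g h c \<longleftrightarrow> (\<exists>\<psi>\<in>invariant_spinors br g h c. \<psi> \<noteq> 0)"

end

(*
  Write x_b for a root vector of the positive root b and r for the number of positive roots. The Clifford
  products J_b of the two real root vectors x_b + conj x_b and i (x_b - conj x_b) commute and square to -1, and
  irreducibility makes each of the 2^r joint eigenspaces of the J_b one-dimensional. The torus acts through
  real combinations of the J_b with the roots as coefficients. So the dimension of the space of invariant
  spinors is the number of ways to sign the positive roots such that the signed sum vanishes.

  Sl(2)-chains show that root spaces are one-dimensional and that simple reflections permute the roots, so the
  positive roots, in coordinates with respect to the base, are generated from the unit vectors by the Cartan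
  matrix.

  If a coefficient of the sum of the positive roots is odd, there is no zero-sum signing. A partition of the
  positive roots into m nonempty blocks that each have a zero-sum signing gives at least 2^m of them. The
  exact numbers are coefficients of products of polynomials.
*)
theory Submission
  imports Defs "HOL-Computational_Algebra.Fundamental_Theorem_Algebra"
begin

section \<open>Linear algebra over the complex numbers\<close>

text \<open>The Killing form is a trace over a chosen real basis, and coroots and the spin lift are
  definite descriptions, so their values have to be derived. Compactness carries the Lie-theoretic
  part: the Killing form and the conjugation of g give a positive definite Hermitian form for which
  h acts by skew-Hermitian operators. Hence joint eigenvectors span, weights are imaginary on h and
  every root has positive norm. Commutators with Clifford products fix the spin lift only up to a
  scalar; elements of the spin Lie algebra have trace zero, which removes this freedom.

  The exponents of the classical lower bounds come from layers of roots that split on their own: two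
  new coordinates at a time in type A, four in types C and D. The exact counts for F4 and E6 range
  over \<open>2^24\<close> and \<open>2^36\<close> signings. The roots are therefore cut into two
  parts, the subset sums of each part are collected in a polynomial in several variables, and
  coefficients at equal exponents are multiplied. In type E8 the 120 positive roots fall into 40
  triples u, v, u + v, which gives \<open>2^40\<close> signings, far above 369600.\<close>

abbreviation clinear :: "(complex ^ 'n \<Rightarrow> complex ^ 'm) \<Rightarrow> bool" where
  "clinear f \<equiv> Vector_Spaces.linear (*s) (*s) f"

lemma clinear_iff:
  "clinear f \<longleftrightarrow> (\<forall>x y. f (x + y) = f x + f y) \<and> (\<forall>a x. f (a *s x) = a *s f x)"
  by (simp add: Vector_Spaces.linear_iff vec.vector_space_axioms)

lemma clinearD:
  assumes "clinear f"
  shows clinear_add: "f (x + y) = f x + f y" and clinear_scale: "f (a *s x) = a *s f x"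
    and clinear_0: "f 0 = 0" and clinear_sum: "f (sum u I) = (\<Sum>i\<in>I. f (u i))"
    and clinear_diff: "f (x - y) = f x - f y" and clinear_neg: "f (- x) = - f x"
  using assms
  by (simp_all add: vec.linear_add vec.linear_scale vec.linear_0 vec.linear_sum vec.linear_diff vec.linear_neg)

lemma scaleR_eq_vector_smult: "a *\<^sub>R (x :: complex ^ 'n) = of_real a *s x"
  by (simp add: vec_eq_iff scaleR_conv_of_real[of a "_::complex"])

lemma clinear_scaleR:
  assumes "clinear f" shows "f (a *\<^sub>R x) = a *\<^sub>R f x"
  by (simp add: scaleR_eq_vector_smult clinear_scale[OF assms])

section \<open>Polynomials in an operator and existence of eigenvectors\<close>

definition papp :: "(complex ^ 'n \<Rightarrow> complex ^ 'n) \<Rightarrow> complex poly \<Rightarrow> complex ^ 'n \<Rightarrow> complex ^ 'n" where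
  "papp f p x = (\<Sum>i\<le>degree p. coeff p i *s (f ^^ i) x)"

lemma papp_bound:
  assumes "degree p \<le> N"
  shows "papp f p x = (\<Sum>i\<le>N. coeff p i *s (f ^^ i) x)"
  unfolding papp_def using assms
  by (intro sum.mono_neutral_left) (auto simp: coeff_eq_0)

lemma papp_add: "papp f (p + q) x = papp f p x + papp f q x"
proof -
  let ?N = "max (degree p) (degree q)"
  have "degree (p + q) \<le> ?N" by (rule degree_add_le_max)
  then show ?thesis
    by (simp add: papp_bound[of _ ?N] vec.scale_left_distrib sum.distrib)
qed

lemma papp_smult: "papp f (smult a p) x = a *s papp f p x"
  by (simp add: papp_bound[OF degree_smult_le] papp_def vec.scale_sum_right)

lemma papp_pCons_0:
  assumes "clinear f"
  shows "papp f (pCons 0 p) x = f (papp f p x)"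
proof -
  have "papp f (pCons 0 p) x = (\<Sum>i\<le>Suc (degree p). coeff (pCons 0 p) i *s (f ^^ i) x)"
    by (rule papp_bound) (simp add: degree_pCons_le)
  also have "\<dots> = (\<Sum>i\<le>degree p. coeff p i *s (f ^^ Suc i) x)"
    by (subst sum.atMost_Suc_shift) simp
  also have "\<dots> = f (papp f p x)"
    by (simp add: papp_def clinear_sum[OF assms] clinear_scale[OF assms])
  finally show ?thesis .
qed

text \<open>More iterates of v than the dimension are dependent, and a dependence is a polynomial.
  If iterates repeat, the set of iterates hides the dependence, so a difference of two monomials
  takes its place.\<close>

lemma annihilating_poly_exists:
  fixes v :: "complex ^ 'n::finite"
  shows "\<exists>p. p \<noteq> 0 \<and> papp f p v = 0"
proof (cases "inj (\<lambda>i. (f ^^ i) v)")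
  case True
  define w where "w = (\<lambda>i. (f ^^ i) v)"
  let ?N = "vec.dim (UNIV :: (complex^'n) set)"
  let ?S = "w ` {..?N}"
  have "card ?S = Suc ?N"
    using True by (subst card_image) (auto simp: w_def inj_on_def)
  then have "vec.dependent ?S"
    using vec.independent_card_le_dim[of ?S UNIV] by auto
  then obtain u where u: "(\<Sum>x\<in>?S. u x *s x) = 0" "\<exists>x\<in>?S. u x \<noteq> 0"
    using vec.dependent_finite[of ?S] by auto
  have 0: "(\<Sum>i\<le>?N. u (w i) *s w i) = 0"
    using u(1) True by (subst (asm) sum.reindex) (auto simp: w_def inj_on_def)
  define p where "p = (\<Sum>i\<le>?N. monom (u (w i)) i)"
  have cp: "coeff p i = (if i \<le> ?N then u (w i) else 0)" for i
    by (simp add: p_def coeff_sum)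
  have "degree p \<le> ?N" by (rule degree_le) (simp add: cp)
  then have "papp f p v = 0"
    using 0 by (simp add: papp_bound[of _ ?N] cp w_def)
  moreover have "p \<noteq> 0"
    using u(2) cp by (metis (no_types, lifting) coeff_0 imageE atMost_iff)
  ultimately show ?thesis by blast
next
  case False
  then obtain i j where ij: "i < j" "(f ^^ i) v = (f ^^ j) v"
    unfolding inj_def by (metis linorder_neqE_nat)
  define p :: "complex poly" where "p = monom 1 j - monom 1 i"
  have "coeff p j = 1" using ij by (simp add: p_def)
  then have "p \<noteq> 0" by auto
  have dp: "degree p \<le> j" unfolding p_def using ij
    by (intro degree_diff_le) (auto intro: order.trans[OF degree_monom_le])
  have "coeff p k *s (f ^^ k) v = (if k = j then (f ^^ j) v else 0) - (if k = i then (f ^^ i) v else 0)" for k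
    using ij by (auto simp: p_def)
  then have "papp f p v = 0"
    using ij by (simp add: papp_bound[OF dp] sum_subtractf sum.delta)
  then show ?thesis using \<open>p \<noteq> 0\<close> by blast
qed

text \<open>Let p annihilate v with least degree and let z be a root of p. The cofactor q of X - z
  has q(f) v nonzero by minimality, and f - z kills this vector.\<close>

lemma eigenvector_in_invariant_subspace:
  fixes f :: "complex ^ 'n::finite \<Rightarrow> complex ^ 'n"
  assumes f: "clinear f" and U: "vec.subspace U" "\<And>x. x \<in> U \<Longrightarrow> f x \<in> U"
    and v: "v \<in> U" "v \<noteq> 0"
  shows "\<exists>x\<in>U. \<exists>l. x \<noteq> 0 \<and> f x = l *s x"
proof -
  obtain p where p: "p \<noteq> 0" "papp f p v = 0"
    and min: "\<And>q. q \<noteq> 0 \<Longrightarrow> papp f q v = 0 \<Longrightarrow> degree p \<le> degree q"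
    using ex_has_least_nat[of "\<lambda>p. p \<noteq> 0 \<and> papp f p v = 0" _ degree]
      annihilating_poly_exists[of f v] by metis
  \<comment> \<open>A nonzero constant that annihilates v would make v zero.\<close>
  have "degree p \<noteq> 0"
  proof
    assume "degree p = 0"
    then have "coeff p 0 *s v = 0" "coeff p 0 \<noteq> 0"
      using p by (auto simp: papp_def leading_coeff_0_iff[symmetric])
    then show False using v by simp
  qed
  then obtain z where "poly p z = 0"
    using fundamental_theorem_of_algebra[of p] by (auto simp: constant_degree)
  then obtain q where q: "p = [:- z, 1:] * q" by (auto simp: poly_eq_0_iff_dvd)
  then have "q \<noteq> 0" using p by auto
  then have "degree p = Suc (degree q)" unfolding q by (subst degree_mult_eq) auto
  then have w: "papp f q v \<noteq> 0" using min[of q] \<open>q \<noteq> 0\<close> by auto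
  have "p = pCons 0 q + smult (- z) q" by (simp add: q)
  then have "f (papp f q v) + (- z) *s papp f q v = 0"
    using p papp_add papp_smult papp_pCons_0[OF f] by metis
  then have "f (papp f q v) = z *s papp f q v"
    by (simp add: add_eq_0_iff)
  moreover have "(f ^^ i) v \<in> U" for i by (induction i) (auto simp: v U)
  then have "papp f q v \<in> U"
    unfolding papp_def by (intro vec.subspace_sum U(1) vec.subspace_scale)
  ultimately show ?thesis using w by blast
qed

section \<open>Traces with respect to an explicit basis\<close>

definition ctrace :: "(complex ^ 'n) set \<Rightarrow> (complex ^ 'n \<Rightarrow> complex ^ 'n) \<Rightarrow> complex" where
  "ctrace B f = (\<Sum>b\<in>B. vec.representation B (f b) b)"

text \<open>Both traces expand into the same double sum of matrix entries. Symmetry and invariance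
  of the Killing form rest on this, and so does the vanishing trace of spin operators.\<close>

lemma ctrace_commute:
  fixes B :: "(complex ^ 'n::finite) set"
  assumes B: "vec.independent B" and f: "clinear f" and g: "clinear g"
    and fB: "\<And>b. b \<in> B \<Longrightarrow> f b \<in> vec.span B" and gB: "\<And>b. b \<in> B \<Longrightarrow> g b \<in> vec.span B"
  shows "ctrace B (\<lambda>x. f (g x)) = ctrace B (\<lambda>x. g (f x))"
proof -
  have fin: "finite B" using B vec.finiteI_independent by blast
  have *: "vec.representation B (F (G b)) c =
      (\<Sum>d\<in>B. vec.representation B (G b) d * vec.representation B (F d) c)"
    if F: "clinear F" "\<And>b. b \<in> B \<Longrightarrow> F b \<in> vec.span B" and G: "\<And>b. b \<in> B \<Longrightarrow> G b \<in> vec.span B"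
      and b: "b \<in> B" for F G :: "complex ^ 'n \<Rightarrow> complex ^ 'n" and b c
  proof -
    have "F (G b) = F (\<Sum>d\<in>B. vec.representation B (G b) d *s d)"
      using vec.sum_representation_eq[OF B G[OF b] fin] by simp
    also have "\<dots> = (\<Sum>d\<in>B. vec.representation B (G b) d *s F d)"
      by (simp add: clinear_sum[OF F(1)] clinear_scale[OF F(1)])
    finally show ?thesis
      using F(2) by (simp add: vec.representation_sum[OF B] vec.representation_scale[OF B] vec.span_scale)
  qed
  have "ctrace B (\<lambda>x. f (g x)) = (\<Sum>b\<in>B. \<Sum>d\<in>B. vec.representation B (g b) d * vec.representation B (f d) b)"
    unfolding ctrace_def by (intro sum.cong refl *[OF f fB gB])
  also have "\<dots> = (\<Sum>d\<in>B. \<Sum>b\<in>B. vec.representation B (f d) b * vec.representation B (g b) d)"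
    by (subst sum.swap) (simp add: mult.commute)
  also have "\<dots> = ctrace B (\<lambda>x. g (f x))"
    unfolding ctrace_def by (intro sum.cong refl *[OF g gB fB, symmetric])
  finally show ?thesis .
qed

lemma ctrace_add:
  assumes B: "vec.independent B"
    and "\<And>b. b \<in> B \<Longrightarrow> f b \<in> vec.span B" "\<And>b. b \<in> B \<Longrightarrow> g b \<in> vec.span B"
  shows "ctrace B (\<lambda>x. f x + g x) = ctrace B f + ctrace B g"
  using assms(2,3) by (simp add: ctrace_def vec.representation_add[OF B] sum.distrib)

lemma ctrace_diff:
  assumes B: "vec.independent B"
    and "\<And>b. b \<in> B \<Longrightarrow> f b \<in> vec.span B" "\<And>b. b \<in> B \<Longrightarrow> g b \<in> vec.span B"
  shows "ctrace B (\<lambda>x. f x - g x) = ctrace B f - ctrace B g"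
  using assms(2,3) by (simp add: ctrace_def vec.representation_diff[OF B] sum_subtractf)

lemma ctrace_scale:
  assumes B: "vec.independent B" and "\<And>b. b \<in> B \<Longrightarrow> f b \<in> vec.span B"
  shows "ctrace B (\<lambda>x. a *s f x) = a * ctrace B f"
  using assms(2) by (simp add: ctrace_def vec.representation_scale[OF B] sum_distrib_left)

lemma ctrace_sum:
  assumes B: "vec.independent B" and "\<And>i b. i \<in> I \<Longrightarrow> b \<in> B \<Longrightarrow> f i b \<in> vec.span B"
  shows "ctrace B (\<lambda>x. \<Sum>i\<in>I. f i x) = (\<Sum>i\<in>I. ctrace B (f i))"
  using assms(2) by (simp add: ctrace_def vec.representation_sum[OF B]) (rule sum.swap)

lemma ctrace_ident:
  assumes "vec.independent B"
  shows "ctrace B (\<lambda>x. x) = of_nat (card B)"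
  using assms by (simp add: ctrace_def vec.representation_basis)

text \<open>Schur's lemma: an eigenspace of S is stable under every c x, so irreducibility makes it
  the whole space.\<close>

lemma schur_scalar:
  fixes S :: "complex ^ 's::finite \<Rightarrow> complex ^ 's"
  assumes S: "clinear S" and comm: "\<And>x \<psi>. x \<in> m \<Longrightarrow> S (c x \<psi>) = c x (S \<psi>)"
    and lin: "\<And>x. x \<in> m \<Longrightarrow> clinear (c x)"
    and irr: "\<And>W. vec.subspace W \<Longrightarrow> (\<And>x \<psi>. x \<in> m \<Longrightarrow> \<psi> \<in> W \<Longrightarrow> c x \<psi> \<in> W) \<Longrightarrow> W = {0} \<or> W = UNIV"
  shows "\<exists>l. \<forall>\<psi>. S \<psi> = l *s \<psi>"
proof -
  have "(axis undefined 1 :: complex ^ 's) \<noteq> 0" by (simp add: axis_eq_0_iff)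
  then obtain x l where x: "x \<noteq> 0" "S x = l *s x"
    using eigenvector_in_invariant_subspace[OF S vec.subspace_UNIV] by blast
  define W where "W = {\<psi>. S \<psi> = l *s \<psi>}"
  have "vec.subspace W"
    unfolding W_def vec.subspace_def
    by (auto simp: clinear_add[OF S] clinear_scale[OF S] clinear_0[OF S] vec.scale_right_distrib vec.scale_left_commute)
  moreover have "c v \<psi> \<in> W" if "v \<in> m" "\<psi> \<in> W" for v \<psi>
    using that by (simp add: W_def comm clinear_scale[OF lin])
  ultimately have "W = UNIV" using irr[of W] x by (auto simp: W_def)
  then show ?thesis by (auto simp: W_def)
qed

section \<open>Positive roots generated by simple reflections\<close>

text \<open>With A j i the value of the j-th simple root on the i-th simple coroot, this is the
  value on that coroot of the root with coordinates k.\<close>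

definition pairing :: "(nat \<Rightarrow> nat \<Rightarrow> int) \<Rightarrow> nat \<Rightarrow> (nat \<Rightarrow> int) \<Rightarrow> nat \<Rightarrow> int" where
  "pairing A n k i = (\<Sum>j=1..n. k j * A j i)"

definition simple_reflection :: "(nat \<Rightarrow> nat \<Rightarrow> int) \<Rightarrow> nat \<Rightarrow> nat \<Rightarrow> (nat \<Rightarrow> int) \<Rightarrow> nat \<Rightarrow> int" where
  "simple_reflection A n i k = k(i := k i - pairing A n k i)"

definition unit_root :: "nat \<Rightarrow> nat \<Rightarrow> int" where
  "unit_root i = (\<lambda>j. if j = i then 1 else 0)"

inductive_set positive_roots :: "(nat \<Rightarrow> nat \<Rightarrow> int) \<Rightarrow> nat \<Rightarrow> (nat \<Rightarrow> int) set"
  for A :: "nat \<Rightarrow> nat \<Rightarrow> int" and n :: nat where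
  unit: "i \<in> {1..n} \<Longrightarrow> unit_root i \<in> positive_roots A n"
| raise: "k \<in> positive_roots A n \<Longrightarrow> i \<in> {1..n} \<Longrightarrow> pairing A n k i < 0 \<Longrightarrow>
    simple_reflection A n i k \<in> positive_roots A n"

text \<open>A signing is encoded by the set D of vectors with sign +; the vectors of P - D have sign
  -.\<close>

definition zero_sum_splittings :: "(nat \<Rightarrow> int) set \<Rightarrow> (nat \<Rightarrow> int) set set" where
  "zero_sum_splittings P = {D. D \<subseteq> P \<and> (\<forall>i. (\<Sum>k\<in>D. k i) = (\<Sum>k\<in>P - D. k i))}"

lemma pairing_unit_root: "i \<in> {1..n} \<Longrightarrow> pairing A n (unit_root i) j = A i j"
  unfolding pairing_def unit_root_def
  by (subst sum.cong[OF refl, of _ _ "\<lambda>l. if l = i then A l j else 0"]) auto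

lemma pairing_simple_reflection:
  assumes "i \<in> {1..n}"
  shows "pairing A n (simple_reflection A n i k) j = pairing A n k j - pairing A n k i * A i j"
proof -
  have "pairing A n (simple_reflection A n i k) j =
      (\<Sum>l=1..n. k l * A l j - (if l = i then pairing A n k i * A l j else 0))"
    unfolding pairing_def[of A n "simple_reflection A n i k"]
    by (rule sum.cong) (auto simp: simple_reflection_def algebra_simps)
  also have "\<dots> = pairing A n k j - pairing A n k i * A i j"
    using assms by (subst sum_subtractf) (simp add: pairing_def)
  finally show ?thesis .
qed

section \<open>Root space decomposition for a maximal torus\<close>

locale compact_torus =
  fixes br :: "'n::finite bracket" and g h :: "(complex ^ 'n) set"
  assumes lie: "complex_lie_algebra br" and crf: "compact_real_form br g"
    and mta: "maximal_torus_algebra br g h"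
begin

lemma br_clinear: "clinear (br x)" "clinear (\<lambda>x. br x y)"
  using lie by (simp_all add: complex_lie_algebra_def)

lemmas br_r = clinearD[OF br_clinear(1)]
lemmas br_l = clinearD[OF br_clinear(2)]

lemma br_self: "br x x = 0"
  using lie by (simp add: complex_lie_algebra_def)

lemma br_anti: "br x y = - br y x"
proof -
  have "br x y + br y x = 0"
    using br_self[of "x + y"] unfolding br_r(1) br_l(1) by (simp add: br_self add.commute)
  then show ?thesis by (simp only: eq_neg_iff_add_eq_0)
qed

lemma jacobi: "br x (br y z) = br (br x y) z + br y (br x z)"
proof -
  have "br x (br y z) + br y (br z x) + br z (br x y) = 0"
    using lie by (simp add: complex_lie_algebra_def)
  moreover have "br y (br z x) = - br y (br x z)" using br_anti[of z x] by (simp add: br_r)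
  moreover have "br z (br x y) = - br (br x y) z" by (rule br_anti)
  ultimately show ?thesis by (simp add: algebra_simps)
qed

lemma g_subspace: "subspace g" and g_br: "x \<in> g \<Longrightarrow> y \<in> g \<Longrightarrow> br x y \<in> g"
  using crf by (auto simp: compact_real_form_def real_subalgebra_def)

lemma g_smult: "x \<in> g \<Longrightarrow> of_real a *s x \<in> g"
  using subspace_scale[OF g_subspace, of x a] by (simp add: scaleR_eq_vector_smult)

lemmas g_closed = subspace_add[OF g_subspace] subspace_diff[OF g_subspace]
  subspace_0[OF g_subspace] subspace_neg[OF g_subspace] g_br g_smult

section \<open>The conjugation whose fixed points are the compact form\<close>

definition parts :: "complex ^ 'n \<Rightarrow> (complex ^ 'n) \<times> (complex ^ 'n)" where
  "parts z = (THE (x, y). x \<in> g \<and> y \<in> g \<and> z = x + \<i> *s y)"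

lemma parts_unique: "\<exists>!(x, y). x \<in> g \<and> y \<in> g \<and> z = x + \<i> *s y"
  using crf by (simp add: compact_real_form_def)

lemma parts_eqI: "p \<in> g \<Longrightarrow> q \<in> g \<Longrightarrow> parts (p + \<i> *s q) = (p, q)"
  unfolding parts_def by (rule the1_equality[OF parts_unique]) auto

lemma g_decomp: obtains p q where "p \<in> g" "q \<in> g" "z = p + \<i> *s q"
  using parts_unique[of z] by auto

definition cjg :: "complex ^ 'n \<Rightarrow> complex ^ 'n" where
  "cjg z = fst (parts z) - \<i> *s snd (parts z)"

lemma cjg_eq: "p \<in> g \<Longrightarrow> q \<in> g \<Longrightarrow> cjg (p + \<i> *s q) = p - \<i> *s q"
  by (simp add: cjg_def parts_eqI)

lemma cjg_add: "cjg (z + w) = cjg z + cjg w"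
proof -
  obtain p q where 1: "p \<in> g" "q \<in> g" "z = p + \<i> *s q" by (rule g_decomp)
  obtain p' q' where 2: "p' \<in> g" "q' \<in> g" "w = p' + \<i> *s q'" by (rule g_decomp)
  have e: "z + w = (p + p') + \<i> *s (q + q')" unfolding 1(3) 2(3) by (simp add: vec_eq_iff algebra_simps)
  have "cjg (z + w) = (p + p') - \<i> *s (q + q')"
    unfolding e by (rule cjg_eq) (intro g_closed 1 2)+
  moreover have "cjg z = p - \<i> *s q" "cjg w = p' - \<i> *s q'" using 1 2 cjg_eq by simp_all
  moreover have "(p + p') - \<i> *s (q + q') = (p - \<i> *s q) + (p' - \<i> *s q')"
    by (simp add: vec_eq_iff algebra_simps)
  ultimately show ?thesis by (simp only:)
qed

lemma cjg_scale: "cjg (a *s z) = cnj a *s cjg z"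
proof -
  obtain p q where 1: "p \<in> g" "q \<in> g" "z = p + \<i> *s q" by (rule g_decomp)
  let ?r = "of_real (Re a) *s p - of_real (Im a) *s q"
  let ?s = "of_real (Re a) *s q + of_real (Im a) *s p"
  have e: "a *s z = ?r + \<i> *s ?s"
    unfolding 1(3) by (simp add: vec_eq_iff complex_eq_iff algebra_simps)
  have "cjg (a *s z) = ?r - \<i> *s ?s"
    unfolding e by (rule cjg_eq) (intro g_closed 1)+
  moreover have "cjg z = p - \<i> *s q" using 1 cjg_eq by simp
  moreover have "?r - \<i> *s ?s = cnj a *s (p - \<i> *s q)"
    by (simp add: vec_eq_iff complex_eq_iff algebra_simps)
  ultimately show ?thesis by (simp only:)
qed

lemma cjg_g: "x \<in> g \<Longrightarrow> cjg x = x"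
  using cjg_eq[of x 0] g_closed by simp

lemma cjg_fixed_in_g: "cjg x = x \<Longrightarrow> x \<in> g"
proof -
  assume *: "cjg x = x"
  obtain p q where 1: "p \<in> g" "q \<in> g" "x = p + \<i> *s q" by (rule g_decomp)
  have "p - \<i> *s q = p + \<i> *s q" using * 1 cjg_eq[OF 1(1,2)] by simp
  then have "q = 0" by (simp add: vec_eq_iff complex_eq_iff)
  then show "x \<in> g" using 1(1,3) by simp
qed

lemma cjg_conj: "cjg (cjg z) = z"
proof -
  obtain p q where 1: "p \<in> g" "q \<in> g" "z = p + \<i> *s q" by (rule g_decomp)
  have e: "cjg z = p + \<i> *s (- q)" using 1 by (simp add: cjg_eq)
  have "cjg (cjg z) = p - \<i> *s (- q)" unfolding e by (rule cjg_eq) (intro g_closed 1)+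
  then show ?thesis unfolding 1(3) by simp
qed

lemma cjg_br: "cjg (br z w) = br (cjg z) (cjg w)"
proof -
  obtain p q where 1: "p \<in> g" "q \<in> g" "z = p + \<i> *s q" by (rule g_decomp)
  obtain p' q' where 2: "p' \<in> g" "q' \<in> g" "w = p' + \<i> *s q'" by (rule g_decomp)
  have e: "br z w = (br p p' - br q q') + \<i> *s (br p q' + br q p')"
    unfolding 1(3) 2(3) by (simp add: br_r br_l vec_eq_iff algebra_simps)
  have "cjg (br z w) = (br p p' - br q q') - \<i> *s (br p q' + br q p')"
    unfolding e by (rule cjg_eq) (intro g_closed 1 2)+
  moreover have "cjg z = p - \<i> *s q" "cjg w = p' - \<i> *s q'" using 1 2 cjg_eq by simp_all
  moreover have "(br p p' - br q q') - \<i> *s (br p q' + br q p') = br (p - \<i> *s q) (p' - \<i> *s q')"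
    by (simp add: br_r br_l vec_eq_iff algebra_simps)
  ultimately show ?thesis by (simp only:)
qed

lemma cjg_0: "cjg 0 = 0" and cjg_neg: "cjg (- z) = - cjg z"
  using cjg_scale[of 0 z] cjg_scale[of "-1" z] by simp_all

lemma cjg_diff: "cjg (z - w) = cjg z - cjg w"
  using cjg_add[of z "- w"] by (simp add: cjg_neg)

lemma cjg_eq_0: "cjg z = 0 \<longleftrightarrow> z = 0"
  using cjg_conj[of z] cjg_0 by auto

text \<open>This is literally the choice made inside \<open>trace_on\<close>, so that
  \<open>killing_form\<close> unfolds to a sum over \<open>gbasis\<close>.\<close>

definition gbasis :: "(complex ^ 'n) set" where
  "gbasis = (SOME B. independent B \<and> span B = g)"

lemma gbasis: "independent gbasis" "span gbasis = g"
proof -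
  obtain B where "B \<subseteq> g" "independent B" "g \<subseteq> span B" by (rule maximal_independent_subset)
  then have "independent B \<and> span B = g" using span_minimal[OF _ g_subspace] by blast
  then have "independent gbasis \<and> span gbasis = g" unfolding gbasis_def by (rule someI)
  then show "independent gbasis" "span gbasis = g" by auto
qed

lemma gbasis_finite: "finite gbasis" using gbasis(1) by (rule independent_imp_finite)

lemma gbasis_g: "b \<in> gbasis \<Longrightarrow> b \<in> g" using gbasis(2) span_superset by blast

text \<open>A complex relation splits into a real and an imaginary part, both in g, and the
  decomposition along g and i g is unique.\<close>

lemma gbasis_cindependent: "vec.independent gbasis"
  unfolding vec.independent_explicit
proof (intro conjI gbasis_finite allI impI ballI)
  fix u b assume 0: "(\<Sum>v\<in>gbasis. u v *s v) = 0" and b: "b \<in> gbasis"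
  let ?p = "\<Sum>v\<in>gbasis. Re (u v) *\<^sub>R v" and ?q = "\<Sum>v\<in>gbasis. Im (u v) *\<^sub>R v"
  have g: "?p \<in> g" "?q \<in> g"
    using gbasis_g by (auto intro!: subspace_sum[OF g_subspace] subspace_scale[OF g_subspace])
  have "(\<Sum>v\<in>gbasis. u v *s v) = ?p + \<i> *s ?q"
    unfolding vec.scale_sum_right sum.distrib[symmetric] scaleR_eq_vector_smult
    by (rule sum.cong) (auto simp: vec_eq_iff complex_eq_iff algebra_simps)
  then have "?p + \<i> *s ?q = 0 + \<i> *s 0" using 0 by simp
  then have "(?p, ?q) = (0, 0)"
    using parts_eqI[OF g] parts_eqI[OF g_closed(3) g_closed(3)] by (simp only:)
  then have "Re (u b) = 0" "Im (u b) = 0"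
    using independentD[OF gbasis(1) gbasis_finite order.refl _ b] by auto
  then show "u b = 0" by (simp add: complex_eq_iff)
qed

lemma gbasis_combination:
  assumes "x \<in> g"
  shows "x = (\<Sum>b\<in>gbasis. of_real (representation gbasis x b) *s b)"
proof -
  have "x = (\<Sum>b\<in>gbasis. representation gbasis x b *\<^sub>R b)"
    using assms gbasis(2) by (intro sum_representation_eq[OF gbasis(1) _ gbasis_finite order.refl, symmetric]) simp
  then show ?thesis by (simp only: scaleR_eq_vector_smult)
qed

lemma gbasis_cspan: "vec.span gbasis = UNIV"
proof -
  have *: "x \<in> vec.span gbasis" if "x \<in> g" for x
    by (subst gbasis_combination[OF that]) (intro vec.span_sum vec.span_scale vec.span_base)
  have "z \<in> vec.span gbasis" for z
    by (rule g_decomp[of z]) (simp only:, intro vec.span_add vec.span_scale *)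
  then show ?thesis by blast
qed

text \<open>Real coordinates of a vector of g are also its complex coordinates. This turns the real
  trace in \<open>killing_form\<close> into a complex one.\<close>

lemma gbasis_representation:
  assumes "x \<in> g" "c \<in> gbasis"
  shows "vec.representation gbasis x c = of_real (representation gbasis x c)"
proof -
  have "vec.representation gbasis x c =
      (\<Sum>b\<in>gbasis. of_real (representation gbasis x b) * vec.representation gbasis b c)"
    by (subst arg_cong[OF gbasis_combination[OF assms(1)], of "\<lambda>y. vec.representation gbasis y c"])
      (simp add: vec.representation_sum[OF gbasis_cindependent] vec.representation_scale[OF gbasis_cindependent] gbasis_cspan)
  also have "\<dots> = (\<Sum>b\<in>gbasis. if b = c then of_real (representation gbasis x b) else 0)"
    by (rule sum.cong) (auto simp: vec.representation_basis[OF gbasis_cindependent])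
  finally show ?thesis using assms gbasis_finite by simp
qed

section \<open>The complex Killing form and its Hermitian version\<close>

definition kil :: "complex ^ 'n \<Rightarrow> complex ^ 'n \<Rightarrow> complex" where
  "kil z w = ctrace gbasis (\<lambda>u. br z (br w u))"

lemmas tr_add = ctrace_add[OF gbasis_cindependent, unfolded gbasis_cspan, OF UNIV_I UNIV_I]
lemmas tr_diff = ctrace_diff[OF gbasis_cindependent, unfolded gbasis_cspan, OF UNIV_I UNIV_I]
lemmas tr_scale = ctrace_scale[OF gbasis_cindependent, unfolded gbasis_cspan, OF UNIV_I]
lemmas tr_commute = ctrace_commute[OF gbasis_cindependent _ _, unfolded gbasis_cspan, OF _ _ UNIV_I UNIV_I]

lemma kil_sym: "kil z w = kil w z"
  unfolding kil_def by (rule tr_commute) (rule br_clinear)+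

lemma kil_l: "kil (x + y) w = kil x w + kil y w" "kil (a *s x) w = a * kil x w"
  "kil 0 w = 0" "kil (- x) w = - kil x w" "kil (x - y) w = kil x w - kil y w"
  "kil (sum u I) w = (\<Sum>i\<in>I. kil (u i) w)"
proof -
  show 1: "kil (x + y) w = kil x w + kil y w" for x y
    by (simp add: kil_def br_l tr_add)
  show 2: "kil (a *s x) w = a * kil x w" for a x
    by (simp add: kil_def br_l tr_scale)
  show 3: "kil 0 w = 0" using 2[of 0 0] by simp
  show 4: "kil (- x) w = - kil x w" for x using 2[of "-1" x] by simp
  show "kil (x - y) w = kil x w - kil y w" using 1[of x "-y"] 4[of y] by simp
  show "kil (sum u I) w = (\<Sum>i\<in>I. kil (u i) w)"
    by (induction I rule: infinite_finite_induct) (simp_all add: 1 3)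
qed

lemma kil_r: "kil w (x + y) = kil w x + kil w y" "kil w (a *s x) = a * kil w x"
  "kil w 0 = 0" "kil w (- x) = - kil w x" "kil w (x - y) = kil w x - kil w y"
  using kil_l(1)[of x y w] kil_l(2)[of a x w] kil_l(3)[of w] kil_l(4)[of x w] kil_l(5)[of x y w]
  by (simp_all only: kil_sym)

text \<open>By Jacobi, bracketing with \<open>br x y\<close> is the commutator of the two brackets;
  cyclicity of the trace moves x across.\<close>

lemma kil_invariant: "kil (br x y) z = kil x (br y z)"
proof -
  have *: "br (br x y) u = br x (br y u) - br y (br x u)" for x y u
    using jacobi[of x y u] by simp
  have cl: "clinear (\<lambda>u. br x (br z u))"
    by (simp add: clinear_iff br_r)
  have "ctrace gbasis (\<lambda>u. br y (br x (br z u))) = ctrace gbasis (\<lambda>u. br x (br z (br y u)))"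
    by (rule tr_commute[OF br_clinear(1) cl])
  then show ?thesis
    by (simp add: kil_def * br_r tr_diff)
qed

lemma kil_g:
  assumes "x \<in> g" "y \<in> g"
  shows "kil x y = of_real (killing_form br g x y)"
proof -
  have "kil x y = (\<Sum>b\<in>gbasis. of_real (representation gbasis (br x (br y b)) b))"
    unfolding kil_def ctrace_def
    by (rule sum.cong[OF refl gbasis_representation]) (intro g_br assms gbasis_g)
  then show ?thesis
    by (simp add: killing_form_def trace_on_def gbasis_def Let_def)
qed

lemma killing_neg: "x \<in> g \<Longrightarrow> x \<noteq> 0 \<Longrightarrow> killing_form br g x x < 0"
  using crf by (simp add: compact_real_form_def)

lemma kil_conj: "kil (cjg z) (cjg w) = cnj (kil z w)"
proof -
  obtain p q where 1: "p \<in> g" "q \<in> g" "z = p + \<i> *s q" by (rule g_decomp)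
  obtain p' q' where 2: "p' \<in> g" "q' \<in> g" "w = p' + \<i> *s q'" by (rule g_decomp)
  show ?thesis using 1 2
    by (simp add: cjg_eq kil_l kil_r kil_g algebra_simps)
qed

text \<open>The sesquilinear extension of minus the Killing form of g. It is positive definite by
  compactness, and elements of g act by skew-Hermitian operators.\<close>

definition herm :: "complex ^ 'n \<Rightarrow> complex ^ 'n \<Rightarrow> complex" where
  "herm z w = - kil z (cjg w)"

lemma herm_l: "herm (x + y) w = herm x w + herm y w" "herm (a *s x) w = a * herm x w"
  "herm 0 w = 0" "herm (- x) w = - herm x w" "herm (x - y) w = herm x w - herm y w"
  "herm (sum u I) w = (\<Sum>i\<in>I. herm (u i) w)"
  by (simp_all add: herm_def kil_l sum_negf)

lemma herm_r: "herm w (x + y) = herm w x + herm w y" "herm w (a *s x) = cnj a * herm w x"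
  "herm w 0 = 0" "herm w (- x) = - herm w x" "herm w (x - y) = herm w x - herm w y"
  by (simp_all add: herm_def kil_r cjg_add cjg_scale cjg_0 cjg_neg cjg_diff)

lemma herm_cnj: "herm w z = cnj (herm z w)"
  using kil_conj[of z "cjg w"] kil_sym[of w "cjg z"] by (simp add: herm_def cjg_conj)

lemma herm_pos: assumes "z \<noteq> 0" shows "\<exists>r>0. herm z z = of_real r"
proof -
  obtain p q where 1: "p \<in> g" "q \<in> g" "z = p + \<i> *s q" by (rule g_decomp)
  have "herm z z = of_real (- killing_form br g p p - killing_form br g q q)"
    using 1 kil_sym[of p q] by (simp add: herm_def cjg_eq kil_l kil_r kil_g algebra_simps)
  moreover have "killing_form br g 0 0 = 0"
    using kil_g[of 0 0] kil_l(3)[of 0] g_closed(3) by simp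
  then have "killing_form br g x x \<le> 0" if "x \<in> g" for x
    using killing_neg[OF that] by (cases "x = 0") auto
  then have "killing_form br g p p \<le> 0" "killing_form br g q q \<le> 0" using 1 by auto
  moreover have "p \<noteq> 0 \<or> q \<noteq> 0" using 1 assms by auto
  then have "killing_form br g p p < 0 \<or> killing_form br g q q < 0"
    using 1 killing_neg by blast
  ultimately show ?thesis by (intro exI[of _ "- killing_form br g p p - killing_form br g q q"]) auto
qed

lemma herm_eq_0: "herm z z = 0 \<longleftrightarrow> z = 0"
  using herm_pos[of z] herm_l(3) by fastforce

lemma herm_br: "t \<in> g \<Longrightarrow> herm (br t z) w = - herm z (br t w)"
  using kil_invariant[of z t "cjg w"] br_anti[of t z]
  by (simp add: herm_def cjg_br cjg_g kil_l)

text \<open>For a basis B of W, the map T z = sum of herm z b times b over B has kernel the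
  orthogonal complement of W. It is injective on W, hence maps W onto itself; so some w in W has the
  same image as a given u outside W, and u - w is orthogonal to W.\<close>

lemma orthogonal_vector_exists:
  assumes W: "vec.subspace W" "W \<noteq> UNIV"
  shows "\<exists>z. z \<noteq> 0 \<and> (\<forall>w\<in>W. herm z w = 0)"
proof -
  obtain B where B: "B \<subseteq> W" "vec.independent B" "W \<subseteq> vec.span B"
    by (rule vec.maximal_independent_subset)
  have WB: "W = vec.span B" using B W vec.span_minimal by blast
  have fin: "finite B" using B vec.finiteI_independent by blast
  define T where "T z = (\<Sum>b\<in>B. herm z b *s b)" for z
  have T: "clinear T"
    unfolding clinear_iff T_def
    by (simp add: herm_l vec.scale_left_distrib sum.distrib vec.scale_sum_right)
  have TW: "T z \<in> W" for z
    unfolding T_def WB by (intro vec.span_sum vec.span_scale vec.span_base)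
  have T0: "\<forall>w\<in>W. herm z w = 0" if "T z = 0" for z
  proof
    have b: "herm z b = 0" if "b \<in> B" for b
      using vec.independentD[OF B(2) fin order.refl, of "herm z"] that \<open>T z = 0\<close> unfolding T_def by auto
    fix w assume "w \<in> W"
    then have "w \<in> vec.span B" using WB by simp
    then show "herm z w = 0"
      by (induction rule: vec.span_induct_alt) (simp_all add: herm_r b)
  qed
  have inj: "inj_on T (vec.span W)"
  proof (rule inj_onI)
    fix x y assume "x \<in> vec.span W" "y \<in> vec.span W" and e: "T x = T y"
    then have xy: "x - y \<in> W" using W by (metis vec.span_eq_iff vec.subspace_diff)
    have "T (x - y) = 0" using e by (simp add: clinear_diff[OF T])
    then show "x = y" using T0 xy herm_eq_0[of "x - y"] by auto
  qed
  have "T ` W = W"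
  proof (rule vec.subspace_dim_equal)
    show "vec.subspace (T ` W)" using vec.linear_subspace_image[OF T W(1)] .
    show "vec.dim (T ` W) \<ge> vec.dim W" using vec.dim_image_eq[OF T inj] by simp
  qed (use W TW in auto)
  obtain u where u: "u \<notin> W" using W by auto
  obtain w where w: "w \<in> W" "T w = T u" using TW[of u] \<open>T ` W = W\<close> by (metis imageE)
  have "T (u - w) = 0" using w by (simp add: clinear_diff[OF T])
  moreover have "u - w \<noteq> 0" using u w by auto
  ultimately show ?thesis using T0 by blast
qed

section \<open>Weights of the torus\<close>

lemma h_g: "t \<in> h \<Longrightarrow> t \<in> g"
  and h_commute: "s \<in> h \<Longrightarrow> t \<in> h \<Longrightarrow> br s t = 0"
  using mta by (auto simp: maximal_torus_algebra_def abelian_subalgebra_def real_subalgebra_def)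

lemma h_maximal: "abelian_subalgebra br h' \<Longrightarrow> h \<subseteq> h' \<Longrightarrow> h' \<subseteq> g \<Longrightarrow> h' = h"
  using mta by (auto simp: maximal_torus_algebra_def)

text \<open>If some t in h is not scalar on U, an eigenspace of t in U is proper and nonzero, and it
  is stable under h because h is commutative; the dimension drops.\<close>

lemma common_eigenvector:
  assumes "vec.subspace U" "\<And>t x. t \<in> h \<Longrightarrow> x \<in> U \<Longrightarrow> br t x \<in> U" "U \<noteq> {0}"
  shows "\<exists>x\<in>U. x \<noteq> 0 \<and> (\<forall>t\<in>h. \<exists>l. br t x = l *s x)"
  using assms
proof (induction "vec.dim U" arbitrary: U rule: less_induct)
  case less
  obtain v where v: "v \<in> U" "v \<noteq> 0" using less.prems vec.subspace_0 by blast
  show ?case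
  proof (cases "\<forall>t\<in>h. \<exists>l. \<forall>x\<in>U. br t x = l *s x")
    case True
    then show ?thesis using v by blast
  next
    case False
    then obtain t where t: "t \<in> h" "\<And>l. \<exists>x\<in>U. br t x \<noteq> l *s x" by blast
    obtain x l where x: "x \<in> U" "x \<noteq> 0" "br t x = l *s x"
      using eigenvector_in_invariant_subspace[OF br_clinear(1) less.prems(1) _ v, of t] less.prems(2)[OF t(1)] by blast
    define U' where "U' = {x \<in> U. br t x = l *s x}"
    have sub: "vec.subspace U'"
      using less.prems(1) unfolding U'_def vec.subspace_def
      by (auto simp: br_r vec.scale_right_distrib vec.scale_left_commute)
    have inv: "br s y \<in> U'" if "s \<in> h" "y \<in> U'" for s y
    proof -
      have "br t (br s y) = br s (br t y)"
        using jacobi[of t s y] h_commute[OF t(1) that(1)] by (simp add: br_l)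
      then show ?thesis using that less.prems(2) by (auto simp: U'_def br_r)
    qed
    have "U' \<subset> U" using t(2)[of l] by (auto simp: U'_def)
    then have "vec.dim U' < vec.dim U"
      using vec.dim_psubset[of U' U] sub less.prems(1) by (metis vec.span_eq_iff)
    moreover have "U' \<noteq> {0}" using x by (auto simp: U'_def)
    ultimately have "\<exists>x\<in>U'. x \<noteq> 0 \<and> (\<forall>t\<in>h. \<exists>l. br t x = l *s x)"
      using less.hyps[OF _ sub inv] by blast
    then show ?thesis by (auto simp: U'_def)
  qed
qed

definition H :: "(complex ^ 'n) set" where "H = vec.span h"

lemma h_H: "t \<in> h \<Longrightarrow> t \<in> H" and H_subspace: "vec.subspace H"
  by (auto simp: H_def vec.span_base)

text \<open>Otherwise the orthogonal complement of the span is nonzero. It is stable under h by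
  skewness, so it contains a joint eigenvector, which would be orthogonal to itself.\<close>

lemma weight_vectors_span: "vec.span {x. \<forall>t\<in>h. \<exists>l. br t x = l *s x} = UNIV"
proof (rule ccontr)
  define W where "W = vec.span {x. \<forall>t\<in>h. \<exists>l. br t x = l *s x}"
  assume "\<not> ?thesis"
  then obtain z where z: "z \<noteq> 0" "\<forall>w\<in>W. herm z w = 0"
    using orthogonal_vector_exists[of W] by (auto simp: W_def)
  have W: "br t w \<in> W" if t: "t \<in> h" and "w \<in> W" for t w
    using that(2) unfolding W_def
  proof (induction rule: vec.span_induct_alt)
    case base
    then show ?case by (simp add: br_r vec.span_zero)
  next
    case (step c x y)
    obtain l where l: "br t x = l *s x" using step(1) t by auto
    have "x \<in> vec.span {x. \<forall>t\<in>h. \<exists>l. br t x = l *s x}" using step(1) by (rule vec.span_base)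
    then show ?case unfolding br_r(1,2) l by (intro vec.span_add vec.span_scale step(2))
  qed
  let ?U = "{z. \<forall>w\<in>W. herm z w = 0}"
  have "\<exists>x\<in>?U. x \<noteq> 0 \<and> (\<forall>t\<in>h. \<exists>l. br t x = l *s x)"
  proof (rule common_eigenvector)
    show "vec.subspace ?U" by (auto simp: vec.subspace_def herm_l)
    show "br t x \<in> ?U" if "t \<in> h" "x \<in> ?U" for t x
      using that W h_g by (auto simp: herm_br)
  qed (use z in auto)
  then obtain x where "x \<in> ?U" "x \<noteq> 0" "x \<in> W"
    unfolding W_def by (blast intro: vec.span_base)
  then show False using herm_eq_0[of x] by blast
qed

text \<open>H is its own centralizer; this is where maximality of the torus enters.\<close>

lemma H_iff: "z \<in> H \<longleftrightarrow> (\<forall>t\<in>h. br t z = 0)"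
proof
  assume z: "z \<in> H"
  show "\<forall>t\<in>h. br t z = 0"
  proof
    fix t assume t: "t \<in> h"
    show "br t z = 0" using z unfolding H_def
      by (induction rule: vec.span_induct_alt) (simp_all add: br_r h_commute[OF t])
  qed
next
  assume z: "\<forall>t\<in>h. br t z = 0"
  have *: "p \<in> h" if p: "p \<in> g" "\<forall>t\<in>h. br t p = 0" for p
  proof -
    \<comment> \<open>Adjoining an element of g that commutes with h leaves the subalgebra abelian,
      so maximality puts it into h.\<close>
    let ?h = "span (insert p h)"
    have "br x y = 0" if "x \<in> insert p h" "y \<in> insert p h" for x y
      using that p(2) h_commute br_self br_anti[of p] by auto
    note 0 = this
    have 1: "br x y = 0" if "x \<in> insert p h" "y \<in> ?h" for x y
      using that(2)
      by (induction rule: span_induct_alt) (simp_all add: br_r 0[OF that(1)] clinear_scaleR[OF br_clinear(1)])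
    have 2: "br x y = 0" if "x \<in> ?h" "y \<in> ?h" for x y
      using that(1)
      by (induction rule: span_induct_alt) (simp_all add: br_l 1 that(2) clinear_scaleR[OF br_clinear(2)])
    have "abelian_subalgebra br ?h"
      unfolding abelian_subalgebra_def real_subalgebra_def using 2 by (simp add: span_zero)
    moreover have "?h \<subseteq> g"
      using p h_g by (intro span_minimal[OF _ g_subspace]) auto
    moreover have "h \<subseteq> ?h" by (meson span_superset subset_insertI subset_trans)
    ultimately have "?h = h" by (intro h_maximal)
    then show "p \<in> h" using span_base[of p "insert p h"] by simp
  qed
  obtain p q where 1: "p \<in> g" "q \<in> g" "z = p + \<i> *s q" by (rule g_decomp)
  \<comment> \<open>Bracketing with t preserves g, so the real and the imaginary part of br t z
    vanish separately.\<close>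
  have "br t p = 0 \<and> br t q = 0" if "t \<in> h" for t
  proof -
    have "br t p + \<i> *s br t q = 0 + \<i> *s 0" using z that 1 by (simp add: br_r)
    then have "(br t p, br t q) = (0, 0)"
      using parts_eqI[OF g_br[OF h_g[OF that] 1(1)] g_br[OF h_g[OF that] 1(2)]]
        parts_eqI[OF g_closed(3) g_closed(3)] by (simp only:)
    then show ?thesis by simp
  qed
  then have "p \<in> h" "q \<in> h" using * 1 by auto
  then show "z \<in> H" unfolding 1(3) H_def by (intro vec.span_add vec.span_scale vec.span_base)
qed

lemma conj_H: "t \<in> H \<Longrightarrow> cjg t \<in> H"
  unfolding H_iff
proof
  fix s assume t: "\<forall>s\<in>h. br s t = 0" and s: "s \<in> h"
  have "br s (cjg t) = cjg (br s t)" using s by (simp add: cjg_br cjg_g h_g)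
  then show "br s (cjg t) = 0" using t s by (simp add: cjg_0)
qed

abbreviation ws :: "(complex ^ 'n \<Rightarrow> complex) \<Rightarrow> (complex ^ 'n) set" where
  "ws \<equiv> root_space br H"

lemma wsD: "x \<in> ws l \<Longrightarrow> t \<in> H \<Longrightarrow> br t x = l t *s x"
  by (simp add: root_space_def)

lemma ws_subspace: "vec.subspace (ws l)"
  by (auto simp: vec.subspace_def root_space_def br_r vec.scale_right_distrib vec.scale_left_commute)

text \<open>Unlike \<open>roots\<close>, this admits the zero functional, so that linearity,
  orthogonality and finiteness also cover H itself.\<close>

definition weights :: "(complex ^ 'n \<Rightarrow> complex) set" where
  "weights = {l. (\<forall>t. t \<notin> H \<longrightarrow> l t = 0) \<and> ws l \<noteq> {0}}"

lemma roots_weights: "\<alpha> \<in> roots br H \<Longrightarrow> \<alpha> \<in> weights"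
  by (auto simp: roots_def weights_def)

lemma weights_nonzero: assumes "l \<in> weights" obtains x where "x \<in> ws l" "x \<noteq> 0"
  using assms vec.subspace_0[OF ws_subspace[of l]] unfolding weights_def by blast

lemma weightsI: "(\<And>t. t \<notin> H \<Longrightarrow> l t = 0) \<Longrightarrow> x \<in> ws l \<Longrightarrow> x \<noteq> 0 \<Longrightarrow> l \<in> weights"
  unfolding weights_def by blast

lemma rootsI: "l \<in> weights \<Longrightarrow> t \<in> H \<Longrightarrow> l t \<noteq> 0 \<Longrightarrow> l \<in> roots br H"
  unfolding weights_def roots_def by blast

lemma weight_linear:
  assumes "l \<in> weights"
  shows weight_add: "s \<in> H \<Longrightarrow> t \<in> H \<Longrightarrow> l (s + t) = l s + l t"
    and weight_scale: "t \<in> H \<Longrightarrow> l (a *s t) = a * l t"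
proof -
  obtain x where x: "x \<in> ws l" "x \<noteq> 0" using weights_nonzero[OF assms] .
  show "l (s + t) = l s + l t" if "s \<in> H" "t \<in> H"
  proof -
    have "l (s + t) *s x = (l s + l t) *s x"
      using wsD[OF x(1)] that vec.subspace_add[OF H_subspace that]
      by (metis br_l(1) vec.scale_left_distrib)
    then show ?thesis using x(2) by (simp only: vec.scale_cancel_right simp_thms)
  qed
  show "l (a *s t) = a * l t" if "t \<in> H"
  proof -
    have "l (a *s t) *s x = (a * l t) *s x"
      using wsD[OF x(1)] that vec.subspace_scale[OF H_subspace that]
      by (metis br_l(2) vec.scale_scale)
    then show ?thesis using x(2) by (simp only: vec.scale_cancel_right simp_thms)
  qed
qed

lemma weight_0: "l \<in> weights \<Longrightarrow> l 0 = 0"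
  using weight_scale[of l 0 0] vec.subspace_0[OF H_subspace] by simp

text \<open>Eigenvalues of a skew-Hermitian operator are imaginary.\<close>

lemma weight_skew:
  assumes "l \<in> weights" "t \<in> h" shows "cnj (l t) = - l t"
proof -
  obtain x where x: "x \<in> ws l" "x \<noteq> 0" using weights_nonzero[OF assms(1)] .
  have "l t * herm x x = - (cnj (l t) * herm x x)"
    using herm_br[OF h_g[OF assms(2)], of x x] wsD[OF x(1) h_H[OF assms(2)]] by (simp add: herm_l herm_r)
  then have "(l t + cnj (l t)) * herm x x = 0" by (simp add: algebra_simps)
  then show ?thesis using x herm_eq_0[of x] by (simp add: add_eq_0_iff)
qed

lemma weight_conj:
  assumes "l \<in> weights" "t \<in> H" shows "cnj (l (cjg t)) = - l t"
proof -
  have "t \<in> H \<and> cnj (l (cjg t)) = - l t"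
    using assms(2)[unfolded H_def]
  proof (induction rule: vec.span_induct_alt)
    case base
    then show ?case by (simp add: cjg_0 weight_0[OF assms(1)] vec.subspace_0[OF H_subspace])
  next
    case (step c x y)
    then show ?case
      using weight_skew[OF assms(1), of x] h_H[of x] h_g[of x]
      by (simp add: cjg_add cjg_scale cjg_g weight_add[OF assms(1)] weight_scale[OF assms(1)]
          vec.subspace_add[OF H_subspace] vec.subspace_scale[OF H_subspace] conj_H)
  qed
  then show ?thesis by simp
qed

lemma weight_ext:
  assumes "l \<in> weights" "l' \<in> weights" "\<And>t. t \<in> h \<Longrightarrow> l t = l' t"
  shows "l = l'"
proof
  fix t
  show "l t = l' t"
  proof (cases "t \<in> H")
    case True
    have "t \<in> H \<and> l t = l' t"
      using True[unfolded H_def]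
    proof (induction rule: vec.span_induct_alt)
      case base
      then show ?case by (simp add: weight_0[OF assms(1)] weight_0[OF assms(2)] vec.subspace_0[OF H_subspace])
    next
      case (step c x y)
      then show ?case
        by (simp add: assms(3) h_H weight_add[OF assms(1)] weight_scale[OF assms(1)] weight_add[OF assms(2)]
          weight_scale[OF assms(2)] vec.subspace_add[OF H_subspace] vec.subspace_scale[OF H_subspace])
    qed
    then show ?thesis by simp
  next
    case False
    then show ?thesis using assms by (auto simp: weights_def)
  qed
qed

lemma ws_orthogonal:
  assumes l: "l \<in> weights" "l' \<in> weights" "l \<noteq> l'" and x: "x \<in> ws l" and y: "y \<in> ws l'"
  shows "herm x y = 0"
proof -
  obtain t where t: "t \<in> h" "l t \<noteq> l' t" using weight_ext[OF l(1,2)] l(3) by blast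
  have "l t * herm x y = l' t * herm x y"
    using herm_br[OF h_g[OF t(1)], of x y] wsD[OF x h_H[OF t(1)]] wsD[OF y h_H[OF t(1)]]
      weight_skew[OF l(2) t(1)] by (simp add: herm_l herm_r)
  then show ?thesis using t by simp
qed

lemma ws_conj:
  assumes "l \<in> weights" "x \<in> ws l"
  shows "cjg x \<in> ws (\<lambda>t. - l t)"
  unfolding root_space_def
proof (intro CollectI ballI)
  fix t assume t: "t \<in> H"
  have "br t (cjg x) = cjg (br (cjg t) x)" by (simp add: cjg_br cjg_conj)
  also have "\<dots> = cnj (l (cjg t)) *s cjg x" using wsD[OF assms(2) conj_H[OF t]] by (simp add: cjg_scale)
  finally show "br t (cjg x) = - l t *s cjg x" using weight_conj[OF assms(1) t] by simp
qed

lemma weights_neg: "l \<in> weights \<Longrightarrow> (\<lambda>t. - l t) \<in> weights"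
proof -
  assume l: "l \<in> weights"
  obtain x where "x \<in> ws l" "x \<noteq> 0" using weights_nonzero[OF l] .
  then have "cjg x \<in> ws (\<lambda>t. - l t)" "cjg x \<noteq> 0" using ws_conj[OF l] cjg_eq_0 by auto
  moreover have "- l t = 0" if "t \<notin> H" for t using l that by (simp add: weights_def)
  ultimately show ?thesis by (intro weightsI)
qed

lemma roots_neg: "\<alpha> \<in> roots br H \<Longrightarrow> (\<lambda>t. - \<alpha> t) \<in> roots br H"
proof -
  assume a: "\<alpha> \<in> roots br H"
  then obtain t where "t \<in> H" "\<alpha> t \<noteq> 0" by (auto simp: roots_def)
  then show "(\<lambda>t. - \<alpha> t) \<in> roots br H" using rootsI[OF weights_neg[OF roots_weights[OF a]]] by simp
qed

lemma orthogonal_independent: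
  assumes "\<And>x y. x \<in> S \<Longrightarrow> y \<in> S \<Longrightarrow> x \<noteq> y \<Longrightarrow> herm x y = 0" "0 \<notin> S"
  shows "vec.independent S"
  unfolding vec.dependent_explicit
proof clarify
  fix T u v assume T: "finite T" "T \<subseteq> S" "(\<Sum>v\<in>T. u v *s v) = 0" "v \<in> T" "u v \<noteq> 0"
  have "0 = herm (\<Sum>v\<in>T. u v *s v) v" using T by (simp add: herm_l)
  also have "\<dots> = (\<Sum>w\<in>T. if w = v then u v * herm v v else 0)"
    unfolding herm_l using T assms(1) by (intro sum.cong) auto
  also have "\<dots> = u v * herm v v" using T by simp
  finally show False using T assms(2) herm_eq_0[of v] by auto
qed

text \<open>Weight vectors of different weights are orthogonal; one for each weight gives an
  independent set.\<close>

lemma finite_weights: "finite weights"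
proof -
  define f where "f l = (SOME x. x \<in> ws l \<and> x \<noteq> 0)" for l
  have f: "f l \<in> ws l \<and> f l \<noteq> 0" if "l \<in> weights" for l
    unfolding f_def by (rule someI_ex) (use weights_nonzero[OF that] in blast)
  have inj: "inj_on f weights"
  proof (rule inj_onI, rule ccontr)
    fix l l' assume "l \<in> weights" "l' \<in> weights" "f l = f l'" "l \<noteq> l'"
    then have "herm (f l) (f l) = 0" using ws_orthogonal f by metis
    then show False using herm_eq_0 f \<open>l \<in> weights\<close> by blast
  qed
  have "vec.independent (f ` weights)"
    by (rule orthogonal_independent) (use f ws_orthogonal in force)+
  then show ?thesis using finite_imageD[OF vec.finiteI_independent inj] by blast
qed

lemma ws_br: "x \<in> ws l \<Longrightarrow> y \<in> ws l' \<Longrightarrow> br x y \<in> ws (\<lambda>t. l t + l' t)"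
proof -
  assume x: "x \<in> ws l" and y: "y \<in> ws l'"
  have "br t (br x y) = (l t + l' t) *s br x y" if "t \<in> H" for t
    using wsD[OF x that] wsD[OF y that] jacobi[of t x y]
    by (simp add: br_l br_r vec.scale_left_distrib)
  then show ?thesis by (simp add: root_space_def)
qed

lemma ws_0: "x \<in> ws (\<lambda>t. 0) \<longleftrightarrow> x \<in> H"
proof
  show "x \<in> ws (\<lambda>t. 0) \<Longrightarrow> x \<in> H" using wsD[of x "\<lambda>t. 0"] h_H by (simp add: H_iff)
  assume x: "x \<in> H"
  have "br t x = 0" if "t \<in> H" for t
    using that[unfolded H_def]
    by (induction rule: vec.span_induct_alt) (use x in \<open>simp_all add: br_l H_iff\<close>)
  then show "x \<in> ws (\<lambda>t. 0)" by (simp add: root_space_def)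
qed

lemma weight_not_root: "l \<in> weights \<Longrightarrow> l \<notin> roots br H \<Longrightarrow> l = (\<lambda>t. 0)"
  unfolding weights_def roots_def by blast

text \<open>The eigenvalues of a joint eigenvector form a weight. If it is zero the vector lies in
  H, otherwise in a root space.\<close>

lemma root_decomposition: "vec.span (H \<union> (\<Union>\<alpha>\<in>roots br H. ws \<alpha>)) = UNIV"
proof -
  have "x \<in> H \<union> (\<Union>\<alpha>\<in>roots br H. ws \<alpha>)" if x: "\<forall>t\<in>h. \<exists>l. br t x = l *s x" for x
  proof (cases "x = 0")
    case True
    then show ?thesis using vec.subspace_0[OF H_subspace] by simp
  next
    case False
    \<comment> \<open>The elements having x as an eigenvector form a complex subspace, so containing
      h they contain H.\<close>
    have "vec.subspace {t. \<exists>l. br t x = l *s x}"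
      unfolding vec.subspace_def
    proof (intro conjI allI impI ballI)
      show "0 \<in> {t. \<exists>l. br t x = l *s x}" by (auto simp: br_l intro: exI[of _ 0])
    next
      fix s t assume "s \<in> {t. \<exists>l. br t x = l *s x}" "t \<in> {t. \<exists>l. br t x = l *s x}"
      then obtain a b where "br s x = a *s x" "br t x = b *s x" by auto
      then have "br (s + t) x = (a + b) *s x" by (simp add: br_l vec.scale_left_distrib)
      then show "s + t \<in> {t. \<exists>l. br t x = l *s x}" by blast
    next
      fix c t assume "t \<in> {t. \<exists>l. br t x = l *s x}"
      then obtain a where "br t x = a *s x" by auto
      then have "br (c *s t) x = (c * a) *s x" by (simp add: br_l)
      then show "c *s t \<in> {t. \<exists>l. br t x = l *s x}" by blast
    qed
    then have "H \<subseteq> {t. \<exists>l. br t x = l *s x}"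
      unfolding H_def using x by (intro vec.span_minimal) auto
    then have "\<forall>t. \<exists>l. t \<in> H \<longrightarrow> br t x = l *s x" by blast
    then obtain l where l: "\<And>t. t \<in> H \<Longrightarrow> br t x = l t *s x" by metis
    define l' where "l' = (\<lambda>t. if t \<in> H then l t else 0)"
    have xl: "x \<in> ws l'" by (simp add: root_space_def l'_def l)
    then have "l' \<in> weights" using False by (intro weightsI) (auto simp: l'_def)
    then show ?thesis using weight_not_root[of l'] xl ws_0 by blast
  qed
  then have "vec.span {x. \<forall>t\<in>h. \<exists>l. br t x = l *s x} \<subseteq> vec.span (H \<union> (\<Union>\<alpha>\<in>roots br H. ws \<alpha>))"
    by (intro vec.span_mono) blast
  then show ?thesis using weight_vectors_span by blast
qed

end

section \<open>Root vectors, coroots and sl(2)-chains\<close>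

context compact_torus
begin

lemma kil_nondegenerate:
  assumes "s \<in> H" "\<And>t. t \<in> H \<Longrightarrow> kil s t = 0" shows "s = 0"
  using assms(2)[OF conj_H[OF assms(1)]] herm_eq_0[of s] by (simp add: herm_def)

text \<open>The element of H that represents the root through the Killing form, usually written
  \<open>t\<^sub>\<alpha>\<close>.\<close>

definition root_vec :: "(complex ^ 'n \<Rightarrow> complex) \<Rightarrow> complex ^ 'n" where
  "root_vec \<alpha> = (THE t. t \<in> H \<and> (\<forall>s\<in>H. kil t s = \<alpha> s))"

lemma root_vec_eqI:
  assumes "t \<in> H" "\<And>s. s \<in> H \<Longrightarrow> kil t s = \<alpha> s"
  shows "root_vec \<alpha> = t"
  unfolding root_vec_def
proof (rule the_equality)
  fix t' assume t': "t' \<in> H \<and> (\<forall>s\<in>H. kil t' s = \<alpha> s)"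
  then have "t' - t = 0"
    using assms by (intro kil_nondegenerate) (auto simp: kil_l vec.subspace_diff[OF H_subspace])
  then show "t' = t" by simp
qed (use assms in auto)

lemma ws_br_H:
  assumes "x \<in> ws \<alpha>" "y \<in> ws (\<lambda>t. - \<alpha> t)" shows "br x y \<in> H"
  using ws_br[OF assms] ws_0 by simp

lemma kil_br_H:
  assumes "y \<in> ws (\<lambda>t. - \<alpha> t)" "t \<in> H"
  shows "kil (br x y) t = \<alpha> t * kil x y"
proof -
  have "br y t = \<alpha> t *s y" using br_anti[of y t] wsD[OF assms] by simp
  then show ?thesis by (simp add: kil_invariant kil_r)
qed

lemma kil_conj_neq_0: "x \<noteq> 0 \<Longrightarrow> kil x (cjg x) \<noteq> 0"
  using herm_eq_0[of x] by (simp add: herm_def)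

lemma root_vec:
  assumes "\<alpha> \<in> roots br H"
  shows root_vec_H: "root_vec \<alpha> \<in> H" and kil_root_vec: "s \<in> H \<Longrightarrow> kil (root_vec \<alpha>) s = \<alpha> s"
proof -
  obtain x where x: "x \<in> ws \<alpha>" "x \<noteq> 0" using weights_nonzero[OF roots_weights[OF assms]] .
  note y = ws_conj[OF roots_weights[OF assms] x(1)]
  \<comment> \<open>The conjugate of x is an opposite root vector, and kil x (cjg x) = - herm x x is
    nonzero, so the bracket can be normalised.\<close>
  let ?t = "(1 / kil x (cjg x)) *s br x (cjg x)"
  have t: "?t \<in> H" using ws_br_H[OF x(1) y] vec.subspace_scale[OF H_subspace] by blast
  have k: "kil ?t s = \<alpha> s" if "s \<in> H" for s
    using kil_br_H[OF y that] kil_conj_neq_0[OF x(2)] by (simp add: kil_l)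
  have e: "root_vec \<alpha> = ?t" by (rule root_vec_eqI[OF t k])
  show "root_vec \<alpha> \<in> H" "s \<in> H \<Longrightarrow> kil (root_vec \<alpha>) s = \<alpha> s" unfolding e using t k by auto
qed

text \<open>By invariance both sides have the same Killing product with every element of H, and the
  form is nondegenerate there.\<close>

lemma br_opposite:
  assumes "\<alpha> \<in> roots br H" "x \<in> ws \<alpha>" "y \<in> ws (\<lambda>t. - \<alpha> t)"
  shows "br x y = kil x y *s root_vec \<alpha>"
proof -
  have "br x y - kil x y *s root_vec \<alpha> = 0"
    using root_vec[OF assms(1)] ws_br_H[OF assms(2,3)] kil_br_H[OF assms(3)]
    by (intro kil_nondegenerate vec.subspace_diff[OF H_subspace] vec.subspace_scale[OF H_subspace])
      (auto simp: kil_l)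
  then show ?thesis by simp
qed

lemma root_vec_neg:
  assumes "\<alpha> \<in> roots br H" shows "root_vec (\<lambda>t. - \<alpha> t) = - root_vec \<alpha>"
  using root_vec[OF assms] by (intro root_vec_eqI) (auto simp: kil_l vec.subspace_neg[OF H_subspace])

lemma conj_root_vec:
  assumes "\<alpha> \<in> roots br H" shows "cjg (root_vec \<alpha>) = - root_vec \<alpha>"
proof -
  note r = root_vec[OF assms]
  have "cjg (root_vec \<alpha>) + root_vec \<alpha> = 0"
  proof (rule kil_nondegenerate)
    fix t assume t: "t \<in> H"
    have "kil (cjg (root_vec \<alpha>)) t = cnj (\<alpha> (cjg t))"
      using kil_conj[of "root_vec \<alpha>" "cjg t"] r(2)[OF conj_H[OF t]] by (simp add: cjg_conj)
    then show "kil (cjg (root_vec \<alpha>) + root_vec \<alpha>) t = 0"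
      using weight_conj[OF roots_weights[OF assms] t] r(2)[OF t] by (simp add: kil_l)
  qed (use r conj_H vec.subspace_add[OF H_subspace] in auto)
  then show ?thesis by (simp add: eq_neg_iff_add_eq_0)
qed

text \<open>Conjugation negates the dual vector, so the value of the root on it is its Hermitian
  square. All later divisions and sign arguments use this positivity.\<close>

lemma root_norm_pos:
  assumes "\<alpha> \<in> roots br H" shows "\<exists>r>0. \<alpha> (root_vec \<alpha>) = of_real r"
proof -
  note r = root_vec[OF assms]
  have "root_vec \<alpha> \<noteq> 0"
  proof
    assume "root_vec \<alpha> = 0"
    then have "\<alpha> s = 0" if "s \<in> H" for s using r(2)[OF that] by (simp add: kil_l)
    then show False using assms by (auto simp: roots_def)
  qed
  moreover have "\<alpha> (root_vec \<alpha>) = herm (root_vec \<alpha>) (root_vec \<alpha>)"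
    using r by (simp add: herm_def conj_root_vec[OF assms] kil_r)
  ultimately show ?thesis using herm_pos by metis
qed

lemma root_norm_neq_0: "\<alpha> \<in> roots br H \<Longrightarrow> \<alpha> (root_vec \<alpha>) \<noteq> 0"
  using root_norm_pos by force

lemma root_scale: "\<alpha> \<in> roots br H \<Longrightarrow> t \<in> H \<Longrightarrow> \<alpha> (a *s t) = a * \<alpha> t"
  using weight_scale roots_weights by blast

text \<open>All brackets of opposite root vectors are multiples of the dual vector, so the condition
  that the root takes the value 2 picks a unique one.\<close>

lemma coroot_eq:
  assumes "\<alpha> \<in> roots br H"
  shows "coroot br H \<alpha> = (2 / \<alpha> (root_vec \<alpha>)) *s root_vec \<alpha>"
proof -
  let ?S = "{br x y | x y. x \<in> ws \<alpha> \<and> y \<in> ws (\<lambda>t. - \<alpha> t)}"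
  obtain x where x: "x \<in> ws \<alpha>" "x \<noteq> 0" using weights_nonzero[OF roots_weights[OF assms]] .
  note y = ws_conj[OF roots_weights[OF assms] x(1)]
  have "br x (cjg x) \<in> vec.span ?S" using x y by (intro vec.span_base) blast
  then have "(1 / kil x (cjg x)) *s br x (cjg x) \<in> vec.span ?S" by (rule vec.span_scale)
  then have T: "root_vec \<alpha> \<in> vec.span ?S"
    using br_opposite[OF assms x(1) y] kil_conj_neq_0[OF x(2)] by simp
  have S: "\<exists>a. t = a *s root_vec \<alpha>" if "t \<in> vec.span ?S" for t
    using that
  proof (induction rule: vec.span_induct_alt)
    case base
    then show ?case by (intro exI[of _ 0]) simp
  next
    case (step c u v)
    then obtain a b where "u = b *s root_vec \<alpha>" "v = a *s root_vec \<alpha>"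
      using br_opposite[OF assms] by blast
    then show ?case by (intro exI[of _ "c * b + a"]) (simp add: vec.scale_left_distrib)
  qed
  have n: "\<alpha> (a *s root_vec \<alpha>) = a * \<alpha> (root_vec \<alpha>)" for a
    using root_scale[OF assms root_vec_H[OF assms]] .
  note n0 = root_norm_neq_0[OF assms]
  show ?thesis
    unfolding coroot_def
  proof (rule the_equality)
    show "(2 / \<alpha> (root_vec \<alpha>)) *s root_vec \<alpha> \<in> vec.span ?S \<and> \<alpha> ((2 / \<alpha> (root_vec \<alpha>)) *s root_vec \<alpha>) = 2"
      using vec.span_scale[OF T] n n0 by simp
  next
    fix t assume t: "t \<in> vec.span ?S \<and> \<alpha> t = 2"
    then obtain a where a: "t = a *s root_vec \<alpha>" using S by blast
    then have "a * \<alpha> (root_vec \<alpha>) = 2" using t n by simp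
    then show "t = (2 / \<alpha> (root_vec \<alpha>)) *s root_vec \<alpha>" using a n0 by (simp add: field_simps)
  qed
qed

lemma iterated_raising:
  assumes "x \<in> ws \<alpha>" "z \<in> ws l"
  shows "(br x ^^ j) z \<in> ws (\<lambda>t. l t + of_nat j * \<alpha> t)"
proof (induction j)
  case (Suc j)
  have "(\<lambda>t. \<alpha> t + (l t + of_nat j * \<alpha> t)) = (\<lambda>t. l t + of_nat (Suc j) * \<alpha> t)"
    by (rule ext) (simp add: algebra_simps)
  then show ?case using ws_br[OF assms(1) Suc.IH] by simp
qed (use assms in simp)

text \<open>The commutation relation of a highest weight vector in an sl(2)-module; the coefficient vanishes
  only when \<open>2 l(t\<^sub>\<alpha>) = j \<alpha>(t\<^sub>\<alpha>)\<close>.\<close>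

lemma lowering_chain:
  assumes \<alpha>: "\<alpha> \<in> roots br H" and x: "x \<in> ws \<alpha>" and y: "y \<in> ws (\<lambda>t. - \<alpha> t)"
    and z: "z \<in> ws l" "br x z = 0"
  shows "br x ((br y ^^ Suc j) z) =
    (kil x y * of_nat (Suc j) * (l (root_vec \<alpha>) - of_nat j / 2 * \<alpha> (root_vec \<alpha>))) *s (br y ^^ j) z"
proof (induction j)
  case 0
  have "br x (br y z) = br (br x y) z" using jacobi[of x y z] z by (simp add: br_r)
  then show ?case using br_opposite[OF \<alpha> x y] wsD[OF z(1) root_vec_H[OF \<alpha>]] by (simp add: br_l)
next
  case (Suc j)
  let ?w = "(br y ^^ Suc j) z"
  have w: "?w \<in> ws (\<lambda>t. l t + of_nat (Suc j) * - \<alpha> t)" by (rule iterated_raising[OF y z(1)])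
  have "br x (br y ?w) = br (br x y) ?w + br y (br x ?w)" by (rule jacobi)
  also have "br (br x y) ?w = (kil x y * (l (root_vec \<alpha>) - of_nat (Suc j) * \<alpha> (root_vec \<alpha>))) *s ?w"
    unfolding br_opposite[OF \<alpha> x y] br_l(2) wsD[OF w root_vec_H[OF \<alpha>]] vec.scale_scale by simp
  also have "br y (br x ?w) = (kil x y * of_nat (Suc j) * (l (root_vec \<alpha>) - of_nat j / 2 * \<alpha> (root_vec \<alpha>))) *s ?w"
    unfolding Suc.IH br_r by simp
  finally have "br x (br y ?w) =
      (kil x y * (l (root_vec \<alpha>) - of_nat (Suc j) * \<alpha> (root_vec \<alpha>)) +
       kil x y * of_nat (Suc j) * (l (root_vec \<alpha>) - of_nat j / 2 * \<alpha> (root_vec \<alpha>))) *s ?w"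
    by (simp only: vec.scale_left_distrib)
  moreover have "k * (u - of_nat (Suc j) * v) + k * of_nat (Suc j) * (u - of_nat j / 2 * v) =
      k * of_nat (Suc (Suc j)) * (u - of_nat (Suc j) / 2 * v)" for k u v :: complex
    by (simp add: field_simps)
  ultimately show ?case by (simp only: funpow.simps o_apply)
qed

text \<open>Raising a lowered vector returns a multiple of its predecessor, with the coefficient of
  \<open>lowering_chain\<close>; as long as this coefficient is nonzero, so is the lowered
  vector.\<close>

lemma lowering_nonzero:
  assumes \<alpha>: "\<alpha> \<in> roots br H" and x: "x \<in> ws \<alpha>" and y: "y \<in> ws (\<lambda>t. - \<alpha> t)" and k: "kil x y \<noteq> 0"
    and z: "z \<in> ws l" "br x z = 0" "z \<noteq> 0"
    and l: "\<And>i. i < j \<Longrightarrow> 2 * l (root_vec \<alpha>) \<noteq> of_nat i * \<alpha> (root_vec \<alpha>)"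
  shows "(br y ^^ j) z \<noteq> 0"
  using l
proof (induction j)
  case (Suc j)
  have "2 * l (root_vec \<alpha>) \<noteq> of_nat j * \<alpha> (root_vec \<alpha>)" using Suc.prems[of j] by simp
  then have "l (root_vec \<alpha>) - of_nat j / 2 * \<alpha> (root_vec \<alpha>) \<noteq> 0" by (simp add: field_simps)
  then have "br x ((br y ^^ Suc j) z) \<noteq> 0"
    unfolding lowering_chain[OF \<alpha> x y z(1,2)] using Suc k by (simp del: of_nat_Suc)
  then show ?case using br_r(3)[of x] by metis
qed (use z in simp)

text \<open>The translates are distinct functionals, and there are only finitely many weights; root
  strings therefore end.\<close>

lemma weights_translates:
  assumes "\<alpha> \<in> roots br H" "\<And>t. t \<notin> H \<Longrightarrow> l t = 0"
  shows "\<exists>j::nat. ws (\<lambda>t. l t + of_nat j * \<alpha> t) = {0}"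
proof (rule ccontr)
  assume *: "\<not> ?thesis"
  let ?f = "\<lambda>j::nat. \<lambda>t. l t + of_nat j * \<alpha> t"
  have "\<alpha> t = 0" if "t \<notin> H" for t using assms(1) that by (auto simp: roots_def)
  then have "range ?f \<subseteq> weights" using * assms(2) by (auto simp: weights_def)
  then have "finite (range ?f)" using finite_weights finite_subset by blast
  moreover have "inj ?f"
  proof (rule injI)
    fix i j assume e: "?f i = ?f j"
    have "\<alpha> (root_vec \<alpha>) \<noteq> 0" using root_norm_neq_0[OF assms(1)] .
    then show "i = j" using fun_cong[OF e, of "root_vec \<alpha>"] by simp
  qed
  ultimately show False using finite_imageD by blast
qed

text \<open>A lowest vector of positive weight would start a raising chain whose coefficients never
  vanish, but the chain must end. \<open>lowering_nonzero\<close> is applied with the root negated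
  and x, y exchanged.\<close>

lemma lowest_weight_zero:
  assumes \<alpha>: "\<alpha> \<in> roots br H" and x: "x \<in> ws \<alpha>" and y: "y \<in> ws (\<lambda>t. - \<alpha> t)" and k: "kil x y \<noteq> 0"
    and z: "z \<in> ws (\<lambda>t. of_nat (Suc m) * \<alpha> t)" "br y z = 0"
  shows "z = 0"
proof (rule ccontr)
  assume z0: "z \<noteq> 0"
  let ?l = "\<lambda>t. of_nat (Suc m) * \<alpha> t"
  let ?T = "root_vec (\<lambda>t. - \<alpha> t)"
  have "\<alpha> t = 0" if "t \<notin> H" for t using \<alpha> that by (auto simp: roots_def)
  then obtain j where j: "ws (\<lambda>t. ?l t + of_nat j * \<alpha> t) = {0}"
    using weights_translates[OF \<alpha>, of ?l] by auto
  have x': "x \<in> ws (\<lambda>t. - (- \<alpha> t))" using x by simp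
  have "(br x ^^ j) z \<noteq> 0"
  proof (rule lowering_nonzero[OF roots_neg[OF \<alpha>] y x' _ z z0])
    show "kil y x \<noteq> 0" using k kil_sym by simp
    fix i
    have n: "\<alpha> ?T = - \<alpha> (root_vec \<alpha>)"
      using root_scale[OF \<alpha> root_vec_H[OF \<alpha>], of "-1"] root_vec_neg[OF \<alpha>] by simp
    \<comment> \<open>After negating the root, a vanishing coefficient would require 2 (m + 1) = -
      i.\<close>
    have "2 * Suc m + i \<noteq> 0" by simp
    then have "(2 * of_nat (Suc m) + of_nat i :: complex) \<noteq> 0"
      by (metis of_nat_add of_nat_mult of_nat_numeral of_nat_eq_0_iff)
    then have "(2 * of_nat (Suc m) + of_nat i) * \<alpha> (root_vec \<alpha>) \<noteq> 0"
      using root_norm_neq_0[OF \<alpha>] by simp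
    moreover have "(2 * of_nat (Suc m) + of_nat i) * r = of_nat i * (- (- r)) - 2 * (of_nat (Suc m) * - r)"
      for r :: complex by (simp add: algebra_simps)
    ultimately show "2 * (of_nat (Suc m) * \<alpha> ?T) \<noteq> of_nat i * (- \<alpha> ?T)"
      unfolding n by (metis right_minus_eq)
  qed
  then show False using iterated_raising[OF x z(1), of j] j by auto
qed

text \<open>Subtracting a multiple of x makes z Killing-orthogonal to the conjugate of x, so their
  bracket vanishes; then z is a lowest vector of weight alpha and must be zero.\<close>

lemma root_space_one_dim:
  assumes \<alpha>: "\<alpha> \<in> roots br H" and x: "x \<in> ws \<alpha>" "x \<noteq> 0" and z: "z \<in> ws \<alpha>"
  shows "\<exists>c. z = c *s x"
proof -
  note y = ws_conj[OF roots_weights[OF \<alpha>] x(1)] and k = kil_conj_neq_0[OF x(2)]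
  let ?z = "z - (kil z (cjg x) / kil x (cjg x)) *s x"
  have z': "?z \<in> ws \<alpha>" using z x vec.subspace_diff[OF ws_subspace] vec.subspace_scale[OF ws_subspace] by blast
  have "kil ?z (cjg x) = 0" using k by (simp add: kil_l)
  then have "br (cjg x) ?z = 0"
    using br_opposite[OF \<alpha> z' y] br_anti[of "cjg x" ?z] by simp
  then have "?z = 0" using lowest_weight_zero[OF \<alpha> x(1) y k, of ?z 0] z' by simp
  then show ?thesis by (intro exI[of _ "kil z (cjg x) / kil x (cjg x)"]) simp
qed

text \<open>Lowering a vector of weight k alpha gives weight (k - 1) alpha. The result is zero, by
  induction for k > 2 and by one-dimensionality and invariance for k = 2; a lowest vector of
  positive weight is zero.\<close>

lemma multiple_not_root:
  assumes \<alpha>: "\<alpha> \<in> roots br H" and "k \<ge> 2"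
  shows "(\<lambda>t. of_nat k * \<alpha> t) \<notin> roots br H"
  using assms(2)
proof (induction k rule: less_induct)
  case (less k)
  show ?case
  proof
    assume kr: "(\<lambda>t. of_nat k * \<alpha> t) \<in> roots br H"
    obtain z where z: "z \<in> ws (\<lambda>t. of_nat k * \<alpha> t)" "z \<noteq> 0" using weights_nonzero[OF roots_weights[OF kr]] .
    obtain x where x: "x \<in> ws \<alpha>" "x \<noteq> 0" using weights_nonzero[OF roots_weights[OF \<alpha>]] .
    note y = ws_conj[OF roots_weights[OF \<alpha>] x(1)] and k = kil_conj_neq_0[OF x(2)]
    have "(\<lambda>t. - \<alpha> t + of_nat k * \<alpha> t) = (\<lambda>t. of_nat (k - 1) * \<alpha> t)"
      using less.prems by (simp add: of_nat_diff algebra_simps)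
    then have yz: "br (cjg x) z \<in> ws (\<lambda>t. of_nat (k - 1) * \<alpha> t)"
      using ws_br[OF y z(1)] by simp
    have "br (cjg x) z = 0"
    proof (cases "k = 2")
      case True
      then have "br (cjg x) z \<in> ws \<alpha>" using yz by simp
      then obtain c where c: "br (cjg x) z = c *s x" using root_space_one_dim[OF \<alpha> x] by blast
      \<comment> \<open>Invariance moves the bracket onto the conjugate of x with itself, so the
        coefficient c is zero.\<close>
      have "kil (br (cjg x) z) (cjg x) = - kil z (br (cjg x) (cjg x))"
        using br_anti[of "cjg x" z] kil_invariant[of z "cjg x" "cjg x"] by (simp add: kil_l)
      then have "c * kil x (cjg x) = 0" using c by (simp add: kil_l br_self kil_r)
      then show ?thesis using c k by simp
    next
      case False
      let ?b = "\<lambda>t. of_nat (k - 1) * \<alpha> t"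
      have "k - 1 < k" "k - 1 \<ge> 2" using False less.prems by linarith+
      then have nr: "?b \<notin> roots br H" by (rule less.IH)
      show ?thesis
      proof (rule ccontr)
        assume "br (cjg x) z \<noteq> 0"
        then have "?b \<in> weights" using yz \<alpha> by (intro weightsI) (auto simp: roots_def)
        then have "?b \<in> roots br H"
          using rootsI[OF _ root_vec_H[OF \<alpha>]] root_norm_neq_0[OF \<alpha>] less.prems by auto
        then show False using nr by simp
      qed
    qed
    then have "z = 0" using lowest_weight_zero[OF \<alpha> x(1) y k, of z "k - 1"] z(1) less.prems by simp
    then show False using z by simp
  qed
qed

text \<open>Climb p steps to the top of the root string, then descend n + p steps to the reflected
  weight. The last hypothesis excludes arriving at weight zero.\<close>

lemma root_reflection_nat:
  assumes \<alpha>: "\<alpha> \<in> roots br H" and \<beta>: "\<beta> \<in> roots br H"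
    and n: "2 * \<beta> (root_vec \<alpha>) = of_nat n * \<alpha> (root_vec \<alpha>)"
    and nz: "\<exists>t\<in>H. \<beta> t - of_nat n * \<alpha> t \<noteq> 0"
  shows "(\<lambda>t. \<beta> t - of_nat n * \<alpha> t) \<in> roots br H"
proof -
  obtain x where x: "x \<in> ws \<alpha>" "x \<noteq> 0" using weights_nonzero[OF roots_weights[OF \<alpha>]] .
  note y = ws_conj[OF roots_weights[OF \<alpha>] x(1)] and k = kil_conj_neq_0[OF x(2)]
  obtain z where z: "z \<in> ws \<beta>" "z \<noteq> 0" using weights_nonzero[OF roots_weights[OF \<beta>]] .
  have off: "\<alpha> t = 0" "\<beta> t = 0" if "t \<notin> H" for t using \<alpha> \<beta> that by (auto simp: roots_def)
  obtain j where "ws (\<lambda>t. \<beta> t + of_nat j * \<alpha> t) = {0}" using weights_translates[OF \<alpha>] off by blast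
  then have "\<exists>j. (br x ^^ j) z = 0" using iterated_raising[OF x(1) z(1), of j] by auto
  then obtain p where p: "(br x ^^ Suc p) z = 0" "(br x ^^ p) z \<noteq> 0"
    using ex_least_nat_less[of "\<lambda>j. (br x ^^ j) z = 0"] z(2) by (metis funpow_0 order.refl)
  let ?z = "(br x ^^ p) z" and ?l = "\<lambda>t. \<beta> t + of_nat p * \<alpha> t"
  have nz0: "(br (cjg x) ^^ (n + p)) ?z \<noteq> 0"
  proof (rule lowering_nonzero[OF \<alpha> x(1) y k iterated_raising[OF x(1) z(1)] _ p(2)])
    show "br x ?z = 0" using p by simp
    fix i assume i: "i < n + p"
    \<comment> \<open>From the top of the string the coefficient vanishes only at step n + 2p, which
      is not below n + p.\<close>
    have "of_nat (n + 2 * p) \<noteq> (of_nat i :: complex)" using i by (simp only: of_nat_eq_iff)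
    then have "of_nat (n + 2 * p) * \<alpha> (root_vec \<alpha>) \<noteq> of_nat i * \<alpha> (root_vec \<alpha>)"
      using root_norm_neq_0[OF \<alpha>] by simp
    then show "2 * ?l (root_vec \<alpha>) \<noteq> of_nat i * \<alpha> (root_vec \<alpha>)"
      using n by (simp add: algebra_simps)
  qed
  have "(br (cjg x) ^^ (n + p)) ?z \<in> ws (\<lambda>t. ?l t + of_nat (n + p) * - \<alpha> t)"
    by (rule iterated_raising[OF y iterated_raising[OF x(1) z(1)]])
  moreover have "(\<lambda>t. ?l t + of_nat (n + p) * - \<alpha> t) = (\<lambda>t. \<beta> t - of_nat n * \<alpha> t)"
    by (rule ext) (simp add: algebra_simps)
  ultimately have "(\<lambda>t. \<beta> t - of_nat n * \<alpha> t) \<in> weights"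
    using nz0 off by (intro weightsI[of _ "(br (cjg x) ^^ (n + p)) ?z"]) auto
  then show ?thesis using rootsI nz by blast
qed

text \<open>A negative n is the nonnegative case for - alpha, whose dual vector also changes
  sign.\<close>

lemma root_reflection:
  assumes \<alpha>: "\<alpha> \<in> roots br H" and \<beta>: "\<beta> \<in> roots br H"
    and n: "2 * \<beta> (root_vec \<alpha>) = of_int n * \<alpha> (root_vec \<alpha>)"
    and nz: "\<exists>t\<in>H. \<beta> t - of_int n * \<alpha> t \<noteq> 0"
  shows "(\<lambda>t. \<beta> t - of_int n * \<alpha> t) \<in> roots br H"
proof (cases "n \<ge> 0")
  case True
  then obtain m where "n = int m" using nonneg_int_cases by blast
  then show ?thesis using root_reflection_nat[OF \<alpha> \<beta>, of m] n nz by simp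
next
  case False
  then have m: "n = - int (nat (- n))" by simp
  define m where "m = nat (- n)"
  note m = m[folded m_def]
  let ?a = "\<lambda>t. - \<alpha> t"
  have "\<alpha> (- root_vec \<alpha>) = - \<alpha> (root_vec \<alpha>)" "\<beta> (- root_vec \<alpha>) = - \<beta> (root_vec \<alpha>)"
    using root_scale[OF \<alpha> root_vec_H[OF \<alpha>], of "-1"] root_scale[OF \<beta> root_vec_H[OF \<alpha>], of "-1"] by simp_all
  then show ?thesis
    using root_reflection_nat[OF roots_neg[OF \<alpha>] \<beta>, of m] n nz unfolding m by (simp add: root_vec_neg[OF \<alpha>])
qed

end

section \<open>Positive roots in coordinates with respect to the base\<close>

locale compact_torus_base = compact_torus br g h
  for br :: "'n::finite bracket" and g h :: "(complex ^ 'n) set" +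
  fixes n :: nat and a :: "nat \<Rightarrow> complex ^ 'n \<Rightarrow> complex" and A :: "nat \<Rightarrow> nat \<Rightarrow> int"
  assumes base: "root_base br H n a"
    and cartan: "\<And>i j. i \<in> {1..n} \<Longrightarrow> j \<in> {1..n} \<Longrightarrow> a i (coroot br H (a j)) = of_int (A i j)"
begin

lemma simple_root: "i \<in> {1..n} \<Longrightarrow> a i \<in> roots br H"
  using base by (simp add: root_base_def)

lemma simple_independent:
  "(\<And>t. (\<Sum>i=1..n. of_real (r i) * a i t) = 0) \<Longrightarrow> i \<in> {1..n} \<Longrightarrow> r i = 0" for r :: "nat \<Rightarrow> real"
  using base by (auto simp: root_base_def)

definition comb :: "(nat \<Rightarrow> int) \<Rightarrow> complex ^ 'n \<Rightarrow> complex" where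
  "comb k = (\<lambda>t. \<Sum>i=1..n. of_int (k i) * a i t)"

lemma comb_inject:
  assumes "comb k = comb l" "i \<in> {1..n}" shows "k i = l i"
proof -
  have "(\<Sum>i=1..n. of_real (of_int (k i - l i)) * a i t) = 0" for t
    using fun_cong[OF assms(1), of t] by (simp add: comb_def algebra_simps sum_subtractf)
  then have "real_of_int (k i - l i) = 0" using simple_independent[of "\<lambda>i. of_int (k i - l i)"] assms(2) by blast
  then show ?thesis by linarith
qed

lemma comb_neg: "comb (\<lambda>i. - k i) = (\<lambda>t. - comb k t)"
  by (simp add: comb_def sum_negf)

definition pos_coeffs :: "(nat \<Rightarrow> int) set" where
  "pos_coeffs = {k. (\<forall>i. i \<notin> {1..n} \<longrightarrow> k i = 0) \<and> (\<forall>i. k i \<ge> 0) \<and> comb k \<in> roots br H}"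

lemma roots_pos_or_neg:
  assumes "\<beta> \<in> roots br H"
  shows "\<exists>k\<in>pos_coeffs. \<beta> = comb k \<or> \<beta> = (\<lambda>t. - comb k t)"
proof -
  obtain k :: "nat \<Rightarrow> nat" where k: "(\<forall>t. \<beta> t = (\<Sum>i=1..n. of_nat (k i) * a i t)) \<or>
        (\<forall>t. \<beta> t = - (\<Sum>i=1..n. of_nat (k i) * a i t))"
    using base assms unfolding root_base_def by blast
  define k' where "k' i = (if i \<in> {1..n} then int (k i) else 0)" for i
  have c: "comb k' t = (\<Sum>i=1..n. of_nat (k i) * a i t)" for t
    unfolding comb_def by (rule sum.cong) (auto simp: k'_def)
  have *: "\<beta> = comb k' \<or> \<beta> = (\<lambda>t. - comb k' t)" using k c by (auto simp: fun_eq_iff)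
  then have "comb k' \<in> roots br H" using assms roots_neg[OF assms] by auto
  then have "k' \<in> pos_coeffs" by (simp add: pos_coeffs_def k'_def)
  then show ?thesis using * by blast
qed

text \<open>This makes the Cartan integers of \<open>pairing\<close> available in the form that the
  reflection lemma asks for.\<close>

lemma pairing_root_vec:
  assumes k: "comb k \<in> roots br H" and j: "j \<in> {1..n}"
  shows "2 * comb k (root_vec (a j)) = of_int (pairing A n k j) * a j (root_vec (a j))"
proof -
  note aj = simple_root[OF j]
  have "comb k (coroot br H (a j)) = of_int (pairing A n k j)"
    using cartan j by (simp add: comb_def pairing_def)
  then show ?thesis
    unfolding coroot_eq[OF aj] root_scale[OF k root_vec_H[OF aj]]
    using root_norm_neq_0[OF aj] by (simp add: field_simps)
qed

lemma cartan_diagonal: assumes i: "i \<in> {1..n}" shows "A i i = 2"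
proof -
  note ai = simple_root[OF i]
  have "a i (coroot br H (a i)) = 2"
    unfolding coroot_eq[OF ai] root_scale[OF ai root_vec_H[OF ai]] using root_norm_neq_0[OF ai] by simp
  then have "of_int (A i i) = (of_int 2 :: complex)" using cartan[OF i i] by simp
  then show ?thesis by (simp only: of_int_eq_iff)
qed

lemma comb_reflection:
  assumes "i \<in> {1..n}"
  shows "comb (simple_reflection A n i k) = (\<lambda>t. comb k t - of_int (pairing A n k i) * a i t)"
proof
  fix t
  have "comb (simple_reflection A n i k) t =
      (\<Sum>j=1..n. of_int (k j) * a j t - (if j = i then of_int (pairing A n k i) * a j t else 0))"
    unfolding comb_def by (rule sum.cong) (auto simp: simple_reflection_def algebra_simps)
  then show "comb (simple_reflection A n i k) t = comb k t - of_int (pairing A n k i) * a i t"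
    using assms by (simp add: sum_subtractf comb_def)
qed

lemma comb_unit: "i \<in> {1..n} \<Longrightarrow> comb (unit_root i) = a i"
proof
  fix t assume i: "i \<in> {1..n}"
  have "comb (unit_root i) t = (\<Sum>j=1..n. if j = i then a j t else 0)"
    unfolding comb_def by (rule sum.cong) (auto simp: unit_root_def)
  then show "comb (unit_root i) t = a i t" using i by simp
qed

lemma unit_pos: "i \<in> {1..n} \<Longrightarrow> unit_root i \<in> pos_coeffs"
  using comb_unit simple_root by (auto simp: pos_coeffs_def unit_root_def)

text \<open>Otherwise the root is a multiple of one simple root, and only the factor 1 is
  possible.\<close>

lemma pos_other_coeff:
  assumes k: "k \<in> pos_coeffs" and i: "i \<in> {1..n}" and ne: "k \<noteq> unit_root i"
  shows "\<exists>j\<in>{1..n}. j \<noteq> i \<and> k j > 0"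
proof (rule ccontr)
  assume *: "\<not> ?thesis"
  then have k0: "k j = 0" if "j \<noteq> i" for j
    using k that unfolding pos_coeffs_def by (metis (mono_tags, lifting) mem_Collect_eq order.order_iff_strict)
  define m where "m = nat (k i)"
  have km: "k i = int m" using k by (simp add: m_def pos_coeffs_def)
  have "comb k t = of_nat m * a i t" for t
  proof -
    have "comb k t = (\<Sum>j=1..n. if j = i then of_nat m * a j t else 0)"
      unfolding comb_def by (rule sum.cong) (auto simp: k0 km)
    then show ?thesis using i by simp
  qed
  then have c: "comb k = (\<lambda>t. of_nat m * a i t)" by blast
  have r: "comb k \<in> roots br H" using k by (simp add: pos_coeffs_def)
  have "m \<noteq> 0" using r c by (auto simp: roots_def)
  moreover have "m < 2" using multiple_not_root[OF simple_root[OF i], of m] r c by force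
  ultimately have "k = unit_root i" using k0 km by (auto simp: unit_root_def fun_eq_iff)
  then show False using ne by simp
qed

text \<open>The reflection changes only coordinate i, so some other coordinate stays positive. As
  the coordinates of a root have a common sign, the reflected root is positive.\<close>

lemma reflection_pos:
  assumes k: "k \<in> pos_coeffs" and i: "i \<in> {1..n}" and ne: "k \<noteq> unit_root i"
  shows "simple_reflection A n i k \<in> pos_coeffs"
proof -
  let ?s = "simple_reflection A n i k"
  obtain j where j: "j \<in> {1..n}" "j \<noteq> i" "k j > 0" using pos_other_coeff[OF assms] by blast
  have kr: "comb k \<in> roots br H" using k by (simp add: pos_coeffs_def)
  have sj: "?s j > 0" using j by (simp add: simple_reflection_def)
  have "\<exists>t\<in>H. comb ?s t \<noteq> 0"
  proof (rule ccontr)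
    assume *: "\<not> ?thesis"
    have "comb ?s t = 0" for t
    proof (cases "t \<in> H")
      case False
      then have "a i t = 0" if "i \<in> {1..n}" for i using simple_root[OF that] by (auto simp: roots_def)
      then show ?thesis by (simp add: comb_def)
    qed (use * in blast)
    then have "comb ?s = comb (\<lambda>i. 0)" by (simp add: comb_def fun_eq_iff)
    then have "?s j = (\<lambda>i. 0) j" by (rule comb_inject[OF _ j(1)])
    then show False using sj by simp
  qed
  then have sr: "comb ?s \<in> roots br H"
    unfolding comb_reflection[OF i]
    by (rule root_reflection[OF simple_root[OF i] kr pairing_root_vec[OF kr i]])
  obtain l where l: "l \<in> pos_coeffs" "comb ?s = comb l \<or> comb ?s = comb (\<lambda>i. - l i)"
    using roots_pos_or_neg[OF sr] unfolding comb_neg by blast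
  have "comb ?s = comb l"
  proof (rule ccontr)
    assume "comb ?s \<noteq> comb l"
    then have "?s j = - l j" using comb_inject[OF _ j(1)] l(2) by blast
    moreover have "l j \<ge> 0" using l(1) by (simp add: pos_coeffs_def)
    ultimately show False using sj by simp
  qed
  then have "?s m = l m" for m
  proof (cases "m \<in> {1..n}")
    case False
    then show ?thesis using k l(1) i by (auto simp: pos_coeffs_def simple_reflection_def)
  qed (rule comb_inject)
  then have "?s = l" by blast
  then show ?thesis using l(1) by simp
qed

text \<open>The positive norm of the root is the sum of its inner products with simple roots,
  weighted by its nonnegative coordinates; one of these inner products is positive.\<close>

lemma descent:
  assumes k: "k \<in> pos_coeffs"
  shows "\<exists>i\<in>{1..n}. pairing A n k i > 0"
proof (rule ccontr)
  assume *: "\<not> ?thesis"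
  have kr: "comb k \<in> roots br H" using k by (simp add: pos_coeffs_def)
  let ?T = "root_vec (comb k)"
  obtain r where r: "r > 0" "comb k ?T = of_real r" using root_norm_pos[OF kr] by blast
  have "Re (of_int (k i) * a i ?T) \<le> 0" if i: "i \<in> {1..n}" for i
  proof -
    note ai = simple_root[OF i]
    obtain q where q: "q > 0" "a i (root_vec (a i)) = of_real q" using root_norm_pos[OF ai] by blast
    have "a i ?T = kil (root_vec (a i)) ?T" using kil_root_vec[OF ai root_vec_H[OF kr]] by simp
    also have "\<dots> = comb k (root_vec (a i))" using kil_root_vec[OF kr root_vec_H[OF ai]] kil_sym by simp
    finally have "2 * a i ?T = of_int (pairing A n k i) * of_real q"
      using pairing_root_vec[OF kr i] q by simp
    then have "2 * Re (a i ?T) = of_int (pairing A n k i) * q"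
      by (metis Re_complex_of_real mult_2 of_real_mult of_real_of_int_eq plus_complex.sel(1))
    moreover have "pairing A n k i \<le> 0" using * i by force
    then have "of_int (pairing A n k i) * q \<le> 0" using q(1) by (simp add: mult_le_0_iff)
    ultimately have "Re (a i ?T) \<le> 0" by linarith
    moreover have "k i \<ge> 0" using k by (simp add: pos_coeffs_def)
    ultimately show ?thesis by (simp add: mult_nonneg_nonpos)
  qed
  then have "Re (comb k ?T) \<le> 0" unfolding comb_def Re_sum by (intro sum_nonpos)
  then show False using r by simp
qed

text \<open>One inclusion is stability of positivity. The other is induction on the height: a
  descending reflection gives a lower positive root, and its inverse is a raising step.\<close>

lemma pos_coeffs_eq: "pos_coeffs = positive_roots A n"
proof
  show "positive_roots A n \<subseteq> pos_coeffs"
  proof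
    fix k assume "k \<in> positive_roots A n"
    then show "k \<in> pos_coeffs"
    proof induction
      case (raise k i)
      \<comment> \<open>The i-th unit root has pairing A i i = 2 at i, so it is never raised
        there.\<close>
      have "k \<noteq> unit_root i"
        using raise.hyps pairing_unit_root[of i n A i] cartan_diagonal[of i] by auto
      then show ?case using reflection_pos raise by blast
    qed (rule unit_pos)
  qed
  show "pos_coeffs \<subseteq> positive_roots A n"
  proof
    fix k assume "k \<in> pos_coeffs"
    then show "k \<in> positive_roots A n"
    proof (induction "nat (\<Sum>i=1..n. k i)" arbitrary: k rule: less_induct)
      case less
      obtain i where i: "i \<in> {1..n}" "pairing A n k i > 0" using descent[OF less.prems] by blast
      show ?case
      proof (cases "k = unit_root i")
        case True
        then show ?thesis using positive_roots.unit i by blast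
      next
        case False
        let ?s = "simple_reflection A n i k"
        have s: "?s \<in> pos_coeffs" by (rule reflection_pos[OF less.prems i(1) False])
        have "(\<Sum>j=1..n. ?s j) < (\<Sum>j=1..n. k j)"
          using i by (intro sum_strict_mono_ex1) (auto simp: simple_reflection_def)
        moreover have "0 \<le> (\<Sum>j=1..n. ?s j)" using s by (intro sum_nonneg) (simp add: pos_coeffs_def)
        ultimately have "?s \<in> positive_roots A n" by (intro less.hyps s) linarith
        \<comment> \<open>The lowered root has the opposite pairing at i, so the same reflection is
          a raising step that leads back to k.\<close>
        moreover have p: "pairing A n ?s i = - pairing A n k i"
          by (simp add: pairing_simple_reflection[OF i(1)] cartan_diagonal[OF i(1)])
        ultimately have "simple_reflection A n i ?s \<in> positive_roots A n"
          using i by (intro positive_roots.raise[of ?s A n i]) simp_all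
        moreover have "simple_reflection A n i ?s = k"
          unfolding simple_reflection_def[of A n i ?s] p by (auto simp: simple_reflection_def)
        ultimately show ?thesis by simp
      qed
    qed
  qed
qed

end

section \<open>Clifford modules\<close>

text \<open>The vectors e a, f a stand for an orthonormal basis grouped into the planes of the
  roots; the Lie algebra has disappeared.\<close>

locale clifford_pairs =
  fixes P :: "'p set" and e f :: "'p \<Rightarrow> complex ^ 's::finite \<Rightarrow> complex ^ 's"
  assumes fin: "finite P"
    and e_lin: "a \<in> P \<Longrightarrow> clinear (e a)" and f_lin: "a \<in> P \<Longrightarrow> clinear (f a)"
    and e_sq: "a \<in> P \<Longrightarrow> e a (e a \<psi>) = - \<psi>" and f_sq: "a \<in> P \<Longrightarrow> f a (f a \<psi>) = - \<psi>"
    and e_anti: "a \<in> P \<Longrightarrow> b \<in> P \<Longrightarrow> a \<noteq> b \<Longrightarrow> e a (e b \<psi>) = - e b (e a \<psi>)"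
    and f_anti: "a \<in> P \<Longrightarrow> b \<in> P \<Longrightarrow> a \<noteq> b \<Longrightarrow> f a (f b \<psi>) = - f b (f a \<psi>)"
    and fe: "a \<in> P \<Longrightarrow> b \<in> P \<Longrightarrow> f a (e b \<psi>) = - e b (f a \<psi>)"
    and irreducible: "\<And>W. vec.subspace W \<Longrightarrow> (\<And>a \<psi>. a \<in> P \<Longrightarrow> \<psi> \<in> W \<Longrightarrow> e a \<psi> \<in> W \<and> f a \<psi> \<in> W)
        \<Longrightarrow> W = {0} \<or> W = UNIV"
begin

definition J :: "'p \<Rightarrow> complex ^ 's \<Rightarrow> complex ^ 's" where
  "J a \<psi> = e a (f a \<psi>)"

lemmas e_simps = clinearD[OF e_lin] and f_simps = clinearD[OF f_lin]

lemma J_lin: "a \<in> P \<Longrightarrow> clinear (J a)"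
  by (simp add: clinear_iff J_def e_simps f_simps)

lemmas J_simps = clinearD[OF J_lin]

lemma J_sq: "a \<in> P \<Longrightarrow> J a (J a \<psi>) = - \<psi>"
  by (simp add: J_def fe e_simps f_sq e_sq)

lemma J_e_same: "a \<in> P \<Longrightarrow> J a (e a \<psi>) = f a \<psi>" "a \<in> P \<Longrightarrow> e a (J a \<psi>) = - f a \<psi>"
  by (simp_all add: J_def fe e_simps e_sq)

lemma J_f_same: "a \<in> P \<Longrightarrow> J a (f a \<psi>) = - e a \<psi>" "a \<in> P \<Longrightarrow> f a (J a \<psi>) = e a \<psi>"
  by (simp_all add: J_def fe e_simps f_sq)

lemma J_e_other: "a \<in> P \<Longrightarrow> b \<in> P \<Longrightarrow> a \<noteq> b \<Longrightarrow> J a (e b \<psi>) = e b (J a \<psi>)"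
  by (simp add: J_def fe e_simps e_anti[of a b])

lemma J_f_other: "a \<in> P \<Longrightarrow> b \<in> P \<Longrightarrow> a \<noteq> b \<Longrightarrow> J a (f b \<psi>) = f b (J a \<psi>)"
  by (simp add: J_def fe e_simps f_anti[of a b])

lemma J_commute: "a \<in> P \<Longrightarrow> b \<in> P \<Longrightarrow> J a (J b \<psi>) = J b (J a \<psi>)"
  by (cases "a = b") (simp_all add: J_e_other J_f_other J_def[of b])

lemma e_neq_0: "a \<in> P \<Longrightarrow> \<psi> \<noteq> 0 \<Longrightarrow> e a \<psi> \<noteq> 0"
  using e_sq[of a \<psi>] e_simps(3)[of a] by auto

text \<open>In the induction, v - i J v is an eigenvector of the new J for the eigenvalue i. If it
  is zero, v has eigenvalue - i and e b v is taken instead, since e b anticommutes with J b and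
  commutes with the other J.\<close>

lemma vacuum_exists: "\<exists>v. v \<noteq> 0 \<and> (\<forall>a\<in>P. J a v = \<i> *s v)"
proof -
  have "\<exists>v. v \<noteq> 0 \<and> (\<forall>a\<in>F. J a v = \<i> *s v)" if "F \<subseteq> P" for F
    using finite_subset[OF that fin] that
  proof (induction F rule: finite_induct)
    case empty
    have "(axis undefined 1 :: complex ^ 's) \<noteq> 0" by (simp add: axis_eq_0_iff)
    then show ?case by auto
  next
    case (insert b F)
    then obtain v where v: "v \<noteq> 0" "\<And>a. a \<in> F \<Longrightarrow> J a v = \<i> *s v" by auto
    have b: "b \<in> P" and F: "a \<in> P" "a \<noteq> b" if "a \<in> F" for a using insert that by auto
    have b: "b \<in> P" using insert by auto
    define w where "w = v - \<i> *s J b v"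
    show ?case
    proof (cases "w = 0")
      case False
      have "J b w = \<i> *s w"
        by (simp add: w_def J_simps[OF b] J_sq[OF b] vec.scale_right_diff_distrib)
      moreover have "J a w = \<i> *s w" if "a \<in> F" for a
        unfolding w_def J_simps[OF F(1)[OF that]] J_commute[OF F(1)[OF that] b] v(2)[OF that] J_simps[OF b]
        by (simp add: vec.scale_right_diff_distrib)
      ultimately show ?thesis using False by auto
    next
      case True
      then have "\<i> *s v = \<i> *s (\<i> *s J b v)" by (simp add: w_def)
      then have Jb: "J b v = - (\<i> *s v)" by (simp add: minus_equation_iff)
      then have "e b (J b v) = - (\<i> *s e b v)" by (simp add: e_simps[OF b])
      then have "J b (e b v) = \<i> *s e b v" using J_e_same[OF b, of v] by (simp add: minus_equation_iff)
      moreover have "J a (e b v) = \<i> *s e b v" if "a \<in> F" for a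
        using J_e_other[OF F(1)[OF that] b F(2)[OF that]] v(2)[OF that] by (simp add: e_simps[OF b])
      ultimately show ?thesis using e_neq_0[OF b v(1)] by auto
    qed
  qed
  then show ?thesis by blast
qed

definition vacuum :: "complex ^ 's" where
  "vacuum = (SOME v. v \<noteq> 0 \<and> (\<forall>a\<in>P. J a v = \<i> *s v))"

lemma vacuum: "vacuum \<noteq> 0" "a \<in> P \<Longrightarrow> J a vacuum = \<i> *s vacuum"
  using someI_ex[OF vacuum_exists] unfolding vacuum_def by auto

definition ps :: "'p list" where "ps = (SOME xs. set xs = P \<and> distinct xs)"

lemma ps: "set ps = P" "distinct ps"
  using someI_ex[OF finite_distinct_list[OF fin]] unfolding ps_def by auto

text \<open>The Fock state obtained from the vacuum by the operators e a with a in D. The list fixes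
  an order of these anticommuting operators.\<close>

definition state_on :: "'p list \<Rightarrow> 'p set \<Rightarrow> complex ^ 's" where
  "state_on xs D = foldr (\<lambda>a v. if a \<in> D then e a v else v) xs vacuum"

abbreviation state :: "'p set \<Rightarrow> complex ^ 's" where "state \<equiv> state_on ps"

lemma state_on_simps [simp]:
  "state_on [] D = vacuum"
  "state_on (a # xs) D = (if a \<in> D then e a (state_on xs D) else state_on xs D)"
  by (simp_all add: state_on_def)

lemma state_on_cong: "(\<And>a. a \<in> set xs \<Longrightarrow> a \<in> D \<longleftrightarrow> a \<in> D') \<Longrightarrow> state_on xs D = state_on xs D'"
  by (induction xs) auto

lemma state_on_neq_0: "set xs \<subseteq> P \<Longrightarrow> state_on xs D \<noteq> 0"
  by (induction xs) (auto simp: vacuum e_neq_0)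

lemma J_state_on:
  "set xs \<subseteq> P \<Longrightarrow> distinct xs \<Longrightarrow> a \<in> P \<Longrightarrow>
    J a (state_on xs D) = (if a \<in> D \<and> a \<in> set xs then - \<i> else \<i>) *s state_on xs D"
proof (induction xs)
  case (Cons b xs)
  show ?case
  proof (cases "b \<in> D")
    case True
    show ?thesis
    proof (cases "a = b")
      case True
      have "e b (J b (state_on xs D)) = \<i> *s e b (state_on xs D)"
        using Cons True by (simp add: e_simps)
      then have "J b (e b (state_on xs D)) = - (\<i> *s e b (state_on xs D))"
        using J_e_same[of b "state_on xs D"] Cons.prems by (simp add: minus_equation_iff)
      then show ?thesis using \<open>b \<in> D\<close> True by simp
    next
      case False
      then show ?thesis using Cons \<open>b \<in> D\<close> by (simp add: J_e_other e_simps)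
    qed
  qed (use Cons in auto)
qed (simp add: vacuum)

lemma J_state: "a \<in> P \<Longrightarrow> J a (state D) = (if a \<in> D then - \<i> else \<i>) *s state D"
  using J_state_on[of ps a D] ps by simp

text \<open>Moving e b to its place in the product costs only signs; there it is inserted, or
  cancels against the e b already present.\<close>

lemma e_state_on:
  "set xs \<subseteq> P \<Longrightarrow> distinct xs \<Longrightarrow> b \<in> set xs \<Longrightarrow>
    \<exists>s. e b (state_on xs D) = s *s state_on xs (if b \<in> D then D - {b} else insert b D)"
proof (induction xs)
  case (Cons c xs)
  let ?D = "if b \<in> D then D - {b} else insert b D"
  show ?case
  proof (cases "c = b")
    case True
    have "state_on xs ?D = state_on xs D"
      using Cons True by (intro state_on_cong) auto
    then show ?thesis
      using Cons.prems True e_sq[of b "state_on xs D"]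
      by (intro exI[of _ "if b \<in> D then - 1 else 1"]) auto
  next
    case False
    then obtain s where s: "e b (state_on xs D) = s *s state_on xs ?D" using Cons by auto
    show ?thesis
      using Cons.prems False s e_anti[of b c "state_on xs D"] e_simps[of c]
      by (intro exI[of _ "if c \<in> D then - s else s"]) auto
  qed
qed simp

text \<open>The span is stable under every e b, which toggles b, and under every J b, which is
  diagonal; hence under f b = - e b J b. Irreducibility does the rest.\<close>

lemma states_span: "vec.span (state ` Pow P) = UNIV"
proof -
  let ?W = "vec.span (state ` Pow P)"
  have e: "e b \<psi> \<in> ?W" if b: "b \<in> P" and "\<psi> \<in> ?W" for b \<psi>
    using that(2)
  proof (induction rule: vec.span_induct_alt)
    case base
    then show ?case by (simp add: e_simps[OF b] vec.span_zero)
  next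
    case (step c x y)
    then obtain D where D: "D \<subseteq> P" "x = state D" by auto
    obtain s where s: "e b x = s *s state (if b \<in> D then D - {b} else insert b D)"
      using e_state_on[of ps b D] ps b D by auto
    have "(if b \<in> D then D - {b} else insert b D) \<in> Pow P" using D b by auto
    then have "e b x \<in> ?W" unfolding s by (intro vec.span_scale vec.span_base imageI)
    then show ?case unfolding e_simps[OF b] by (intro vec.span_add vec.span_scale step)
  qed
  have J: "J b \<psi> \<in> ?W" if b: "b \<in> P" and "\<psi> \<in> ?W" for b \<psi>
    using that(2)
  proof (induction rule: vec.span_induct_alt)
    case base
    then show ?case by (simp add: J_simps[OF b] vec.span_zero)
  next
    case (step c x y)
    then have "x \<in> ?W" "\<exists>a. J b x = a *s x" using J_state[OF b] by (auto intro: vec.span_base)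
    then show ?case unfolding J_simps[OF b] by (auto intro!: vec.span_add vec.span_scale step)
  qed
  have "f b \<psi> \<in> ?W" if "b \<in> P" "\<psi> \<in> ?W" for b \<psi>
    using J_e_same(2)[OF that(1), of \<psi>] e[OF that(1) J[OF that]] vec.span_neg
    by (metis add.inverse_inverse)
  then have "?W = {0} \<or> ?W = UNIV" using e by (intro irreducible) auto
  moreover have "state {} \<in> ?W" by (intro vec.span_base) auto
  moreover have "state {} \<noteq> 0" using state_on_neq_0 ps by simp
  ultimately show ?thesis by auto
qed

text \<open>A product of factors 1 + i J or 1 - i J: up to the factor 2 for each list entry, the
  spectral projection onto the eigenvalues that belong to D.\<close>

definition projection :: "'p list \<Rightarrow> 'p set \<Rightarrow> complex ^ 's \<Rightarrow> complex ^ 's" where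
  "projection xs D = foldr (\<lambda>a g \<psi>. g \<psi> + (if a \<in> D then \<i> else - \<i>) *s J a (g \<psi>)) xs (\<lambda>\<psi>. \<psi>)"

lemma projection_lin: "set xs \<subseteq> P \<Longrightarrow> clinear (projection xs D)"
proof (induction xs)
  case (Cons a xs)
  then have a: "a \<in> P" and IH: "clinear (projection xs D)" by auto
  show ?case
    unfolding clinear_iff using IH
    by (auto simp: projection_def[of "a # xs"] projection_def[symmetric] clinearD[OF IH] J_simps[OF a] algebra_simps
       vec.scale_right_distrib vec.scale_left_commute)
qed (simp add: projection_def clinear_iff)

lemma projection_state:
  "set xs \<subseteq> P \<Longrightarrow> projection xs D (state D') =
    (if \<forall>a\<in>set xs. a \<in> D \<longleftrightarrow> a \<in> D' then 2 ^ length xs else 0) *s state D'"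
proof (induction xs)
  case (Cons a xs)
  let ?p = "if \<forall>b\<in>set xs. b \<in> D \<longleftrightarrow> b \<in> D' then 2 ^ length xs else 0 :: complex"
  let ?c = "if a \<in> D then \<i> else - \<i>" and ?m = "if a \<in> D' then - \<i> else \<i>"
  have a: "a \<in> P" and IH: "projection xs D (state D') = ?p *s state D'" using Cons by auto
  have "projection (a # xs) D (state D') = ?p *s state D' + ?c *s J a (?p *s state D')"
    by (simp only: projection_def foldr.simps o_apply) (simp only: projection_def[symmetric] IH)
  also have "\<dots> = ((1 + ?c * ?m) * ?p) *s state D'"
    by (simp add: J_simps[OF a] J_state[OF a] vec_eq_iff algebra_simps)
  also have "(1 + ?c * ?m) * ?p = (if \<forall>b\<in>set (a # xs). b \<in> D \<longleftrightarrow> b \<in> D' then 2 ^ length (a # xs) else 0)"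
    by simp
  finally show ?case .
qed (simp add: projection_def)

text \<open>The projection for D kills all other states. The relation is indexed by sets and not by
  vectors, because injectivity of \<open>state\<close> is itself derived from it.\<close>

lemma state_coefficients:
  assumes "(\<Sum>D\<in>Pow P. u D *s state D) = 0" "D \<subseteq> P" shows "u D = 0"
proof -
  note lin = projection_lin[of ps D, unfolded ps(1), OF order.refl]
  have "0 = projection ps D (\<Sum>D\<in>Pow P. u D *s state D)" using assms clinear_0[OF lin] by simp
  also have "\<dots> = (\<Sum>D'\<in>Pow P. u D' *s projection ps D (state D'))"
    by (simp add: clinear_sum[OF lin] clinear_scale[OF lin])
  also have "\<dots> = (\<Sum>D'\<in>Pow P. if D' = D then (u D * 2 ^ length ps) *s state D else 0)"
    using assms(2) by (intro sum.cong) (auto simp: projection_state ps)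
  also have "\<dots> = (u D * 2 ^ length ps) *s state D" using assms(2) fin by simp
  finally show ?thesis using state_on_neq_0[of ps D] ps by simp
qed

lemma state_inj: "inj_on state (Pow P)"
proof (rule inj_onI, rule ccontr)
  fix D D' assume D: "D \<in> Pow P" "D' \<in> Pow P" "state D = state D'" "D \<noteq> D'"
  let ?u = "\<lambda>C. (if C = D then 1 else 0) - (if C = D' then 1 else 0) :: complex"
  have "?u C *s state C = (if C = D then state D else 0) - (if C = D' then state D' else 0)" for C
    by (auto simp: vec.scale_left_diff_distrib)
  then have "(\<Sum>C\<in>Pow P. ?u C *s state C) = state D - state D'"
    using D fin by (simp add: sum_subtractf)
  then have "?u D = 0" using D by (intro state_coefficients) auto
  then show False using D by simp
qed

lemma states_independent: "vec.independent (state ` Pow P)"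
  unfolding vec.independent_explicit
proof (intro conjI allI impI ballI)
  fix u v assume 0: "(\<Sum>v\<in>state ` Pow P. u v *s v) = 0" and "v \<in> state ` Pow P"
  then obtain D where "D \<subseteq> P" "v = state D" by auto
  moreover have "(\<Sum>D\<in>Pow P. u (state D) *s state D) = 0"
    using 0 by (simp add: sum.reindex[OF state_inj])
  ultimately show "u v = 0" using state_coefficients[of "\<lambda>D. u (state D)"] by simp
qed (use fin in simp)

text \<open>Every state is an eigenvector of all these operators, with eigenvalue i times the
  difference of the angle sums over P - D and D. The joint kernel is spanned by the states where all
  differences vanish.\<close>

theorem dim_joint_kernel:
  fixes \<theta> :: "'p \<Rightarrow> 't \<Rightarrow> real"
  shows "vec.dim {\<psi>. \<forall>t\<in>T. (\<Sum>a\<in>P. \<theta> a t *\<^sub>R J a \<psi>) = 0} =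
    card {D. D \<subseteq> P \<and> (\<forall>t\<in>T. (\<Sum>a\<in>D. \<theta> a t) = (\<Sum>a\<in>P - D. \<theta> a t))}"
    (is "vec.dim ?K = card ?Z")
proof -
  define l where "l D t = \<i> * of_real ((\<Sum>a\<in>P - D. \<theta> a t) - (\<Sum>a\<in>D. \<theta> a t))" for D t
  let ?S = "\<lambda>t \<psi>. \<Sum>a\<in>P. \<theta> a t *\<^sub>R J a \<psi>"
  have S: "clinear (?S t)" for t
    by (simp add: clinear_iff J_simps scaleR_add_right sum.distrib scaleR_eq_vector_smult
      vec.scale_sum_right vec.scale_right_distrib mult.commute)
  have eig: "?S t (state D) = l D t *s state D" if "D \<subseteq> P" for D t
  proof -
    have "?S t (state D) = (\<Sum>a\<in>P. of_real (\<theta> a t) * (if a \<in> D then - \<i> else \<i>)) *s state D"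
      unfolding vec.scale_sum_left
      by (rule sum.cong) (simp_all add: J_state scaleR_eq_vector_smult)
    also have "(\<Sum>a\<in>P. of_real (\<theta> a t) * (if a \<in> D then - \<i> else \<i>)) =
        (\<Sum>a\<in>P - D. of_real (\<theta> a t) * \<i>) + (\<Sum>a\<in>D. of_real (\<theta> a t) * - \<i>)"
      unfolding sum.subset_diff[OF that fin] by (intro arg_cong2[where f = "(+)"] sum.cong) auto
    also have "\<dots> = l D t"
      by (simp add: l_def sum_negf sum_distrib_left algebra_simps)
    finally show ?thesis .
  qed
  have Z: "?Z = {D. D \<subseteq> P \<and> (\<forall>t\<in>T. l D t = 0)}"
    unfolding l_def by (simp only: mult_eq_0_iff of_real_eq_0_iff) auto
  have "?K = vec.span (state ` ?Z)"
  proof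
    show "vec.span (state ` ?Z) \<subseteq> ?K"
    proof (rule vec.span_minimal)
      show "state ` ?Z \<subseteq> ?K" using eig by (auto simp: Z)
      show "vec.subspace ?K"
        unfolding vec.subspace_def by (auto simp: clinearD[OF S])
    qed
    show "?K \<subseteq> vec.span (state ` ?Z)"
    proof
      fix \<psi> assume \<psi>: "\<psi> \<in> ?K"
      have "\<psi> \<in> vec.span (state ` Pow P)" by (simp add: states_span)
      then obtain r where "\<psi> = (\<Sum>v\<in>state ` Pow P. r v *s v)"
        using vec.span_finite[of "state ` Pow P"] fin by auto
      then have r: "\<psi> = (\<Sum>D\<in>Pow P. r (state D) *s state D)" by (simp add: sum.reindex[OF state_inj])
      have "r (state D) * l D t = 0" if "D \<subseteq> P" "t \<in> T" for D t
      proof (rule state_coefficients[OF _ that(1), of "\<lambda>D. r (state D) * l D t"])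
        have "0 = ?S t \<psi>" using \<psi> that by auto
        also have "\<dots> = (\<Sum>D\<in>Pow P. r (state D) *s ?S t (state D))"
          unfolding r by (simp only: clinear_sum[OF S] clinear_scale[OF S])
        also have "\<dots> = (\<Sum>D\<in>Pow P. (r (state D) * l D t) *s state D)"
          by (rule sum.cong) (simp_all add: eig)
        finally show "(\<Sum>D\<in>Pow P. (r (state D) * l D t) *s state D) = 0" by simp
      qed
      then have r0: "r (state D) = 0" if "D \<subseteq> P" "D \<notin> ?Z" for D
        using that unfolding Z by auto
      have "r (state D) *s state D \<in> vec.span (state ` ?Z)" if "D \<in> Pow P" for D
      proof (cases "D \<in> ?Z")
        case True
        then show ?thesis by (intro vec.span_scale vec.span_base imageI)
      next
        case False
        then show ?thesis using r0[of D] that by (simp add: vec.span_zero)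
      qed
      then show "\<psi> \<in> vec.span (state ` ?Z)" unfolding r by (intro vec.span_sum)
    qed
  qed
  moreover have "vec.independent (state ` ?Z)"
    by (rule vec.independent_mono[OF states_independent]) auto
  ultimately have "vec.dim ?K = card (state ` ?Z)"
    using vec.dim_span_eq_card_independent[of "state ` ?Z"] by metis
  also have "\<dots> = card ?Z"
    by (intro card_image inj_on_subset[OF state_inj]) auto
  finally show ?thesis .
qed

end

section \<open>Invariant spinors as zero-sum splittings\<close>

context compact_torus_base
begin

lemma comb_root: "k \<in> pos_coeffs \<Longrightarrow> comb k \<in> roots br H"
  by (simp add: pos_coeffs_def)

lemma comb_inj: "inj_on comb pos_coeffs"
proof (rule inj_onI)
  fix k l assume "k \<in> pos_coeffs" "l \<in> pos_coeffs" and e: "comb k = comb l"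
  then have "k i = l i" for i
    by (cases "i \<in> {1..n}") (auto simp: pos_coeffs_def intro!: comb_inject[OF e])
  then show "k = l" by blast
qed

lemma finite_pos_coeffs: "finite pos_coeffs"
proof (rule finite_imageD[OF finite_subset comb_inj])
  show "comb ` pos_coeffs \<subseteq> weights" using comb_root roots_weights by blast
qed (rule finite_weights)

lemma comb_neq_neg:
  assumes "k \<in> pos_coeffs" "l \<in> pos_coeffs" shows "comb k \<noteq> (\<lambda>t. - comb l t)"
proof
  assume e: "comb k = (\<lambda>t. - comb l t)"
  then have e: "comb k = comb (\<lambda>i. - l i)" by (simp only: comb_neg)
  have "k i = 0" if "i \<in> {1..n}" for i
  proof -
    have "k i \<ge> 0" "l i \<ge> 0" using assms by (auto simp: pos_coeffs_def)
    moreover have "k i = - l i" using comb_inject[OF e that] .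
    ultimately show ?thesis by linarith
  qed
  then have "comb k t = 0" for t by (simp add: comb_def)
  then show False using comb_root[OF assms(1)] by (simp add: roots_def)
qed

text \<open>The square norm 1/2 gives \<open>ev\<close> and \<open>fv\<close> unit length, because a
  root vector is orthogonal to its conjugate.\<close>

definition rv :: "(nat \<Rightarrow> int) \<Rightarrow> complex ^ 'n" where
  "rv k = (SOME x. x \<in> ws (comb k) \<and> herm x x = 1 / 2)"

lemma rv: assumes "k \<in> pos_coeffs" shows "rv k \<in> ws (comb k)" "herm (rv k) (rv k) = 1 / 2"
proof -
  obtain x where x: "x \<in> ws (comb k)" "x \<noteq> 0" using weights_nonzero[OF roots_weights[OF comb_root[OF assms]]] .
  obtain r where r: "r > 0" "herm x x = of_real r" using herm_pos[OF x(2)] by blast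
  let ?s = "of_real (sqrt (1 / (2 * r))) :: complex"
  have "?s * ?s = of_real (1 / (2 * r))" using r by (simp flip: of_real_mult)
  then have "herm (?s *s x) (?s *s x) = of_real (1 / (2 * r) * r)"
    using r by (simp add: herm_l herm_r mult.assoc[symmetric])
  then have "?s *s x \<in> ws (comb k) \<and> herm (?s *s x) (?s *s x) = 1 / 2"
    using x r vec.subspace_scale[OF ws_subspace] by simp
  then show "rv k \<in> ws (comb k)" "herm (rv k) (rv k) = 1 / 2"
    unfolding rv_def by (metis (mono_tags, lifting) someI)+
qed

lemma rv_weights:
  assumes "k \<in> pos_coeffs"
  shows "comb k \<in> weights" "(\<lambda>t. - comb k t) \<in> weights" "cjg (rv k) \<in> ws (\<lambda>t. - comb k t)"
  using roots_weights[OF comb_root[OF assms]] weights_neg ws_conj rv(1)[OF assms] by auto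

lemma herm_cjg: "herm (cjg x) (cjg y) = cnj (herm x y)"
  using kil_conj[of x "cjg y"] by (simp add: herm_def)

lemma herm_rv:
  assumes k: "k \<in> pos_coeffs" and l: "l \<in> pos_coeffs"
  shows "herm (rv k) (rv l) = (if k = l then 1 / 2 else 0)"
    and "herm (cjg (rv k)) (cjg (rv l)) = (if k = l then 1 / 2 else 0)"
    and "herm (rv k) (cjg (rv l)) = 0" and "herm (cjg (rv k)) (rv l) = 0"
proof -
  show 1: "herm (rv k) (rv l) = (if k = l then 1 / 2 else 0)"
    using rv[OF k] rv[OF l] ws_orthogonal[OF rv_weights(1)[OF k] rv_weights(1)[OF l]] inj_onD[OF comb_inj _ k l]
    by auto
  show "herm (cjg (rv k)) (cjg (rv l)) = (if k = l then 1 / 2 else 0)" unfolding herm_cjg 1 by simp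
  show "herm (rv k) (cjg (rv l)) = 0"
    by (rule ws_orthogonal[OF rv_weights(1)[OF k] rv_weights(2)[OF l] comb_neq_neg[OF k l] rv(1)[OF k] rv_weights(3)[OF l]])
  show "herm (cjg (rv k)) (rv l) = 0"
    by (rule ws_orthogonal[OF rv_weights(2)[OF k] rv_weights(1)[OF l] comb_neq_neg[OF l k, symmetric] rv_weights(3)[OF k] rv(1)[OF l]])
qed

text \<open>The real and imaginary combinations \<open>ev\<close>, \<open>fv\<close> lie in g, and t
  in h rotates their plane with speed \<open>angle\<close>.\<close>

definition ev :: "(nat \<Rightarrow> int) \<Rightarrow> complex ^ 'n" where "ev k = rv k + cjg (rv k)"
definition fv :: "(nat \<Rightarrow> int) \<Rightarrow> complex ^ 'n" where "fv k = \<i> *s (rv k - cjg (rv k))"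
definition angle :: "(nat \<Rightarrow> int) \<Rightarrow> complex ^ 'n \<Rightarrow> real" where "angle k t = Im (comb k t)"

lemma ev_g: "ev k \<in> g" and fv_g: "fv k \<in> g"
proof -
  show "ev k \<in> g" by (rule cjg_fixed_in_g) (simp add: ev_def cjg_add cjg_conj add.commute)
  show "fv k \<in> g"
    by (rule cjg_fixed_in_g) (simp add: fv_def cjg_scale cjg_diff cjg_conj vec.scale_right_diff_distrib)
qed

lemma herm_ev_fv:
  assumes "k \<in> pos_coeffs" "l \<in> pos_coeffs"
  shows "herm (ev k) (ev l) = (if k = l then 1 else 0)" "herm (fv k) (fv l) = (if k = l then 1 else 0)"
    "herm (ev k) (fv l) = 0" "herm (fv k) (ev l) = 0"
  by (simp_all add: ev_def fv_def herm_l herm_r herm_rv[OF assms])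

lemma comb_h: "k \<in> pos_coeffs \<Longrightarrow> t \<in> h \<Longrightarrow> comb k t = \<i> * of_real (angle k t)"
  using weight_skew[OF rv_weights(1), of k t] by (simp add: angle_def complex_eq_iff)

lemma br_ev_fv:
  assumes k: "k \<in> pos_coeffs" and t: "t \<in> h"
  shows "br t (ev k) = of_real (angle k t) *s fv k" "br t (fv k) = - of_real (angle k t) *s ev k"
proof -
  have 1: "br t (rv k) = (\<i> * of_real (angle k t)) *s rv k"
    using wsD[OF rv(1)[OF k] h_H[OF t]] comb_h[OF k t] by simp
  have 2: "br t (cjg (rv k)) = (- \<i> * of_real (angle k t)) *s cjg (rv k)"
    using wsD[OF rv_weights(3)[OF k] h_H[OF t]] comb_h[OF k t] by simp
  show "br t (ev k) = of_real (angle k t) *s fv k" "br t (fv k) = - of_real (angle k t) *s ev k"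
    unfolding ev_def fv_def br_r 1 2 by (simp_all add: vec_eq_iff algebra_simps)
qed

abbreviation m :: "(complex ^ 'n) set" where "m \<equiv> isotropy_module br g h"

lemma m_iff: "x \<in> m \<longleftrightarrow> x \<in> g \<and> (\<forall>y\<in>h. herm x y = 0)"
  unfolding isotropy_module_def using kil_g h_g by (auto simp: herm_def cjg_g)

lemma m_subspace: "subspace m"
  unfolding subspace_def
  by (auto simp: m_iff herm_l g_closed subspace_scale[OF g_subspace]) (simp add: scaleR_eq_vector_smult herm_l)

lemma herm_g: "x \<in> g \<Longrightarrow> y \<in> g \<Longrightarrow> herm x y = of_real (- killing_form br g x y)"
  by (simp add: herm_def cjg_g kil_g)

lemma ev_m: "k \<in> pos_coeffs \<Longrightarrow> ev k \<in> m" and fv_m: "k \<in> pos_coeffs \<Longrightarrow> fv k \<in> m"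
proof -
  assume k: "k \<in> pos_coeffs"
  have "herm (rv k) y = 0 \<and> herm (cjg (rv k)) y = 0" if y: "y \<in> h" for y
  proof (cases "y = 0")
    case False
    have y0: "y \<in> ws (\<lambda>t. 0)" using ws_0 h_H[OF y] by simp
    then have w0: "(\<lambda>t. 0) \<in> weights" using weightsI[of "\<lambda>t. 0" y] False by simp
    have "comb k \<noteq> (\<lambda>t. 0)" using comb_root[OF k] by (auto simp: roots_def)
    moreover from this have "(\<lambda>t. - comb k t) \<noteq> (\<lambda>t. 0)" by (auto simp: fun_eq_iff)
    ultimately show ?thesis
      using ws_orthogonal[OF rv_weights(1)[OF k] w0 _ rv(1)[OF k] y0]
        ws_orthogonal[OF rv_weights(2)[OF k] w0 _ rv_weights(3)[OF k] y0] by blast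
  qed (simp add: herm_r)
  then have "herm (ev k) y = 0" "herm (fv k) y = 0" if "y \<in> h" for y
    using that by (simp_all add: ev_def fv_def herm_l)
  then show "ev k \<in> m" "fv k \<in> m" by (simp_all add: m_iff ev_g fv_g)
qed

text \<open>The difference w of the two sides is orthogonal to all \<open>ev\<close> and
  \<open>fv\<close>, hence to all root spaces, which are one-dimensional; it is also orthogonal to
  H. By the root decomposition w is orthogonal to itself.\<close>

lemma m_expansion:
  assumes v: "v \<in> m"
  shows "v = (\<Sum>k\<in>pos_coeffs. Re (herm v (ev k)) *\<^sub>R ev k + Re (herm v (fv k)) *\<^sub>R fv k)"
proof -
  define w where "w = v - (\<Sum>k\<in>pos_coeffs. Re (herm v (ev k)) *\<^sub>R ev k + Re (herm v (fv k)) *\<^sub>R fv k)"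
  have vg: "v \<in> g" using v by (simp add: m_iff)
  have wm: "w \<in> m"
    unfolding w_def by (intro subspace_diff subspace_sum subspace_add subspace_scale m_subspace v ev_m fv_m)
  have re: "of_real (Re (herm v (ev l))) = herm v (ev l)" "of_real (Re (herm v (fv l))) = herm v (fv l)" for l
    by (simp_all add: herm_g vg ev_g fv_g)
  have wE: "herm w (ev k) = 0" and wF: "herm w (fv k) = 0" if k: "k \<in> pos_coeffs" for k
  proof -
    have "herm w (ev k) = herm v (ev k) - (\<Sum>l\<in>pos_coeffs. if l = k then herm v (ev k) else 0)"
      unfolding w_def herm_l
      by (intro arg_cong2[where f = "(-)"] refl sum.cong)
        (auto simp: herm_l herm_ev_fv k scaleR_eq_vector_smult re)
    then show "herm w (ev k) = 0" using k finite_pos_coeffs by simp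
    have "herm w (fv k) = herm v (fv k) - (\<Sum>l\<in>pos_coeffs. if l = k then herm v (fv k) else 0)"
      unfolding w_def herm_l
      by (intro arg_cong2[where f = "(-)"] refl sum.cong)
        (auto simp: herm_l herm_ev_fv k scaleR_eq_vector_smult re)
    then show "herm w (fv k) = 0" using k finite_pos_coeffs by simp
  qed
  have wH: "herm w z = 0" if "z \<in> H" for z
    using that unfolding H_def
    by (induction rule: vec.span_induct_alt) (use wm in \<open>simp_all add: herm_r m_iff\<close>)
  \<comment> \<open>Orthogonality to \<open>ev k\<close> and \<open>fv k\<close> gives the sum and
    the difference of these two products.\<close>
  have wr: "herm w (rv k) = 0" "herm w (cjg (rv k)) = 0" if k: "k \<in> pos_coeffs" for k
  proof -
    have 1: "herm w (rv k) + herm w (cjg (rv k)) = 0" using wE[OF k] by (simp add: ev_def herm_r)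
    have 2: "herm w (rv k) = herm w (cjg (rv k))" using wF[OF k] by (simp add: fv_def herm_r)
    show "herm w (rv k) = 0" "herm w (cjg (rv k)) = 0" using 1 2 by auto
  qed
  have wR: "herm w z = 0" if \<alpha>: "\<alpha> \<in> roots br H" and z: "z \<in> ws \<alpha>" for \<alpha> z
  proof -
    obtain k where k: "k \<in> pos_coeffs" "\<alpha> = comb k \<or> \<alpha> = (\<lambda>t. - comb k t)" using roots_pos_or_neg[OF \<alpha>] by blast
    have nz: "rv k \<noteq> 0" using rv(2)[OF k(1)] by (auto simp: herm_l)
    have "\<exists>c. z = c *s rv k \<or> z = c *s cjg (rv k)"
      using k(2)
    proof
      assume "\<alpha> = comb k"
      then show ?thesis using root_space_one_dim[OF \<alpha> _ nz z] rv(1)[OF k(1)] by blast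
    next
      assume "\<alpha> = (\<lambda>t. - comb k t)"
      then show ?thesis
        using root_space_one_dim[OF \<alpha> _ _ z, of "cjg (rv k)"] rv_weights(3)[OF k(1)] nz cjg_eq_0 by blast
    qed
    then show ?thesis using wr[OF k(1)] by (auto simp: herm_r)
  qed
  have "herm w z = 0" if "z \<in> vec.span (H \<union> (\<Union>\<alpha>\<in>roots br H. ws \<alpha>))" for z
    using that by (induction rule: vec.span_induct_alt) (use wH wR in \<open>auto simp: herm_r\<close>)
  then have "herm w w = 0" by (simp add: root_decomposition)
  then show ?thesis using herm_eq_0[of w] by (simp add: w_def)
qed

end

section \<open>The lift of the isotropy representation to spinors\<close>

locale compact_torus_spin = compact_torus_base br g h n a A
  for br :: "'n::finite bracket" and g h :: "(complex ^ 'n) set" and n :: nat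
    and a :: "nat \<Rightarrow> complex ^ 'n \<Rightarrow> complex" and A :: "nat \<Rightarrow> nat \<Rightarrow> int" +
  fixes c :: "complex ^ 'n \<Rightarrow> complex ^ 's::finite \<Rightarrow> complex ^ 's"
  assumes spinor: "spinor_module br g h c"
begin

lemma cliff: "clifford_module m (\<lambda>x y. - killing_form br g x y) c"
  and cliff_irreducible: "\<And>W. vec.subspace W \<Longrightarrow> (\<And>x \<psi>. x \<in> m \<Longrightarrow> \<psi> \<in> W \<Longrightarrow> c x \<psi> \<in> W) \<Longrightarrow> W = {0} \<or> W = UNIV"
  using spinor by (auto simp: spinor_module_def irreducible_clifford_module_def)

lemma c_lin: "x \<in> m \<Longrightarrow> clinear (c x)"
  and c_add: "x \<in> m \<Longrightarrow> y \<in> m \<Longrightarrow> c (x + y) \<psi> = c x \<psi> + c y \<psi>"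
  and c_scale: "x \<in> m \<Longrightarrow> c (r *\<^sub>R x) \<psi> = r *\<^sub>R c x \<psi>"
  and c_sq: "x \<in> m \<Longrightarrow> c x (c x \<psi>) = killing_form br g x x *\<^sub>R \<psi>"
  using cliff by (auto simp: clifford_module_def)

lemmas c_simps = clinearD[OF c_lin]

lemma c_sum:
  assumes "\<And>i. i \<in> I \<Longrightarrow> u i \<in> m" shows "c (sum u I) \<psi> = (\<Sum>i\<in>I. c (u i) \<psi>)"
  using assms
proof (induction I rule: infinite_finite_induct)
  case empty
  then show ?case using c_scale[OF subspace_0[OF m_subspace], of 0 \<psi>] by simp
next
  case (infinite I)
  then show ?case using c_scale[OF subspace_0[OF m_subspace], of 0 \<psi>] by simp
next
  case (insert i I)
  then show ?case using c_add[of "u i" "sum u I"] subspace_sum[OF m_subspace, of I u] by simp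
qed

text \<open>Polarization of the Clifford relation for squares.\<close>

lemma c_anticommute:
  assumes "x \<in> m" "y \<in> m"
  shows "c x (c y \<psi>) + c y (c x \<psi>) = (- 2 * herm x y) *s \<psi>"
proof -
  have q: "c z (c z \<psi>) = (- herm z z) *s \<psi>" if "z \<in> m" for z \<psi>
    using c_sq[OF that] herm_g[of z z] that by (simp add: m_iff scaleR_eq_vector_smult)
  have xy: "x + y \<in> m" using assms subspace_add[OF m_subspace] by blast
  have "herm y x = herm x y"
    using herm_cnj[of x y] assms herm_g[of y x] by (simp add: m_iff)
  have "c (x + y) (c (x + y) \<psi>) = c x (c x \<psi>) + c y (c y \<psi>) + (c x (c y \<psi>) + c y (c x \<psi>))"
    using assms by (simp add: c_add c_simps)
  then have "c x (c y \<psi>) + c y (c x \<psi>) = (- herm (x + y) (x + y)) *s \<psi> - (- herm x x) *s \<psi> - (- herm y y) *s \<psi>"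
    unfolding q[OF xy] q[OF assms(1)] q[OF assms(2)] by (simp add: algebra_simps)
  also have "\<dots> = (- 2 * herm x y) *s \<psi>"
    using \<open>herm y x = herm x y\<close> by (simp add: herm_l herm_r vec_eq_iff algebra_simps)
  finally show ?thesis .
qed

lemma c_expansion:
  assumes v: "v \<in> m"
  shows "c v \<psi> = (\<Sum>k\<in>pos_coeffs. Re (herm v (ev k)) *\<^sub>R c (ev k) \<psi> + Re (herm v (fv k)) *\<^sub>R c (fv k) \<psi>)"
proof -
  have "c v \<psi> = c (\<Sum>k\<in>pos_coeffs. Re (herm v (ev k)) *\<^sub>R ev k + Re (herm v (fv k)) *\<^sub>R fv k) \<psi>"
    using m_expansion[OF v] by simp
  also have "\<dots> = (\<Sum>k\<in>pos_coeffs. c (Re (herm v (ev k)) *\<^sub>R ev k + Re (herm v (fv k)) *\<^sub>R fv k) \<psi>)"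
    by (intro c_sum subspace_add subspace_scale m_subspace ev_m fv_m)
  also have "\<dots> = (\<Sum>k\<in>pos_coeffs. Re (herm v (ev k)) *\<^sub>R c (ev k) \<psi> + Re (herm v (fv k)) *\<^sub>R c (fv k) \<psi>)"
    by (intro sum.cong refl) (simp add: c_add c_scale ev_m fv_m subspace_scale[OF m_subspace])
  finally show ?thesis .
qed

text \<open>Irreducibility transfers because the Clifford product of any vector of m is a
  combination of those of the \<open>ev\<close> and \<open>fv\<close>.\<close>

sublocale pairs: clifford_pairs pos_coeffs "\<lambda>k. c (ev k)" "\<lambda>k. c (fv k)"
proof (rule clifford_pairs.intro)
  fix k \<psi> assume k: "k \<in> pos_coeffs"
  show "clinear (c (ev k))" "clinear (c (fv k))" using k by (simp_all add: c_lin ev_m fv_m)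
  have n: "x = - \<psi>" if "x + x = - 2 *s \<psi>" for x :: "complex ^ 's"
  proof -
    have "x = (1 / 2) *s (x + x)" by (simp add: vec_eq_iff)
    then show ?thesis unfolding that by (simp add: vec_eq_iff)
  qed
  show "c (ev k) (c (ev k) \<psi>) = - \<psi>"
    using c_anticommute[OF ev_m[OF k] ev_m[OF k], of \<psi>] by (intro n) (simp add: herm_ev_fv[OF k k])
  show "c (fv k) (c (fv k) \<psi>) = - \<psi>"
    using c_anticommute[OF fv_m[OF k] fv_m[OF k], of \<psi>] by (intro n) (simp add: herm_ev_fv[OF k k])
next
  fix k l \<psi> assume kl: "k \<in> pos_coeffs" "l \<in> pos_coeffs"
  show "c (fv k) (c (ev l) \<psi>) = - c (ev l) (c (fv k) \<psi>)"
    using c_anticommute[OF fv_m[OF kl(1)] ev_m[OF kl(2)], of \<psi>]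
    by (simp add: herm_ev_fv[OF kl] eq_neg_iff_add_eq_0)
  assume "k \<noteq> l"
  then show "c (ev k) (c (ev l) \<psi>) = - c (ev l) (c (ev k) \<psi>)"
    "c (fv k) (c (fv l) \<psi>) = - c (fv l) (c (fv k) \<psi>)"
    using c_anticommute[OF ev_m[OF kl(1)] ev_m[OF kl(2)], of \<psi>] c_anticommute[OF fv_m[OF kl(1)] fv_m[OF kl(2)], of \<psi>]
    by (simp_all add: herm_ev_fv[OF kl] eq_neg_iff_add_eq_0)
next
  fix W :: "(complex ^ 's) set"
  assume W: "vec.subspace W" "\<And>k \<psi>. k \<in> pos_coeffs \<Longrightarrow> \<psi> \<in> W \<Longrightarrow> c (ev k) \<psi> \<in> W \<and> c (fv k) \<psi> \<in> W"
  show "W = {0} \<or> W = UNIV"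
  proof (rule cliff_irreducible[OF W(1)])
    fix x \<psi> assume "x \<in> m" "\<psi> \<in> W"
    then show "c x \<psi> \<in> W"
      unfolding c_expansion[OF \<open>x \<in> m\<close>] scaleR_eq_vector_smult
      using W(2) by (intro vec.subspace_sum vec.subspace_add vec.subspace_scale W(1)) auto
  qed
qed (rule finite_pos_coeffs)

text \<open>The factor 1/2 compensates for the commutator of J k with the product by
  \<open>ev k\<close>, which is twice the product by \<open>fv k\<close>.\<close>

definition lift :: "complex ^ 'n \<Rightarrow> complex ^ 's \<Rightarrow> complex ^ 's" where
  "lift t \<psi> = (\<Sum>k\<in>pos_coeffs. (angle k t / 2) *\<^sub>R pairs.J k \<psi>)"

lemma lift_lin: "clinear (lift t)"
  by (simp add: clinear_iff lift_def pairs.J_simps scaleR_add_right sum.distrib scaleR_eq_vector_smult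
      vec.scale_sum_right mult.commute)

text \<open>As the two products anticommute, J is half of their commutator; hence the coefficients
  angle / 4. The enumeration u supplies the numbering that \<open>spin_lie_algebra\<close>
  uses.\<close>

lemma lift_in_spin: "lift t \<in> spin_lie_algebra m c"
proof -
  obtain u where u: "bij_betw u {..<card pos_coeffs} pos_coeffs"
    using ex_bij_betw_nat_finite[OF finite_pos_coeffs] by (auto simp: atLeast0LessThan)
  have "lift t \<psi> = (\<Sum>j<card pos_coeffs. (angle (u j) t / 4) *\<^sub>R (c (ev (u j)) (c (fv (u j)) \<psi>) - c (fv (u j)) (c (ev (u j)) \<psi>)))" for \<psi>
    unfolding lift_def sum.reindex_bij_betw[OF u, symmetric]
  proof (rule sum.cong[OF refl])
    fix j assume "j \<in> {..<card pos_coeffs}"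
    then have "u j \<in> pos_coeffs" using u by (auto simp: bij_betw_def)
    then show "(angle (u j) t / 2) *\<^sub>R pairs.J (u j) \<psi> =
        (angle (u j) t / 4) *\<^sub>R (c (ev (u j)) (c (fv (u j)) \<psi>) - c (fv (u j)) (c (ev (u j)) \<psi>))"
      by (simp add: pairs.J_def pairs.fe scaleR_eq_vector_smult vec_eq_iff)
  qed
  moreover have "\<forall>j<card pos_coeffs. ev (u j) \<in> m \<and> fv (u j) \<in> m"
    using u ev_m fv_m by (auto simp: bij_betw_def)
  ultimately show ?thesis
    unfolding spin_lie_algebra_def mem_Collect_eq fun_eq_iff
    by (intro exI[of _ "card pos_coeffs"] exI[of _ "\<lambda>j. angle (u j) t / 4"] exI[of _ "\<lambda>j. ev (u j)"]
      exI[of _ "\<lambda>j. fv (u j)"]) simp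
qed

text \<open>All J k with k different from l commute with both products, so only the summand at l
  survives.\<close>

lemma lift_commutator_basis:
  assumes l: "l \<in> pos_coeffs" and t: "t \<in> h"
  shows "lift t (c (ev l) \<psi>) - c (ev l) (lift t \<psi>) = c (br t (ev l)) \<psi>"
    and "lift t (c (fv l) \<psi>) - c (fv l) (lift t \<psi>) = c (br t (fv l)) \<psi>"
proof -
  have "lift t (c (ev l) \<psi>) - c (ev l) (lift t \<psi>) =
      (\<Sum>k\<in>pos_coeffs. (angle k t / 2) *\<^sub>R (pairs.J k (c (ev l) \<psi>) - c (ev l) (pairs.J k \<psi>)))"
    unfolding lift_def pairs.e_simps[OF l] clinear_scaleR[OF pairs.e_lin[OF l]]
    by (simp add: sum_subtractf scaleR_diff_right)
  also have "\<dots> = (\<Sum>k\<in>pos_coeffs. if k = l then angle l t *\<^sub>R c (fv l) \<psi> else 0)"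
    by (rule sum.cong) (auto simp: pairs.J_e_same pairs.J_e_other l scaleR_eq_vector_smult vec_eq_iff)
  also have "\<dots> = c (br t (ev l)) \<psi>"
    using l finite_pos_coeffs c_scale[OF fv_m[OF l]] br_ev_fv(1)[OF l t] by (simp add: scaleR_eq_vector_smult)
  finally show "lift t (c (ev l) \<psi>) - c (ev l) (lift t \<psi>) = c (br t (ev l)) \<psi>" .
  have "lift t (c (fv l) \<psi>) - c (fv l) (lift t \<psi>) =
      (\<Sum>k\<in>pos_coeffs. (angle k t / 2) *\<^sub>R (pairs.J k (c (fv l) \<psi>) - c (fv l) (pairs.J k \<psi>)))"
    unfolding lift_def pairs.f_simps[OF l] clinear_scaleR[OF pairs.f_lin[OF l]]
    by (simp add: sum_subtractf scaleR_diff_right)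
  also have "\<dots> = (\<Sum>k\<in>pos_coeffs. if k = l then (- angle l t) *\<^sub>R c (ev l) \<psi> else 0)"
    by (rule sum.cong) (auto simp: pairs.J_f_same pairs.J_f_other l scaleR_eq_vector_smult vec_eq_iff)
  also have "\<dots> = c (br t (fv l)) \<psi>"
    using l finite_pos_coeffs c_scale[OF ev_m[OF l], of "- angle l t"] br_ev_fv(2)[OF l t] by (simp add: scaleR_eq_vector_smult)
  finally show "lift t (c (fv l) \<psi>) - c (fv l) (lift t \<psi>) = c (br t (fv l)) \<psi>" .
qed

lemma lift_commutator:
  assumes v: "v \<in> m" and t: "t \<in> h"
  shows "lift t (c v \<psi>) - c v (lift t \<psi>) = c (br t v) \<psi>"
proof -
  let ?x = "\<lambda>k. Re (herm v (ev k))" and ?y = "\<lambda>k. Re (herm v (fv k))"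
  have bm: "br t (ev k) \<in> m" "br t (fv k) \<in> m" if "k \<in> pos_coeffs" for k
    using br_ev_fv[OF that t] subspace_scale[OF m_subspace fv_m[OF that], of "angle k t"]
      subspace_scale[OF m_subspace ev_m[OF that], of "- angle k t"] by (simp_all add: scaleR_eq_vector_smult)
  have "br t v = br t (\<Sum>k\<in>pos_coeffs. ?x k *\<^sub>R ev k + ?y k *\<^sub>R fv k)"
    using m_expansion[OF v] by simp
  also have "\<dots> = (\<Sum>k\<in>pos_coeffs. ?x k *\<^sub>R br t (ev k) + ?y k *\<^sub>R br t (fv k))"
    by (simp add: br_r clinear_scaleR[OF br_clinear(1)])
  finally have "c (br t v) \<psi> = c (\<Sum>k\<in>pos_coeffs. ?x k *\<^sub>R br t (ev k) + ?y k *\<^sub>R br t (fv k)) \<psi>" by simp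
  also have "\<dots> = (\<Sum>k\<in>pos_coeffs. c (?x k *\<^sub>R br t (ev k) + ?y k *\<^sub>R br t (fv k)) \<psi>)"
    by (intro c_sum subspace_add subspace_scale m_subspace bm)
  also have "\<dots> = (\<Sum>k\<in>pos_coeffs. ?x k *\<^sub>R c (br t (ev k)) \<psi> + ?y k *\<^sub>R c (br t (fv k)) \<psi>)"
    by (intro sum.cong refl) (simp add: c_add c_scale bm subspace_scale[OF m_subspace])
  also have "\<dots> = (\<Sum>k\<in>pos_coeffs. ?x k *\<^sub>R (lift t (c (ev k) \<psi>) - c (ev k) (lift t \<psi>)) +
      ?y k *\<^sub>R (lift t (c (fv k) \<psi>) - c (fv k) (lift t \<psi>)))"
    by (intro sum.cong refl) (simp add: lift_commutator_basis t)
  also have "\<dots> = lift t (c v \<psi>) - c v (lift t \<psi>)"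
    unfolding c_expansion[OF v] clinear_sum[OF lift_lin] clinear_add[OF lift_lin] clinear_scaleR[OF lift_lin]
    by (simp add: sum_subtractf[symmetric] scaleR_diff_right algebra_simps)
  finally show ?thesis by simp
qed

text \<open>Elements are sums of commutators. The vanishing trace excludes nonzero scalars, which
  uniqueness of the lift needs.\<close>

lemma spin_lie_algebra_traceless:
  assumes "S \<in> spin_lie_algebra m c"
  shows "clinear S" "ctrace (cart_basis :: (complex ^ 's) set) S = 0"
proof -
  obtain N :: nat and r :: "nat \<Rightarrow> real" and x y where xy: "\<And>k. k < N \<Longrightarrow> x k \<in> m \<and> y k \<in> m"
    and S: "S = (\<lambda>\<psi>. \<Sum>k<N. r k *\<^sub>R (c (x k) (c (y k) \<psi>) - c (y k) (c (x k) \<psi>)))"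
    using assms unfolding spin_lie_algebra_def by blast
  show "clinear S"
    unfolding clinear_iff S scaleR_eq_vector_smult
    using xy by (auto simp: c_simps vec.scale_sum_right sum.distrib[symmetric] vec_eq_iff algebra_simps intro!: sum.cong)
  let ?B = "cart_basis :: (complex ^ 's) set"
  note B = independent_cart_basis[where ?'a = complex and ?'b = 's]
  have "ctrace ?B S = (\<Sum>k<N. of_real (r k) * (ctrace ?B (\<lambda>\<psi>. c (x k) (c (y k) \<psi>)) - ctrace ?B (\<lambda>\<psi>. c (y k) (c (x k) \<psi>))))"
    unfolding S scaleR_eq_vector_smult by (simp add: ctrace_sum[OF B] ctrace_scale[OF B] ctrace_diff[OF B] algebra_simps)
  also have "\<dots> = (\<Sum>k<N. 0)"
  proof (rule sum.cong[OF refl])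
    fix k assume "k \<in> {..<N}"
    then have "ctrace ?B (\<lambda>\<psi>. c (x k) (c (y k) \<psi>)) = ctrace ?B (\<lambda>\<psi>. c (y k) (c (x k) \<psi>))"
      using xy by (intro ctrace_commute[OF B]) (auto simp: c_lin)
    then show "of_real (r k) * (ctrace ?B (\<lambda>\<psi>. c (x k) (c (y k) \<psi>)) - ctrace ?B (\<lambda>\<psi>. c (y k) (c (x k) \<psi>))) = 0"
      by simp
  qed
  finally show "ctrace ?B S = 0" by simp
qed

text \<open>Two candidates differ by an operator that commutes with all Clifford products. By Schur
  it is a scalar, and its trace is zero.\<close>

lemma spin_isotropy_eq:
  assumes t: "t \<in> h"
  shows "spin_isotropy br g h c t = lift t"
  unfolding spin_isotropy_def
proof (rule the_equality)
  show "lift t \<in> spin_lie_algebra m c \<and> (\<forall>v\<in>m. \<forall>\<psi>. lift t (c v \<psi>) - c v (lift t \<psi>) = c (br t v) \<psi>)"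
    using lift_in_spin lift_commutator[OF _ t] by blast
next
  fix S assume S: "S \<in> spin_lie_algebra m c \<and> (\<forall>v\<in>m. \<forall>\<psi>. S (c v \<psi>) - c v (S \<psi>) = c (br t v) \<psi>)"
  let ?D = "\<lambda>\<psi>. S \<psi> - lift t \<psi>"
  note Sl = spin_lie_algebra_traceless[OF conjunct1[OF S]]
  have D: "clinear ?D" by (simp add: clinear_iff clinearD[OF Sl(1)] clinearD[OF lift_lin] vec.scale_right_diff_distrib)
  have "?D (c v \<psi>) = c v (?D \<psi>)" if v: "v \<in> m" for v \<psi>
  proof -
    have "S (c v \<psi>) - c v (S \<psi>) = lift t (c v \<psi>) - c v (lift t \<psi>)"
      using S v lift_commutator[OF v t] by simp
    then show ?thesis by (simp add: c_simps[OF v] algebra_simps)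
  qed
  then obtain l where l: "\<And>\<psi>. ?D \<psi> = l *s \<psi>"
    using schur_scalar[OF D, of m c] c_lin cliff_irreducible by blast
  let ?B = "cart_basis :: (complex ^ 's) set"
  note B = independent_cart_basis[where ?'a = complex and ?'b = 's]
  have "ctrace ?B ?D = 0"
    using ctrace_diff[OF B, of S "lift t"] Sl(2) spin_lie_algebra_traceless(2)[OF lift_in_spin] by simp
  then have "l * of_nat (card ?B) = 0"
    unfolding l using ctrace_scale[OF B, of "\<lambda>\<psi>. \<psi>" l] ctrace_ident[OF B] by simp
  moreover have "card ?B \<noteq> 0" by (simp add: card_cart_basis)
  ultimately have "l = 0" by simp
  then show "S = lift t" using l by (auto simp: fun_eq_iff)
qed

lemma comb_sum: "(\<Sum>k\<in>D. comb k t) = comb (\<lambda>i. \<Sum>k\<in>D. k i) t"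
  unfolding comb_def by (subst sum.swap) (simp add: sum_distrib_right)

text \<open>Equality on h extends to H by complex linearity and is trivial off H; independence of
  the simple roots then compares coordinates.\<close>

lemma zero_sum_iff:
  assumes "D \<subseteq> pos_coeffs" "E \<subseteq> pos_coeffs"
  shows "(\<forall>t\<in>h. (\<Sum>k\<in>D. angle k t / 2) = (\<Sum>k\<in>E. angle k t / 2)) \<longleftrightarrow> (\<forall>i. (\<Sum>k\<in>D. k i) = (\<Sum>k\<in>E. k i))"
proof
  assume "\<forall>i. (\<Sum>k\<in>D. k i) = (\<Sum>k\<in>E. k i)"
  then have "(\<Sum>k\<in>D. comb k t) = (\<Sum>k\<in>E. comb k t)" for t by (simp add: comb_sum)
  then have "Im (\<Sum>k\<in>D. comb k t) = Im (\<Sum>k\<in>E. comb k t)" for t by simp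
  then show "\<forall>t\<in>h. (\<Sum>k\<in>D. angle k t / 2) = (\<Sum>k\<in>E. angle k t / 2)"
    by (simp add: angle_def sum_divide_distrib[symmetric])
next
  assume *: "\<forall>t\<in>h. (\<Sum>k\<in>D. angle k t / 2) = (\<Sum>k\<in>E. angle k t / 2)"
  have h: "(\<Sum>k\<in>D. comb k t) = (\<Sum>k\<in>E. comb k t)" if t: "t \<in> h" for t
  proof -
    have "(\<Sum>k\<in>X. comb k t) = 2 * \<i> * of_real (\<Sum>k\<in>X. angle k t / 2)" if "X \<subseteq> pos_coeffs" for X
      unfolding of_real_sum sum_distrib_left using comb_h[OF _ t] that by (intro sum.cong) auto
    from this[OF assms(1)] this[OF assms(2)] show ?thesis
      by (simp only: *[rule_format, OF t])
  qed
  have e: "(\<Sum>k\<in>D. comb k t) = (\<Sum>k\<in>E. comb k t)" for t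
  proof (cases "t \<in> H")
    case True
    have lin: "(\<Sum>k\<in>X. comb k (r *s x + y)) = r * (\<Sum>k\<in>X. comb k x) + (\<Sum>k\<in>X. comb k y)"
      "(\<Sum>k\<in>X. comb k 0) = 0"
      if "X \<subseteq> pos_coeffs" "x \<in> H" "y \<in> H" for X r x y
      unfolding sum_distrib_left sum.distrib[symmetric] using that
      by (auto intro!: sum.cong sum.neutral simp: weight_add[OF rv_weights(1)] weight_scale[OF rv_weights(1)]
         weight_0[OF rv_weights(1)] vec.subspace_scale[OF H_subspace])
    have "t \<in> H \<and> (\<Sum>k\<in>D. comb k t) = (\<Sum>k\<in>E. comb k t)"
      using True[unfolded H_def]
    proof (induction rule: vec.span_induct_alt)
      case base
      note z = vec.subspace_0[OF H_subspace]
      show ?case using lin(2)[OF assms(1) z z] lin(2)[OF assms(2) z z] z by simp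
    next
      case (step r x y)
      then have "x \<in> H" "y \<in> H" using h_H by auto
      then show ?case
        using step h[OF step(1)] lin(1)[OF assms(1), of x y r] lin(1)[OF assms(2), of x y r]
          vec.subspace_add[OF H_subspace vec.subspace_scale[OF H_subspace]] by simp
    qed
    then show ?thesis by simp
  next
    case False
    have "(\<Sum>k\<in>X. comb k t) = 0" if "X \<subseteq> pos_coeffs" for X
      using that False comb_root by (intro sum.neutral) (auto simp: roots_def)
    then show ?thesis using assms by simp
  qed
  have "(\<Sum>k\<in>D. k i) = (\<Sum>k\<in>E. k i)" if "i \<in> {1..n}" for i
    by (rule comb_inject[OF _ that]) (simp add: fun_eq_iff comb_sum[symmetric] e)
  moreover have "(\<Sum>k\<in>X. k i) = 0" if "i \<notin> {1..n}" "X \<subseteq> pos_coeffs" for i X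
    using that by (intro sum.neutral) (auto simp: pos_coeffs_def)
  ultimately show "\<forall>i. (\<Sum>k\<in>D. k i) = (\<Sum>k\<in>E. k i)" using assms by metis
qed

theorem dim_invariant_spinors:
  "vec.dim (invariant_spinors br g h c) = card (zero_sum_splittings (positive_roots A n))"
proof -
  have inv: "invariant_spinors br g h c = {\<psi>. \<forall>t\<in>h. (\<Sum>k\<in>pos_coeffs. (angle k t / 2) *\<^sub>R pairs.J k \<psi>) = 0}"
    unfolding invariant_spinors_def by (auto simp: spin_isotropy_eq lift_def)
  have "{D. D \<subseteq> pos_coeffs \<and> (\<forall>t\<in>h. (\<Sum>k\<in>D. angle k t / 2) = (\<Sum>k\<in>pos_coeffs - D. angle k t / 2))} =
      zero_sum_splittings pos_coeffs"
    unfolding zero_sum_splittings_def by (intro set_eqI) (simp add: zero_sum_iff[OF _ Diff_subset] cong: conj_cong)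
  then show ?thesis
    using pairs.dim_joint_kernel[of h "\<lambda>k t. angle k t / 2"] unfolding inv by (simp only: pos_coeffs_eq)
qed

lemma admits_iff:
  "admits_invariant_spinors br g h c \<longleftrightarrow> vec.dim (invariant_spinors br g h c) \<noteq> 0"
proof -
  have "(\<forall>\<psi>\<in>invariant_spinors br g h c. \<psi> = 0) \<longleftrightarrow> invariant_spinors br g h c \<subseteq> {0}" by auto
  then show ?thesis unfolding admits_invariant_spinors_def by (auto simp: vec.dim_eq_0)
qed

end

text \<open>The only passage from Lie algebras to combinatorics: from here on just the Cartan matrix
  and the rank are used.\<close>

lemma dim_invariant_spinors_cartan_type:
  assumes "complex_simple_lie_algebra br" "compact_real_form br g" "maximal_torus_algebra br g h"
    "spinor_module br g h c" "has_cartan_type br (vec.span h) X"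
  shows "vec.dim (invariant_spinors br g h c) = card (zero_sum_splittings (positive_roots (cartan_matrix X) (cartan_rank X)))"
    and "admits_invariant_spinors br g h c \<longleftrightarrow> vec.dim (invariant_spinors br g h c) \<noteq> 0"
proof -
  interpret t: compact_torus br g h
    using assms(1) by (intro compact_torus.intro assms(2,3)) (simp add: complex_simple_lie_algebra_def)
  obtain a where a: "root_base br t.H (cartan_rank X) a"
    "\<forall>i\<in>{1..cartan_rank X}. \<forall>j\<in>{1..cartan_rank X}. a i (coroot br t.H (a j)) = of_int (cartan_matrix X i j)"
    using assms(5) unfolding has_cartan_type_def t.H_def by blast
  interpret compact_torus_spin br g h "cartan_rank X" a "cartan_matrix X" c
    by (intro compact_torus_spin.intro compact_torus_base.intro compact_torus_base_axioms.intro
      compact_torus_spin_axioms.intro t.compact_torus_axioms a(1) a(2)[rule_format] assms(4))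
  show "vec.dim (invariant_spinors br g h c) = card (zero_sum_splittings (positive_roots (cartan_matrix X) (cartan_rank X)))"
    by (rule dim_invariant_spinors)
  show "admits_invariant_spinors br g h c \<longleftrightarrow> vec.dim (invariant_spinors br g h c) \<noteq> 0"
    by (rule admits_iff)
qed

section \<open>Zero-sum splittings\<close>

text \<open>Indexing the vectors lets the classical types be handled through pairs of coordinate
  indices instead of sets of functions.\<close>

definition splittings :: "('i \<Rightarrow> nat \<Rightarrow> int) \<Rightarrow> 'i set \<Rightarrow> 'i set set" where
  "splittings w I = {D. D \<subseteq> I \<and> (\<forall>i. (\<Sum>x\<in>D. w x i) = (\<Sum>x\<in>I - D. w x i))}"

lemma finite_splittings: "finite I \<Longrightarrow> finite (splittings w I)"
  unfolding splittings_def by (rule finite_subset[of _ "Pow I"]) auto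

lemma splittings_empty: "splittings w {} = {{}}"
  by (auto simp: splittings_def)

lemma splittings_signing:
  assumes "finite I" "\<And>x. x \<in> I \<Longrightarrow> s x = 1 \<or> s x = (-1::int)"
    and "\<And>i. (\<Sum>x\<in>I. s x * w x i) = 0"
  shows "{x \<in> I. s x = 1} \<in> splittings w I"
proof -
  let ?D = "{x \<in> I. s x = 1}"
  have "(\<Sum>x\<in>?D. w x i) - (\<Sum>x\<in>I - ?D. w x i) = 0" for i
  proof -
    have "(\<Sum>x\<in>I. s x * w x i) = (\<Sum>x\<in>I - ?D. s x * w x i) + (\<Sum>x\<in>?D. s x * w x i)"
      by (rule sum.subset_diff) (use assms in auto)
    moreover have "(\<Sum>x\<in>?D. s x * w x i) = (\<Sum>x\<in>?D. w x i)" by (rule sum.cong) auto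
    moreover have "(\<Sum>x\<in>I - ?D. s x * w x i) = - (\<Sum>x\<in>I - ?D. w x i)"
      unfolding sum_negf[symmetric] by (rule sum.cong) (use assms(2) in force)+
    ultimately show ?thesis using assms(3)[of i] by simp
  qed
  then show ?thesis by (auto simp: splittings_def)
qed

lemma splittings_complement: "D \<in> splittings w I \<Longrightarrow> I - D \<in> splittings w I"
  by (auto simp: splittings_def double_diff)

text \<open>Reversing all signs gives a second splitting.\<close>

lemma card_splittings_ge_2:
  assumes "finite I" "I \<noteq> {}" "splittings w I \<noteq> {}"
  shows "card (splittings w I) \<ge> 2"
proof -
  obtain D where D: "D \<in> splittings w I" using assms(3) by blast
  have "D \<noteq> I - D" using assms(2) D by (auto simp: splittings_def)
  then have "card {D, I - D} = 2" by simp
  moreover have "{D, I - D} \<subseteq> splittings w I" using D splittings_complement by blast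
  ultimately show ?thesis using card_mono[OF finite_splittings[OF assms(1)]] by metis
qed

text \<open>Splittings of disjoint blocks combine freely, so counts are supermultiplicative.\<close>

lemma card_splittings_Un:
  assumes "finite I" "finite I'" "I \<inter> I' = {}"
  shows "card (splittings w I) * card (splittings w I') \<le> card (splittings w (I \<union> I'))"
proof -
  let ?f = "\<lambda>(D, D'). D \<union> D'"
  have "inj_on ?f (splittings w I \<times> splittings w I')"
  proof (rule inj_onI, clarify)
    fix D D' E E'
    assume "D \<in> splittings w I" "D' \<in> splittings w I'" "E \<in> splittings w I" "E' \<in> splittings w I'"
    then have "D \<subseteq> I" "D' \<subseteq> I'" "E \<subseteq> I" "E' \<subseteq> I'" by (auto simp: splittings_def)
    then have "D = (D \<union> D') \<inter> I" "D' = (D \<union> D') \<inter> I'" "E = (E \<union> E') \<inter> I" "E' = (E \<union> E') \<inter> I'"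
      using assms(3) by auto
    moreover assume "D \<union> D' = E \<union> E'"
    ultimately show "D = E \<and> D' = E'" by metis
  qed
  moreover have "?f ` (splittings w I \<times> splittings w I') \<subseteq> splittings w (I \<union> I')"
  proof clarify
    fix D D' assume D: "D \<in> splittings w I" and D': "D' \<in> splittings w I'"
    then have sub: "D \<subseteq> I" "D' \<subseteq> I'" by (auto simp: splittings_def)
    have fin: "finite D" "finite D'" "finite (I - D)" "finite (I' - D')"
      using finite_subset[OF sub(1) assms(1)] finite_subset[OF sub(2) assms(2)] assms(1,2) by simp_all
    have dis: "D \<inter> D' = {}" "(I - D) \<inter> (I' - D') = {}" using sub assms(3) by auto
    have e: "I \<union> I' - (D \<union> D') = (I - D) \<union> (I' - D')" using sub assms(3) by auto
    have "(\<Sum>x\<in>D \<union> D'. w x i) = (\<Sum>x\<in>I \<union> I' - (D \<union> D'). w x i)" for i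
    proof -
      have "(\<Sum>x\<in>D. w x i) = (\<Sum>x\<in>I - D. w x i)" "(\<Sum>x\<in>D'. w x i) = (\<Sum>x\<in>I' - D'. w x i)"
        using D D' unfolding splittings_def by blast+
      then show ?thesis
        unfolding e sum.union_disjoint[OF fin(1,2) dis(1)] sum.union_disjoint[OF fin(3,4) dis(2)] by (simp only:)
    qed
    then show "D \<union> D' \<in> splittings w (I \<union> I')"
      using sub unfolding splittings_def by blast
  qed
  ultimately have "card (splittings w I \<times> splittings w I') \<le> card (splittings w (I \<union> I'))"
    by (rule card_inj_on_le) (intro finite_splittings finite_UnI assms(1,2))
  then show ?thesis by (simp add: card_cartesian_product)
qed

lemma card_splittings_Un_double:
  assumes "finite I" "finite I'" "I \<inter> I' = {}" "I' \<noteq> {}" "splittings w I' \<noteq> {}"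
  shows "2 * card (splittings w I) \<le> card (splittings w (I \<union> I'))"
proof -
  have "card (splittings w I) * 2 \<le> card (splittings w I) * card (splittings w I')"
    using card_splittings_ge_2[OF assms(2,4,5)] by (rule mult_le_mono2)
  then show ?thesis using card_splittings_Un[OF assms(1-3), of w] by linarith
qed

text \<open>A quantity that every splitting balances has an even total. The function f is left
  general so that half of a coordinate sum can be used in types C and D.\<close>

lemma splittings_parity:
  fixes f :: "'i \<Rightarrow> int"
  assumes "finite I" "odd (\<Sum>x\<in>I. f x)"
    and "\<And>D. D \<in> splittings w I \<Longrightarrow> (\<Sum>x\<in>D. f x) = (\<Sum>x\<in>I - D. f x)"
  shows "splittings w I = {}"
proof (rule ccontr)
  assume "splittings w I \<noteq> {}"
  then obtain D where D: "D \<in> splittings w I" by blast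
  then have "D \<subseteq> I" by (simp add: splittings_def)
  then have "(\<Sum>x\<in>I. f x) = (\<Sum>x\<in>I - D. f x) + (\<Sum>x\<in>D. f x)" using sum.subset_diff assms(1) by metis
  then have "(\<Sum>x\<in>I. f x) = 2 * (\<Sum>x\<in>D. f x)" using assms(3)[OF D] by simp
  then show False using assms(2) by simp
qed

lemma zero_sum_splittings_eq: "zero_sum_splittings P = splittings (\<lambda>k. k) P"
  by (simp add: zero_sum_splittings_def splittings_def)

lemma card_splittings_reindex:
  assumes "bij_betw u I P" and "\<And>D E. D \<subseteq> I \<Longrightarrow> E \<subseteq> I \<Longrightarrow>
    (\<forall>i. (\<Sum>x\<in>D. w x i) = (\<Sum>x\<in>E. w x i)) \<longleftrightarrow> (\<forall>i. (\<Sum>x\<in>D. v (u x) i) = (\<Sum>x\<in>E. v (u x) i))"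
  shows "card (splittings w I) = card (splittings v P)"
proof -
  have inj: "inj_on u I" and P: "P = u ` I" using assms(1) by (auto simp: bij_betw_def)
  have "splittings v P = (`) u ` splittings w I"
  proof -
    have *: "u ` D \<in> splittings v P \<longleftrightarrow> D \<in> splittings w I" if D: "D \<subseteq> I" for D
    proof -
      have "P - u ` D = u ` (I - D)" unfolding P using inj D by (simp add: inj_on_image_set_diff)
      moreover have "inj_on u D" "inj_on u (I - D)" using inj D inj_on_subset by blast+
      ultimately have "u ` D \<in> splittings v P \<longleftrightarrow> (\<forall>i. (\<Sum>x\<in>D. v (u x) i) = (\<Sum>x\<in>I - D. v (u x) i))"
        using D unfolding splittings_def by (auto simp: sum.reindex P)
      then show ?thesis using assms(2)[OF D Diff_subset, of D] D by (simp add: splittings_def)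
    qed
    show ?thesis
    proof (intro set_eqI iffI)
      fix X assume X: "X \<in> splittings v P"
      then obtain D where "D \<subseteq> I" "X = u ` D" unfolding splittings_def P by (auto simp: subset_image_iff)
      then show "X \<in> (`) u ` splittings w I" using * X by blast
    next
      fix X assume "X \<in> (`) u ` splittings w I"
      then obtain D where "D \<in> splittings w I" "X = u ` D" by blast
      moreover then have "D \<subseteq> I" by (simp add: splittings_def)
      ultimately show "X \<in> splittings v P" using * by blast
    qed
  qed
  moreover have "inj_on ((`) u) (splittings w I)"
    by (rule inj_on_subset[OF inj_on_image_Pow[OF inj]]) (auto simp: splittings_def)
  ultimately show ?thesis by (simp add: card_image)
qed

definition int_linear :: "((nat \<Rightarrow> int) \<Rightarrow> nat \<Rightarrow> int) \<Rightarrow> bool" where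
  "int_linear \<phi> \<longleftrightarrow> (\<forall>k l c. \<phi> (\<lambda>j. k j + c * l j) = (\<lambda>j. \<phi> k j + c * \<phi> l j))"

lemma int_linearD: "int_linear \<phi> \<Longrightarrow> \<phi> (\<lambda>j. k j + c * l j) = (\<lambda>j. \<phi> k j + c * \<phi> l j)"
  unfolding int_linear_def by (drule spec[of _ k], drule spec[of _ l], drule spec[of _ c])

lemma int_linear_0: "int_linear \<phi> \<Longrightarrow> \<phi> (\<lambda>j. 0) = (\<lambda>j. 0)"
  using int_linearD[of \<phi> "\<lambda>j. 0" 1 "\<lambda>j. 0"] by (simp add: fun_eq_iff)

lemma int_linear_sum:
  assumes "int_linear \<phi>" "finite D"
  shows "\<phi> (\<lambda>i. \<Sum>k\<in>D. k i) = (\<lambda>i. \<Sum>k\<in>D. \<phi> k i)"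
  using assms(2)
proof (induction D rule: finite_induct)
  case (insert k D)
  have "\<phi> (\<lambda>i. k i + 1 * (\<Sum>k\<in>D. k i)) = (\<lambda>i. \<phi> k i + 1 * \<phi> (\<lambda>i. \<Sum>k\<in>D. k i) i)"
    by (rule int_linearD[OF assms(1)])
  then show ?case using insert by simp
qed (simp add: int_linear_0[OF assms(1)])

text \<open>The raising process of \<open>positive_roots\<close> in other coordinates: v i is the
  i-th simple root, and p i u the value of u on its coroot.\<close>

inductive_set generated :: "(nat \<Rightarrow> nat \<Rightarrow> int) \<Rightarrow> (nat \<Rightarrow> (nat \<Rightarrow> int) \<Rightarrow> int) \<Rightarrow> nat \<Rightarrow> (nat \<Rightarrow> int) set"
  for v :: "nat \<Rightarrow> nat \<Rightarrow> int" and p :: "nat \<Rightarrow> (nat \<Rightarrow> int) \<Rightarrow> int" and n :: nat where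
  simple: "i \<in> {1..n} \<Longrightarrow> v i \<in> generated v p n"
| raise: "u \<in> generated v p n \<Longrightarrow> i \<in> {1..n} \<Longrightarrow> p i u < 0 \<Longrightarrow> (\<lambda>j. u j - p i u * v i j) \<in> generated v p n"

lemma generated_raise_eq:
  "u \<in> generated v p n \<Longrightarrow> i \<in> {1..n} \<Longrightarrow> p i u < 0 \<Longrightarrow> (\<And>j. u' j = u j - p i u * v i j) \<Longrightarrow> u' \<in> generated v p n"
proof -
  assume "u \<in> generated v p n" "i \<in> {1..n}" "p i u < 0" and u': "\<And>j. u' j = u j - p i u * v i j"
  then have "(\<lambda>j. u j - p i u * v i j) \<in> generated v p n" by (intro generated.raise)
  moreover have "u' = (\<lambda>j. u j - p i u * v i j)" using u' by blast
  ultimately show ?thesis by simp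
qed

lemma positive_roots_support: "k \<in> positive_roots A n \<Longrightarrow> i \<notin> {1..n} \<Longrightarrow> k i = 0"
  by (induction rule: positive_roots.induct) (auto simp: unit_root_def simple_reflection_def)

text \<open>A change from base coordinates to orthogonal coordinates, injective on vectors supported
  on 1..n and compatible with the coroot pairings.\<close>

locale root_realization =
  fixes A :: "nat \<Rightarrow> nat \<Rightarrow> int" and n :: nat and \<phi> :: "(nat \<Rightarrow> int) \<Rightarrow> nat \<Rightarrow> int"
    and p :: "nat \<Rightarrow> (nat \<Rightarrow> int) \<Rightarrow> int" and v :: "nat \<Rightarrow> nat \<Rightarrow> int"
  assumes lin: "int_linear \<phi>"
    and ker: "(\<And>i. i \<notin> {1..n} \<Longrightarrow> k i = 0) \<Longrightarrow> \<phi> k = (\<lambda>j. 0) \<Longrightarrow> k = (\<lambda>j. 0)"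
    and unit: "i \<in> {1..n} \<Longrightarrow> \<phi> (unit_root i) = v i"
    and pair: "(\<And>i. i \<notin> {1..n} \<Longrightarrow> k i = 0) \<Longrightarrow> i \<in> {1..n} \<Longrightarrow> pairing A n k i = p i (\<phi> k)"
begin

lemma \<phi>_reflection:
  assumes "k \<in> positive_roots A n" "i \<in> {1..n}"
  shows "\<phi> (simple_reflection A n i k) = (\<lambda>j. \<phi> k j - p i (\<phi> k) * v i j)"
proof -
  have "simple_reflection A n i k = (\<lambda>j. k j + (- pairing A n k i) * unit_root i j)"
    by (auto simp: simple_reflection_def unit_root_def)
  then have "\<phi> (simple_reflection A n i k) = (\<lambda>j. \<phi> k j + (- pairing A n k i) * \<phi> (unit_root i) j)"
    using int_linearD[OF lin, of k "- pairing A n k i" "unit_root i"] by simp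
  then show ?thesis using pair[OF positive_roots_support[OF assms(1)] assms(2)] unit[OF assms(2)] by simp
qed

lemma image_positive_roots: "\<phi> ` positive_roots A n = generated v p n"
proof
  show "\<phi> ` positive_roots A n \<subseteq> generated v p n"
  proof clarify
    fix k assume "k \<in> positive_roots A n"
    then show "\<phi> k \<in> generated v p n"
    proof induction
      case (unit i)
      then show ?case using generated.simple root_realization.unit[OF root_realization_axioms] by metis
    next
      case (raise k i)
      then show ?case
        unfolding \<phi>_reflection[OF raise.hyps(1,2)]
        using pair[OF positive_roots_support[OF raise.hyps(1)] raise.hyps(2)]
        by (intro generated.raise) auto
    qed
  qed
  show "generated v p n \<subseteq> \<phi> ` positive_roots A n"
  proof
    fix u assume "u \<in> generated v p n"
    then show "u \<in> \<phi> ` positive_roots A n"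
    proof induction
      case (simple i)
      then show ?case using positive_roots.unit unit by (metis image_eqI)
    next
      case (raise u i)
      then obtain k where k: "k \<in> positive_roots A n" "u = \<phi> k" by blast
      have "pairing A n k i < 0"
        using pair[OF positive_roots_support[OF k(1)] raise.hyps(2)] raise.hyps(3) k by simp
      then have "simple_reflection A n i k \<in> positive_roots A n"
        using positive_roots.raise k(1) raise.hyps(2) by blast
      then show ?case using \<phi>_reflection[OF k(1) raise.hyps(2)] k(2) by (metis image_eqI)
    qed
  qed
qed

lemma \<phi>_inj:
  assumes "\<And>i. i \<notin> {1..n} \<Longrightarrow> k i = 0" "\<And>i. i \<notin> {1..n} \<Longrightarrow> l i = 0" "\<phi> k = \<phi> l"
  shows "k = l"
proof -
  have "\<phi> (\<lambda>j. k j + (- 1) * l j) = (\<lambda>j. \<phi> k j + (- 1) * \<phi> l j)"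
    by (rule int_linearD[OF lin])
  then have "\<phi> (\<lambda>j. k j + (- 1) * l j) = (\<lambda>j. 0)" using assms(3) by simp
  then have "(\<lambda>j. k j + (- 1) * l j) = (\<lambda>j. 0)" using assms(1,2) by (intro ker[of "\<lambda>j. k j + (- 1) * l j"]) simp_all
  then show ?thesis by (simp add: fun_eq_iff)
qed

lemma card_zero_sum_splittings:
  assumes w: "inj_on w I" "finite I" "w ` I = generated v p n"
  shows "card (zero_sum_splittings (positive_roots A n)) = card (splittings w I)"
proof -
  let ?P = "positive_roots A n"
  have inj: "inj_on \<phi> ?P"
    using \<phi>_inj positive_roots_support by (intro inj_onI) blast
  have "finite (\<phi> ` ?P)" using w image_positive_roots by (metis finite_imageI)
  then have finP: "finite ?P" using inj finite_imageD by blast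
  \<comment> \<open>Each positive root is matched with the index of its realization.\<close>
  have b: "bij_betw (inv_into I w \<circ> \<phi>) ?P I"
  proof (rule bij_betw_trans)
    show "bij_betw \<phi> ?P (w ` I)" using inj image_positive_roots w(3) by (simp add: bij_betw_def)
    show "bij_betw (inv_into I w) (w ` I) I" using w(1) by (intro bij_betw_inv_into) (simp add: bij_betw_def)
  qed
  have wu: "w ((inv_into I w \<circ> \<phi>) k) = \<phi> k" if "k \<in> ?P" for k
    using that image_positive_roots w(3) f_inv_into_f[of "\<phi> k" w I] by auto
  have "card (splittings (\<lambda>k. k) ?P) = card (splittings w I)"
  proof (rule card_splittings_reindex[OF b])
    fix D E assume D: "D \<subseteq> ?P" and E: "E \<subseteq> ?P"
    have s: "\<phi> (\<lambda>i. \<Sum>k\<in>X. k i) = (\<lambda>i. \<Sum>k\<in>X. w ((inv_into I w \<circ> \<phi>) k) i)" if "X \<subseteq> ?P" for X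
    proof -
      have "\<phi> (\<lambda>i. \<Sum>k\<in>X. k i) = (\<lambda>i. \<Sum>k\<in>X. \<phi> k i)"
        by (rule int_linear_sum[OF lin finite_subset[OF that finP]])
      also have "\<dots> = (\<lambda>i. \<Sum>k\<in>X. w ((inv_into I w \<circ> \<phi>) k) i)"
        using that by (intro ext sum.cong refl) (simp only: wu subsetD)
      finally show ?thesis .
    qed
    have z: "(\<Sum>k\<in>X. k i) = 0" if "X \<subseteq> ?P" "i \<notin> {1..n}" for X i
      using that positive_roots_support by (intro sum.neutral) blast
    have "(\<forall>i. (\<Sum>k\<in>D. k i) = (\<Sum>k\<in>E. k i)) \<longleftrightarrow> \<phi> (\<lambda>i. \<Sum>k\<in>D. k i) = \<phi> (\<lambda>i. \<Sum>k\<in>E. k i)"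
    proof
      assume "\<phi> (\<lambda>i. \<Sum>k\<in>D. k i) = \<phi> (\<lambda>i. \<Sum>k\<in>E. k i)"
      from \<phi>_inj[OF z[OF D] z[OF E] this] show "\<forall>i. (\<Sum>k\<in>D. k i) = (\<Sum>k\<in>E. k i)" by (simp add: fun_eq_iff)
    qed simp
    then show "(\<forall>i. (\<Sum>k\<in>D. k i) = (\<Sum>k\<in>E. k i)) \<longleftrightarrow>
        (\<forall>i. (\<Sum>k\<in>D. w ((inv_into I w \<circ> \<phi>) k) i) = (\<Sum>k\<in>E. w ((inv_into I w \<circ> \<phi>) k) i))"
      unfolding s[OF D] s[OF E] fun_eq_iff .
  qed
  then show ?thesis by (simp only: zero_sum_splittings_eq)
qed

end

section \<open>Classical types\<close>

definition pairs_below :: "nat \<Rightarrow> (nat \<times> nat) set" where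
  "pairs_below n = (SIGMA b:{1..n}. {1..<b})"

lemma mem_pairs_below [simp]: "(b, a) \<in> pairs_below n \<longleftrightarrow> 1 \<le> a \<and> a < b \<and> b \<le> n"
  by (auto simp: pairs_below_def)

lemma finite_pairs_below [simp]: "finite (pairs_below n)"
  by (simp add: pairs_below_def)

lemma card_pairs_below: "2 * card (pairs_below n) = n * (n - 1)"
proof -
  have "(\<Sum>b=1..n. 2 * (b - 1)) = n * (n - 1)"
  proof (induction n)
    case (Suc n)
    then show ?case by (cases n) auto
  qed simp
  then show ?thesis by (simp add: pairs_below_def sum_distrib_left)
qed

lemma sum_Sigma: "finite A \<Longrightarrow> (\<And>x. finite (B x)) \<Longrightarrow> (\<Sum>z\<in>Sigma A B. f z) = (\<Sum>x\<in>A. \<Sum>y\<in>B x. f (x, y))"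
  by (simp add: sum.Sigma)

text \<open>The formula has no exceptions at the ends of the chain because k vanishes at 0 and n +
  1.\<close>

lemma sum_chain_matrix:
  assumes "\<And>j. j \<notin> {1..n} \<Longrightarrow> k j = 0" "i \<in> {1..n}"
  shows "(\<Sum>j=1..n. k j * chain_matrix j i) = 2 * k i - k (i - 1) - k (Suc i)"
proof -
  have "(\<Sum>j=1..n. k j * chain_matrix j i) = (\<Sum>j=1..n. (if j = i then 2 * k i else 0) -
      (if j = i - 1 then k (i - 1) else 0) - (if j = Suc i then k (Suc i) else 0))"
    by (rule sum.cong) (auto simp: chain_matrix_def)
  also have "\<dots> = 2 * k i - (if i - 1 \<in> {1..n} then k (i - 1) else 0) - (if Suc i \<in> {1..n} then k (Suc i) else 0)"
    using assms(2) by (simp add: sum_subtractf)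
  finally show ?thesis using assms(1)[of "i - 1"] assms(1)[of "Suc i"] by auto
qed

definition diff_root :: "nat \<times> nat \<Rightarrow> nat \<Rightarrow> int" where
  "diff_root = (\<lambda>(b, a) j. unit_root a j - unit_root b j)"

text \<open>Raising \<open>e\<^sub>a - e\<^sub>b\<close> by the simple root
  \<open>e\<^sub>b - e\<^sub>b\<^sub>+\<^sub>1\<close> moves b up by one. The bound m is n + 1 in
  type A and n in types B, C and D.\<close>

lemma diff_root_generated:
  assumes v: "\<And>i. 1 \<le> i \<Longrightarrow> i < m \<Longrightarrow> v i = diff_root (Suc i, i)"
    and p: "\<And>i u. 1 \<le> i \<Longrightarrow> i < m \<Longrightarrow> p i u = u i - u (Suc i)" and m: "m \<le> Suc n"
    and ab: "1 \<le> a" "a < b" "b \<le> m"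
  shows "diff_root (b, a) \<in> generated v p n"
proof -
  have "Suc a \<le> b" using ab by simp
  then show ?thesis using ab(3)
  proof (induction b rule: dec_induct)
    case base
    then have "v a = diff_root (Suc a, a)" using ab(1) v by simp
    moreover have "v a \<in> generated v p n" using base ab(1) m by (intro generated.simple) simp
    ultimately show ?case by simp
  next
    case (step b)
    then have "diff_root (b, a) \<in> generated v p n" by simp
    then show ?case
    proof (rule generated_raise_eq[where i = b])
      show "b \<in> {1..n}" using step ab m by simp
      have pb: "p b (diff_root (b, a)) = - 1" using step ab by (simp add: p diff_root_def unit_root_def)
      then show "p b (diff_root (b, a)) < 0" by simp
      fix j show "diff_root (Suc b, a) j = diff_root (b, a) j - p b (diff_root (b, a)) * v b j"
        unfolding pb using step ab by (simp add: v diff_root_def)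
    qed
  qed
qed

lemma diff_root_inj: "inj_on diff_root (pairs_below n)"
proof (rule inj_onI, clarify)
  fix b a b' a' assume ab: "(b, a) \<in> pairs_below n" "(b', a') \<in> pairs_below n" and e: "diff_root (b, a) = diff_root (b', a')"
  from fun_cong[OF e, of a] fun_cong[OF e, of b] show "b = b' \<and> a = a'"
    using ab by (auto simp: diff_root_def unit_root_def split: if_splits)
qed

subsection \<open>Type A\<close>

lemma type_A_splittings:
  "card (zero_sum_splittings (positive_roots (cartan_matrix (Type_A n)) n)) = card (splittings diff_root (pairs_below (Suc n)))"
proof -
  \<comment> \<open>With simple roots \<open>e\<^sub>i - e\<^sub>i\<^sub>+\<^sub>1\<close> the
    coefficient of \<open>e\<^sub>j\<close> telescopes to this difference. At j = 0 truncated
    subtraction makes it zero.\<close>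
  define \<phi> :: "(nat \<Rightarrow> int) \<Rightarrow> nat \<Rightarrow> int" where "\<phi> k = (\<lambda>j. k j - k (j - 1))" for k
  define p :: "nat \<Rightarrow> (nat \<Rightarrow> int) \<Rightarrow> int" where "p i u = u i - u (Suc i)" for i u
  define v where "v i = diff_root (Suc i, i)" for i
  interpret root_realization "cartan_matrix (Type_A n)" n \<phi> p v
  proof
    show "int_linear \<phi>" by (auto simp: int_linear_def \<phi>_def algebra_simps)
    fix k :: "nat \<Rightarrow> int" assume k: "\<And>i. i \<notin> {1..n} \<Longrightarrow> k i = 0"
    show "k = (\<lambda>j. 0)" if "\<phi> k = (\<lambda>j. 0)"
    proof
      fix j show "k j = 0"
      proof (induction j)
        case 0 then show ?case using k[of 0] by simp
      next
        case (Suc j) then show ?case using fun_cong[OF that, of "Suc j"] by (simp add: \<phi>_def)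
      qed
    qed
    show "pairing (cartan_matrix (Type_A n)) n k i = p i (\<phi> k)" if "i \<in> {1..n}" for i
      using sum_chain_matrix[OF k that] by (simp add: pairing_def p_def \<phi>_def)
  next
    fix i assume "i \<in> {1..n}"
    then show "\<phi> (unit_root i) = v i"
      by (auto simp: \<phi>_def v_def diff_root_def unit_root_def fun_eq_iff)
  qed
  have "diff_root ` pairs_below (Suc n) = generated v p n"
  proof
    show "diff_root ` pairs_below (Suc n) \<subseteq> generated v p n"
      using diff_root_generated[of "Suc n" v p n] by (auto simp: v_def p_def)
    show "generated v p n \<subseteq> diff_root ` pairs_below (Suc n)"
    proof
      fix u assume "u \<in> generated v p n"
      then show "u \<in> diff_root ` pairs_below (Suc n)"
      proof induction
        case (simple i)
        then show ?case by (auto simp: v_def intro!: imageI)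
      next
        case (raise u i)
        then obtain a b where u: "u = diff_root (b, a)" and ab: "1 \<le> a" "a < b" "b \<le> Suc n" by auto
        have i: "1 \<le> i" "i \<le> n" using raise by auto
        have "p i u < 0" by fact
        \<comment> \<open>A negative pairing needs the entry -1 at i or the entry 1 at i +
          1.\<close>
        then have "b = i \<or> a = Suc i"
          using ab by (auto simp: u p_def diff_root_def unit_root_def split: if_splits)
        then have "(\<lambda>j. u j - p i u * v i j) = diff_root (Suc i, a) \<and> b = i \<or>
            (\<lambda>j. u j - p i u * v i j) = diff_root (b, i) \<and> a = Suc i"
          using ab by (auto simp: u p_def v_def diff_root_def unit_root_def fun_eq_iff)
        moreover have "diff_root (Suc i, a) \<in> diff_root ` pairs_below (Suc n)" if "b = i"
          using that ab i by (intro imageI) simp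
        moreover have "diff_root (b, i) \<in> diff_root ` pairs_below (Suc n)" if "a = Suc i"
          using that ab i by (intro imageI) simp
        ultimately show ?case by auto
      qed
    qed
  qed
  then show ?thesis by (intro card_zero_sum_splittings diff_root_inj) simp_all
qed

lemma alternating_sum: "(\<Sum>a=1..<2 * m + 2 :: nat. if odd a then 1 else - 1 :: int) = 1"
proof (induction m)
  case (Suc m)
  have e: "2 * Suc m + 2 = Suc (Suc (2 * m + 2))" by simp
  have "odd (Suc (2 * m + 2))" "even (2 * m + 2)" by simp_all
  then show ?case
    using Suc unfolding e by (simp only: sum.atLeastLessThan_Suc le_SucI le_add2 one_le_numeral trans_le_add2) simp
qed simp

text \<open>Let x, y be the two new coordinates. The roots from an old a to x and to y get opposite
  signs, alternating with a, so the old coordinates cancel. The alternating sum over 1..2m+1 is 1,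
  which leaves \<open>- e\<^sub>x + e\<^sub>y\<close>; the root \<open>e\<^sub>x - e\<^sub>y\<close>
  cancels it.\<close>

lemma type_A_lower_bound: "card (splittings diff_root (pairs_below (2 * m + 1))) \<ge> 2 ^ m"
proof (induction m)
  case 0
  have "pairs_below 1 = {}" by (auto simp: pairs_below_def)
  then show ?case by (simp add: splittings_empty)
next
  case (Suc m)
  let ?N = "2 * m + 1"
  let ?L = "SIGMA b:{Suc ?N, Suc (Suc ?N)}. {1..<b}"
  let ?t = "\<lambda>a::nat. if odd a then 1 else - 1 :: int"
  let ?s = "\<lambda>(b, a). if b = Suc ?N then ?t a else if a = Suc ?N then 1 else - ?t a"
  have e: "pairs_below (2 * Suc m + 1) = pairs_below ?N \<union> ?L"
    by (auto simp: pairs_below_def)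
  have "{x \<in> ?L. ?s x = 1} \<in> splittings diff_root ?L"
  proof (rule splittings_signing)
    show "finite ?L" by simp
    show "?s x = 1 \<or> ?s x = - 1" for x by (cases x) auto
    fix i
    let ?e = "\<lambda>a. unit_root a i" and ?x = "Suc ?N" and ?y = "Suc (Suc ?N)"
    have "(\<Sum>z\<in>?L. ?s z * diff_root z i) =
        (\<Sum>a=1..<?x. ?t a * (?e a - ?e ?x)) + ((\<Sum>a=1..<?x. - ?t a * (?e a - ?e ?y)) + (?e ?x - ?e ?y))"
      by (subst sum_Sigma) (simp_all add: diff_root_def)
    also have "\<dots> = (\<Sum>a=1..<?x. ?t a * ?e a) - (\<Sum>a=1..<?x. ?t a) * ?e ?x
        - (\<Sum>a=1..<?x. ?t a * ?e a) + (\<Sum>a=1..<?x. ?t a) * ?e ?y + (?e ?x - ?e ?y)"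
      by (simp only: sum_distrib_right right_diff_distrib sum_subtractf mult_minus_left sum_negf)
    also have "(\<Sum>a=1..<?x. ?t a) = 1" using alternating_sum[of m] by simp
    finally show "(\<Sum>z\<in>?L. ?s z * diff_root z i) = 0" by simp
  qed
  then have ne: "splittings diff_root ?L \<noteq> {}" by blast
  have "(Suc ?N, 1) \<in> ?L" by simp
  then have ne': "?L \<noteq> {}" by blast
  have "pairs_below ?N \<inter> ?L = {}" by (auto simp: pairs_below_def)
  from card_splittings_Un_double[OF _ _ this ne' ne]
  have "2 * card (splittings diff_root (pairs_below ?N)) \<le> card (splittings diff_root (pairs_below ?N \<union> ?L))"
    by simp
  then show ?case unfolding e using Suc by simp
qed

text \<open>The coordinate at 1 of the sum of all positive roots is n: only the n pairs (b, 1)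
  contribute, each with 1.\<close>

lemma type_A_parity:
  assumes "odd n" shows "splittings diff_root (pairs_below (Suc n)) = {}"
proof (rule splittings_parity[where f = "\<lambda>x. diff_root x 1"])
  have "(\<Sum>x\<in>pairs_below (Suc n). diff_root x 1) = (\<Sum>b=1..Suc n. \<Sum>a=1..<b. diff_root (b, a) 1)"
    unfolding pairs_below_def by (rule sum_Sigma) simp_all
  also have "\<dots> = (\<Sum>b=1..Suc n. if b = 1 then 0 else 1)"
  proof (rule sum.cong[OF refl])
    fix b assume "b \<in> {1..Suc n}"
    have "(\<Sum>a=1..<b. diff_root (b, a) 1) = (\<Sum>a=1..<b. if a = 1 then 1 else 0)"
      by (rule sum.cong) (auto simp: diff_root_def unit_root_def)
    then show "(\<Sum>a=1..<b. diff_root (b, a) 1) = (if b = 1 then 0 else 1)"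
      using \<open>b \<in> {1..Suc n}\<close> by auto
  qed
  also have "\<dots> = int n" by (induction n) auto
  finally show "odd (\<Sum>x\<in>pairs_below (Suc n). diff_root x 1)" using assms by simp
qed (auto simp: splittings_def)

subsection \<open>Types B, C and D\<close>

text \<open>The index \<open>(s, b, a)\<close> with \<open>a < b\<close> stands for \<open>e\<^sub>a + e\<^sub>b\<close> or \<open>e\<^sub>a - e\<^sub>b\<close>, and \<open>(True, b, b)\<close> stands for \<open>c e\<^sub>b\<close>;
  type B has \<open>c = 1\<close>, type C has \<open>c = 2\<close>, and type D has no diagonal indices.\<close>

definition signed_root :: "int \<Rightarrow> bool \<times> nat \<times> nat \<Rightarrow> nat \<Rightarrow> int" where
  "signed_root c = (\<lambda>(s, b, a) j. if a = b then c * unit_root b j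
     else unit_root a j + (if s then unit_root b j else - unit_root b j))"

definition diagonal_indices :: "nat \<Rightarrow> (bool \<times> nat \<times> nat) set" where
  "diagonal_indices n = (\<lambda>b. (True, b, b)) ` {1..n}"

abbreviation signed_pairs :: "nat \<Rightarrow> (bool \<times> nat \<times> nat) set" where
  "signed_pairs n \<equiv> UNIV \<times> pairs_below n"

lemma signed_root_simps:
  "a < b \<Longrightarrow> signed_root c (True, b, a) j = unit_root a j + unit_root b j"
  "a < b \<Longrightarrow> signed_root c (False, b, a) j = unit_root a j - unit_root b j"
  "signed_root c (s, b, b) j = c * unit_root b j"
  by (simp_all add: signed_root_def)

lemma signed_root_False: "a < b \<Longrightarrow> signed_root c (False, b, a) = diff_root (b, a)"
  by (auto simp: signed_root_def diff_root_def)

lemma mem_diagonal_indices [simp]: "(s, b, a) \<in> diagonal_indices n \<longleftrightarrow> s \<and> a = b \<and> 1 \<le> b \<and> b \<le> n"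
  by (auto simp: diagonal_indices_def)

lemma finite_diagonal_indices [simp]: "finite (diagonal_indices n)"
  by (simp add: diagonal_indices_def)

lemma signed_root_inj:
  assumes "c = 1 \<or> c = 2"
  shows "inj_on (signed_root c) (signed_pairs n \<union> diagonal_indices n)"
proof (rule inj_onI)
  fix x y assume x: "x \<in> signed_pairs n \<union> diagonal_indices n" and y: "y \<in> signed_pairs n \<union> diagonal_indices n"
    and e: "signed_root c x = signed_root c y"
  obtain s b a s' b' a' where xy: "x = (s, b, a)" "y = (s', b', a')" by (cases x, cases y) auto
  have le: "a \<le> b" "a' \<le> b'" and ss: "a = b \<Longrightarrow> s" "a' = b' \<Longrightarrow> s'" using x y xy by auto
  \<comment> \<open>The support recovers the two indices, and the sign of the entry at b recovers
    s.\<close>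
  have supp: "signed_root c (s, b, a) j \<noteq> 0 \<longleftrightarrow> j = a \<or> j = b" for s b a j
    using assms by (auto simp: signed_root_def unit_root_def)
  have "j = a \<or> j = b \<longleftrightarrow> j = a' \<or> j = b'" for j
    using supp[of s b a j] supp[of s' b' a' j] e xy by simp
  then have "{a, b} = {a', b'}" by blast
  then have ab: "a = a'" "b = b'" using le by (auto simp: doubleton_eq_iff)
  have "s = s'"
  proof (cases "a = b")
    case False
    then show ?thesis
      using fun_cong[OF e, of b] unfolding xy ab[symmetric]
      by (simp add: signed_root_def unit_root_def split: if_splits)
  qed (use ss ab in simp)
  then show "x = y" using xy ab by simp
qed

text \<open>Descending induction on b: \<open>e\<^sub>a + e\<^sub>b\<^sub>+\<^sub>1\<close> is
  raised by \<open>e\<^sub>b - e\<^sub>b\<^sub>+\<^sub>1\<close>. How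
  \<open>e\<^sub>a + e\<^sub>n\<close> arises depends on the last simple root and is left as a
  hypothesis.\<close>

lemma sum_root_generated:
  assumes v: "\<And>i. 1 \<le> i \<Longrightarrow> i < n \<Longrightarrow> v i = diff_root (Suc i, i)"
    and p: "\<And>i u. 1 \<le> i \<Longrightarrow> i < n \<Longrightarrow> p i u = u i - u (Suc i)"
    and last: "\<And>a. 1 \<le> a \<Longrightarrow> a < n \<Longrightarrow> signed_root c (True, n, a) \<in> generated v p n"
    and ab: "1 \<le> a" "a < b" "b \<le> n"
  shows "signed_root c (True, b, a) \<in> generated v p n"
  using ab(3,2)
proof (induction b rule: inc_induct)
  case base
  then show ?case using last ab(1) by simp
next
  case (step b)
  then have "signed_root c (True, Suc b, a) \<in> generated v p n" by simp
  then show ?case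
  proof (rule generated_raise_eq[where i = b])
    show "b \<in> {1..n}" using step ab by simp
    have pb: "p b (signed_root c (True, Suc b, a)) = - 1"
      using step ab by (simp add: p signed_root_simps unit_root_def)
    then show "p b (signed_root c (True, Suc b, a)) < 0" by simp
    fix j show "signed_root c (True, b, a) j = signed_root c (True, Suc b, a) j - p b (signed_root c (True, Suc b, a)) * v b j"
      unfolding pb using step ab by (simp add: v signed_root_simps diff_root_def)
  qed
qed

lemma signed_root_reflection:
  assumes u: "u = signed_root c (s, b, a)" "1 \<le> a" "a < b" "b \<le> n" and i: "1 \<le> i" "i < n"
    and neg: "u i - u (Suc i) < 0"
  shows "(\<lambda>j. u j - (u i - u (Suc i)) * diff_root (Suc i, i) j) \<in> signed_root c ` signed_pairs n"
proof -
  let ?u = "\<lambda>j. u j - (u i - u (Suc i)) * diff_root (Suc i, i) j"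
  \<comment> \<open>A negative pairing means that i + 1 carries a +1 not matched at i, or i carries
    a -1; the reflection swaps the two coordinates.\<close>
  have "a = Suc i \<and> b \<noteq> i \<or> (\<not> s \<and> b = i \<and> a < i) \<or> (s \<and> b = Suc i \<and> a < i)"
    using neg u by (cases s) (auto simp: signed_root_def unit_root_def split: if_splits)
  then have "?u = signed_root c (s, b, i) \<and> (s, b, i) \<in> signed_pairs n \<or>
      ?u = signed_root c (False, Suc i, a) \<and> (False, Suc i, a) \<in> signed_pairs n \<or>
      ?u = signed_root c (True, i, a) \<and> (True, i, a) \<in> signed_pairs n"
    using u(2-4) i unfolding u(1)
    by (cases s) (auto simp: signed_root_def diff_root_def unit_root_def fun_eq_iff)
  then show ?thesis by (elim disjE conjE) (simp_all only: imageI)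
qed

lemma pred_eq_iff: "1 \<le> (i::nat) \<Longrightarrow> j - 1 = i \<longleftrightarrow> j = Suc i"
  by auto

text \<open>Types B and C differ only in the last simple root, c times \<open>e\<^sub>n\<close> with
  c = 1 or 2. Its coroot evaluates the last coordinate times 2 / c.\<close>

lemma type_BC_splittings:
  assumes c: "c = 1 \<or> c = 2" and m: "n = Suc m" "1 \<le> m"
    and A: "\<And>k i. (\<And>j. j \<notin> {1..n} \<Longrightarrow> k j = 0) \<Longrightarrow> i \<in> {1..n} \<Longrightarrow> pairing A n k i =
      (if i = n then (2 div c) * (c * k n - k m) else
       if i = m then 2 * k i - k (i - 1) - c * k n else 2 * k i - k (i - 1) - k (Suc i))"
  shows "card (zero_sum_splittings (positive_roots A n)) = card (splittings (signed_root c) (signed_pairs n \<union> diagonal_indices n))"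
proof -
  define \<phi> :: "(nat \<Rightarrow> int) \<Rightarrow> nat \<Rightarrow> int" where
    "\<phi> k = (\<lambda>j. if j < n then k j - k (j - 1) else if j = n then c * k n - k m else 0)" for k
  define p :: "nat \<Rightarrow> (nat \<Rightarrow> int) \<Rightarrow> int" where
    "p i u = (if i < n then u i - u (Suc i) else (2 div c) * u n)" for i u
  define v where "v i = (if i < n then diff_root (Suc i, i) else signed_root c (True, n, n))" for i
  have n: "n \<ge> 1" using m by simp
  have c2: "(2 div c) * c = 2" "c > 0" "2 div c > 0" using c by auto
  interpret root_realization A n \<phi> p v
  proof
    show "int_linear \<phi>" by (auto simp: int_linear_def \<phi>_def algebra_simps)
    fix k :: "nat \<Rightarrow> int" assume k: "\<And>i. i \<notin> {1..n} \<Longrightarrow> k i = 0"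
    show "k = (\<lambda>j. 0)" if z: "\<phi> k = (\<lambda>j. 0)"
    proof
      have 1: "k j = 0" if "j < n" for j
        using that
      proof (induction j)
        case 0 then show ?case using k[of 0] by simp
      next
        case (Suc j) then show ?case using fun_cong[OF z, of "Suc j"] by (simp add: \<phi>_def)
      qed
      have "c * k n - k m = 0" using fun_cong[OF z, of n] by (simp add: \<phi>_def)
      then have "k n = 0" using 1[of m] m c2 by simp
      then show "k j = 0" for j using 1[of j] k[of j] by (cases "j < n"; cases "j = n") auto
    qed
    fix i assume i: "i \<in> {1..n}"
    show "pairing A n k i = p i (\<phi> k)"
    proof -
      have "pairing A n k i = (if i = n then (2 div c) * (c * k n - k m) else
        if i = m then 2 * k i - k (i - 1) - c * k n else 2 * k i - k (i - 1) - k (Suc i))"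
        by (rule A) (use k i in auto)
      then show ?thesis using i m by (auto simp: p_def \<phi>_def)
    qed
  next
    fix i assume i: "i \<in> {1..n}"
    show "\<phi> (unit_root i) = v i"
    proof
      fix j
      have i1: "1 \<le> i" and e: "m = i \<longleftrightarrow> n = Suc i" using i m by auto
      show "\<phi> (unit_root i) j = v i j"
      proof (cases "i < n")
        case True
        have "j - 1 = i \<longleftrightarrow> j = Suc i" using i1 by (rule pred_eq_iff)
        then show ?thesis
          using e True i1 unfolding \<phi>_def v_def diff_root_def unit_root_def case_prod_conv
          by (cases "j < n"; cases "j = n") auto
      next
        case False
        then have "i = n" using i by simp
        then show ?thesis using m
          by (auto simp: \<phi>_def v_def signed_root_def unit_root_def)
      qed
    qed
  qed
  let ?I = "signed_pairs n \<union> diagonal_indices n"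
  have neg: "diff_root (b, a) \<in> generated v p n" if "1 \<le> a" "a < b" "b \<le> n" for a b
    using that by (intro diff_root_generated[of n]) (auto simp: v_def p_def)
  have pos: "signed_root c (True, b, a) \<in> generated v p n" if ab: "1 \<le> a" "a < b" "b \<le> n" for a b
  proof (rule sum_root_generated[OF _ _ _ ab])
    fix a assume a: "1 \<le> a" "a < n"
    from neg[OF a order.refl] show "signed_root c (True, n, a) \<in> generated v p n"
    proof (rule generated_raise_eq[where i = n])
      show "n \<in> {1..n}" using n by simp
      have pn: "p n (diff_root (n, a)) = - (2 div c)" using a by (simp add: p_def diff_root_def unit_root_def)
      then show "p n (diff_root (n, a)) < 0" using c2 by simp
      fix j show "signed_root c (True, n, a) j = diff_root (n, a) j - p n (diff_root (n, a)) * v n j"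
        unfolding pn using a c2(1) by (auto simp: v_def signed_root_simps diff_root_def algebra_simps)
    qed
  qed (auto simp: v_def p_def)
  have diag: "signed_root c (True, b, b) \<in> generated v p n" if "1 \<le> b" "b \<le> n" for b
    using that(2,1)
  proof (induction b rule: inc_induct)
    case base
    have "v n = signed_root c (True, n, n)" by (simp add: v_def)
    moreover have "v n \<in> generated v p n" using n by (intro generated.simple) simp
    ultimately show ?case by (simp only:)
  next
    case (step b)
    then have "signed_root c (True, Suc b, Suc b) \<in> generated v p n" by simp
    then show ?case
    proof (rule generated_raise_eq[where i = b])
      show "b \<in> {1..n}" using step by simp
      have pb: "p b (signed_root c (True, Suc b, Suc b)) = - c"
        using step by (simp add: p_def signed_root_simps unit_root_def)
      then show "p b (signed_root c (True, Suc b, Suc b)) < 0" using c2 by simp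
      fix j show "signed_root c (True, b, b) j =
          signed_root c (True, Suc b, Suc b) j - p b (signed_root c (True, Suc b, Suc b)) * v b j"
        unfolding pb using step by (simp add: v_def signed_root_simps diff_root_def algebra_simps)
    qed
  qed
  have "signed_root c ` ?I = generated v p n"
  proof
    have "signed_root c (s, b, a) \<in> generated v p n" if "(s, b, a) \<in> ?I" for s b a
      using that neg pos diag by (cases s) (auto simp: signed_root_False)
    then show "signed_root c ` ?I \<subseteq> generated v p n" by (intro image_subsetI) (metis prod_cases3)
    show "generated v p n \<subseteq> signed_root c ` ?I"
    proof
      fix u assume "u \<in> generated v p n"
      then show "u \<in> signed_root c ` ?I"
      proof induction
        case (simple i)
        show ?case
        proof (cases "i < n")
          case True
          then have "v i = signed_root c (False, Suc i, i)" by (simp add: v_def signed_root_False)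
          then show ?thesis using True simple by auto
        next
          case False
          then have "v i = signed_root c (True, n, n)" by (simp add: v_def)
          then show ?thesis using n by auto
        qed
      next
        case (raise u i)
        then obtain s b a where u: "u = signed_root c (s, b, a)" and m: "(s, b, a) \<in> ?I" by auto
        have i: "1 \<le> i" "i \<le> n" using raise by auto
        show ?case
        proof (cases "i < n")
          case True
          then have p: "p i u = u i - u (Suc i)" and v: "v i = diff_root (Suc i, i)" by (simp_all add: p_def v_def)
          show ?thesis
          proof (cases "a = b")
            case False
            then show ?thesis
              using signed_root_reflection[OF u, of n i] m i True raise.hyps(3) unfolding p v by auto
          next
            case diag: True
            have "u i - u (Suc i) < 0" using raise.hyps(3) by (simp only: p)
            then have bi: "b = Suc i" using c2 diag
              unfolding u by (auto simp: signed_root_def unit_root_def split: if_splits)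
            have "(\<lambda>j. u j - p i u * v i j) = signed_root c (True, i, i)"
              unfolding p v unfolding u diag bi by (auto simp: signed_root_def diff_root_def unit_root_def fun_eq_iff)
            moreover have "(True, i, i) \<in> ?I" using i by simp
            ultimately show ?thesis by (metis imageI)
          qed
        next
          case False
          then have n: "i = n" using i by simp
          then have p: "p i u = (2 div c) * u n" and v: "v i = signed_root c (True, n, n)" by (simp_all add: p_def v_def)
          have "(2 div c) * u n < 0" using raise.hyps(3) by (simp only: p)
          then have "u n < 0" using c2 by (simp add: mult_less_0_iff)
          \<comment> \<open>Only a difference with second index n has a negative last
            coordinate.\<close>
          then have sb: "\<not> s" "b = n" "a < n"
            using m c2 unfolding u by (auto simp: signed_root_def unit_root_def split: if_splits)
          have "u n = - 1" using sb by (simp add: u signed_root_def unit_root_def)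
          then have pi: "p i u = - (2 div c)" by (simp add: p)
          have c2': "(2 div c) * (c * x) = 2 * x" for x using c2(1) by (metis mult.assoc)
          have "(\<lambda>j. u j - p i u * v i j) = signed_root c (True, n, a)"
            unfolding pi v unfolding u using sb c2' by (auto simp: signed_root_simps fun_eq_iff)
          moreover have "(True, n, a) \<in> ?I" using m sb by auto
          ultimately show ?thesis by (metis imageI)
        qed
      qed
    qed
  qed
  then show ?thesis by (intro card_zero_sum_splittings signed_root_inj c) simp_all
qed

lemma type_B_splittings:
  assumes n: "n \<ge> 2"
  shows "card (zero_sum_splittings (positive_roots (cartan_matrix (Type_B n)) n)) =
    card (splittings (signed_root 1) (signed_pairs n \<union> diagonal_indices n))"
proof (rule type_BC_splittings)
  show "n = Suc (n - 1)" "1 \<le> n - 1" using n by auto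
  fix k :: "nat \<Rightarrow> int" and i assume k: "\<And>j. j \<notin> {1..n} \<Longrightarrow> k j = 0" and i: "i \<in> {1..n}"
  have S: "(\<Sum>j=1..n. k j * chain_matrix j i) = 2 * k i - k (i - 1) - k (Suc i)"
    by (rule sum_chain_matrix) (use k i in auto)
  have "pairing (cartan_matrix (Type_B n)) n k i =
      (\<Sum>j=1..n. k j * chain_matrix j i - (if j = n - 1 then (if i = n then k j else 0) else 0))"
    unfolding pairing_def using n by (intro sum.cong) (auto simp: chain_matrix_def)
  also have "\<dots> = 2 * k i - k (i - 1) - k (Suc i) - (if i = n then k (n - 1) else 0)"
    unfolding sum_subtractf S using n i by auto
  finally show "pairing (cartan_matrix (Type_B n)) n k i =
      (if i = n then (2 div 1) * (1 * k n - k (n - 1)) else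
       if i = n - 1 then 2 * k i - k (i - 1) - 1 * k n else 2 * k i - k (i - 1) - k (Suc i))"
    using k[of "Suc n"] n by auto
qed simp

lemma type_C_splittings:
  assumes n: "n \<ge> 2"
  shows "card (zero_sum_splittings (positive_roots (cartan_matrix (Type_C n)) n)) =
    card (splittings (signed_root 2) (signed_pairs n \<union> diagonal_indices n))"
proof (rule type_BC_splittings)
  show "n = Suc (n - 1)" "1 \<le> n - 1" using n by auto
  fix k :: "nat \<Rightarrow> int" and i assume k: "\<And>j. j \<notin> {1..n} \<Longrightarrow> k j = 0" and i: "i \<in> {1..n}"
  have S: "(\<Sum>j=1..n. k j * chain_matrix j i) = 2 * k i - k (i - 1) - k (Suc i)"
    by (rule sum_chain_matrix) (use k i in auto)
  have "pairing (cartan_matrix (Type_C n)) n k i =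
      (\<Sum>j=1..n. k j * chain_matrix j i - (if j = n then (if Suc i = n then k j else 0) else 0))"
    unfolding pairing_def using n by (intro sum.cong) (auto simp: chain_matrix_def)
  also have "\<dots> = 2 * k i - k (i - 1) - k (Suc i) - (if Suc i = n then k n else 0)"
    unfolding sum_subtractf S using n i by auto
  finally show "pairing (cartan_matrix (Type_C n)) n k i =
      (if i = n then (2 div 2) * (2 * k n - k (n - 1)) else
       if i = n - 1 then 2 * k i - k (i - 1) - 2 * k n else 2 * k i - k (i - 1) - k (Suc i))"
    using k[of "Suc n"] n by auto
qed simp

text \<open>The parameter 2 of \<open>signed_root\<close> is the one of type C, so that the parity
  argument serves both types.\<close>

lemma type_D_splittings:
  assumes "n \<ge> 3"
  shows "card (zero_sum_splittings (positive_roots (cartan_matrix (Type_D n)) n)) = card (splittings (signed_root 2) (signed_pairs n))"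
proof -
  let ?A = "cartan_matrix (Type_D n)"
  define m where "m = n - 2"
  have m: "n = Suc (Suc m)" "1 \<le> m" using assms by (auto simp: m_def)
  then have n: "n \<ge> 3" by simp
  \<comment> \<open>The last simple root is \<open>e\<^sub>n\<^sub>-\<^sub>1 + e\<^sub>n\<close>, so
    k n enters the last two coordinates.\<close>
  define \<phi> :: "(nat \<Rightarrow> int) \<Rightarrow> nat \<Rightarrow> int" where
    "\<phi> k = (\<lambda>j. if j \<le> m then k j - k (j - 1) else if j = Suc m then k (Suc m) + k n - k m
      else if j = n then k n - k (Suc m) else 0)" for k
  define p :: "nat \<Rightarrow> (nat \<Rightarrow> int) \<Rightarrow> int" where
    "p i u = (if i < n then u i - u (Suc i) else u (n - 1) + u n)" for i u
  define v where "v i = (if i < n then diff_root (Suc i, i) else signed_root 2 (True, n, n - 1))" for i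
  interpret root_realization ?A n \<phi> p v
  proof
    show "int_linear \<phi>" by (auto simp: int_linear_def \<phi>_def algebra_simps)
    fix k :: "nat \<Rightarrow> int" assume k: "\<And>i. i \<notin> {1..n} \<Longrightarrow> k i = 0"
    show "k = (\<lambda>j. 0)" if z: "\<phi> k = (\<lambda>j. 0)"
    proof
      have 1: "k j = 0" if "j \<le> m" for j
        using that
      proof (induction j)
        case 0 then show ?case using k[of 0] by simp
      next
        case (Suc j) then show ?case using fun_cong[OF z, of "Suc j"] by (simp add: \<phi>_def)
      qed
      have "k (Suc m) + k n - k m = 0" "k n - k (Suc m) = 0"
        using fun_cong[OF z, of "Suc m"] fun_cong[OF z, of n] by (simp_all add: \<phi>_def m)
      then have 2: "k n = 0" "k (Suc m) = 0" using 1[of m] by simp_all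
      fix j
      consider "j \<le> m" | "j = Suc m" | "j = n" | "j \<notin> {1..n}" using m by fastforce
      then show "k j = 0" using 1 2 k by cases auto
    qed
    fix i assume i: "i \<in> {1..n}"
    have S: "(\<Sum>j=1..n. k j * chain_matrix j i) = 2 * k i - k (i - 1) - k (Suc i)"
      by (rule sum_chain_matrix) (use k i in auto)
    \<comment> \<open>Relative to the chain matrix, the edge between n - 2 and n is added and the
      edge between n - 1 and n is removed, each in both directions.\<close>
    have "pairing ?A n k i = (\<Sum>j=1..n. k j * chain_matrix j i
        - (if j = n then (if i = m then k j else 0) else 0) + (if j = n then (if i = Suc m then k j else 0) else 0)
        - (if j = m then (if i = n then k j else 0) else 0) + (if j = Suc m then (if i = n then k j else 0) else 0))"
      unfolding pairing_def m(1) using m(2) by (intro sum.cong) (auto simp: chain_matrix_def doubleton_eq_iff)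
    also have "\<dots> = 2 * k i - k (i - 1) - k (Suc i) - (if i = m then k n else 0) + (if i = Suc m then k n else 0)
        - (if i = n then k m else 0) + (if i = n then k (Suc m) else 0)"
      unfolding sum_subtractf sum.distrib S using m by simp
    finally have P: "pairing ?A n k i = 2 * k i - k (i - 1) - k (Suc i) - (if i = m then k n else 0)
        + (if i = Suc m then k n else 0) - (if i = n then k m else 0) + (if i = n then k (Suc m) else 0)" .
    consider "i = n" | "i = Suc m" | "i = m" | "i < m" using i m by fastforce
    then show "pairing ?A n k i = p i (\<phi> k)"
      unfolding P by cases (use m k[of "Suc n"] in \<open>simp_all add: p_def \<phi>_def\<close>)
  next
    fix i assume i: "i \<in> {1..n}"
    show "\<phi> (unit_root i) = v i"
    proof
      fix j
      have i1: "1 \<le> i" using i by auto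
      show "\<phi> (unit_root i) j = v i j"
      proof (cases "i < n")
        case True
        have "j - 1 = i \<longleftrightarrow> j = Suc i" using i1 by (rule pred_eq_iff)
        then show ?thesis
          using m True i1 unfolding \<phi>_def v_def diff_root_def unit_root_def case_prod_conv
          by (cases "j \<le> m"; cases "j = Suc m"; cases "j = n") auto
      next
        case False
        then have "i = n" using i by simp
        then show ?thesis using m
          by (auto simp: \<phi>_def v_def signed_root_def unit_root_def)
      qed
    qed
  qed
  have neg: "diff_root (b, a) \<in> generated v p n" if "1 \<le> a" "a < b" "b \<le> n" for a b
    using that by (intro diff_root_generated[of n]) (auto simp: v_def p_def)
  have pos: "signed_root 2 (True, b, a) \<in> generated v p n" if ab: "1 \<le> a" "a < b" "b \<le> n" for a b
  proof (rule sum_root_generated[OF _ _ _ ab])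
    fix a assume a: "1 \<le> a" "a < n"
    show "signed_root 2 (True, n, a) \<in> generated v p n"
    proof (cases "a = n - 1")
      case True
      have "v n = signed_root 2 (True, n, a)" using True by (simp add: v_def)
      moreover have "v n \<in> generated v p n" using n by (intro generated.simple) simp
      ultimately show ?thesis by (simp only:)
    next
      case False
      then have "diff_root (n - 1, a) \<in> generated v p n" using a by (intro neg) auto
      then show ?thesis
      proof (rule generated_raise_eq[where i = n])
        show "n \<in> {1..n}" using n by simp
        have pn: "p n (diff_root (n - 1, a)) = - 1" using a False n by (simp add: p_def diff_root_def unit_root_def)
        then show "p n (diff_root (n - 1, a)) < 0" by simp
        fix j show "signed_root 2 (True, n, a) j = diff_root (n - 1, a) j - p n (diff_root (n - 1, a)) * v n j"
          unfolding pn using a n False by (simp add: v_def signed_root_def diff_root_def)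
      qed
    qed
  qed (auto simp: v_def p_def)
  have "signed_root 2 ` signed_pairs n = generated v p n"
  proof
    have "signed_root 2 (s, b, a) \<in> generated v p n" if "(s, b, a) \<in> signed_pairs n" for s b a
      using that neg pos by (cases s) (auto simp: signed_root_False)
    then show "signed_root 2 ` signed_pairs n \<subseteq> generated v p n" by auto
    show "generated v p n \<subseteq> signed_root 2 ` signed_pairs n"
    proof
      fix u assume "u \<in> generated v p n"
      then show "u \<in> signed_root 2 ` signed_pairs n"
      proof induction
        case (simple i)
        show ?case
        proof (cases "i < n")
          case True
          then have "v i = signed_root 2 (False, Suc i, i)" by (simp add: v_def signed_root_False)
          then show ?thesis using True simple by auto
        next
          case False
          then have "v i = signed_root 2 (True, n, n - 1)" by (simp add: v_def)
          moreover have "(True, n, n - 1) \<in> signed_pairs n" using n by simp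
          ultimately show ?thesis by (metis imageI)
        qed
      next
        case (raise u i)
        then obtain s b a where u: "u = signed_root 2 (s, b, a)" and m: "1 \<le> a" "a < b" "b \<le> n" by auto
        have i: "1 \<le> i" "i \<le> n" using raise by auto
        show ?case
        proof (cases "i < n")
          case True
          then have p: "p i u = u i - u (Suc i)" and v: "v i = diff_root (Suc i, i)" by (simp_all add: p_def v_def)
          show ?thesis
            using signed_root_reflection[OF u m i(1) True] raise.hyps(3) unfolding p v by auto
        next
          case False
          then have n': "i = n" using i by simp
          then have p: "p i u = u (n - 1) + u n" and v: "v i = signed_root 2 (True, n, n - 1)" by (simp_all add: p_def v_def)
          have "u (n - 1) + u n < 0" using raise.hyps(3) by (simp only: p)
          \<comment> \<open>The vector must have a negative entry at n - 1 or n. The difference of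
            the last two coordinates is excluded, as its pairing is zero.\<close>
          then have sb: "\<not> s" "b = n \<and> a < n - 1 \<or> b = n - 1"
            using m n unfolding u by (auto simp: signed_root_def unit_root_def split: if_splits)
          have e: "n - 1 \<noteq> n" using n by simp
          from sb(2) show ?thesis
          proof
            assume b: "b = n \<and> a < n - 1"
            have "(\<lambda>j. u j - p i u * v i j) = signed_root 2 (True, n - 1, a)"
              unfolding p v unfolding u using sb(1) b m e by (auto simp: signed_root_def unit_root_def fun_eq_iff)
            moreover have "(True, n - 1, a) \<in> signed_pairs n" using m b by simp
            ultimately show ?thesis by (metis imageI)
          next
            assume b: "b = n - 1"
            have "(\<lambda>j. u j - p i u * v i j) = signed_root 2 (True, n, a)"
              unfolding p v unfolding u using sb(1) b m e by (auto simp: signed_root_def unit_root_def fun_eq_iff)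
            moreover have "(True, n, a) \<in> signed_pairs n" using m b by simp
            ultimately show ?thesis by (metis imageI)
          qed
        qed
      qed
    qed
  qed
  then show ?thesis
    by (intro card_zero_sum_splittings inj_on_subset[OF signed_root_inj]) auto
qed

lemma sum_UNIV_bool: "finite X \<Longrightarrow> (\<Sum>z\<in>(UNIV :: bool set) \<times> X. f z) = (\<Sum>x\<in>X. f (True, x) + f (False, x))"
  by (simp add: sum.cartesian_product' UNIV_bool sum.distrib add.commute)

lemma splittings_Un_nonempty:
  assumes "finite I" "finite I'" "I \<inter> I' = {}" "splittings w I \<noteq> {}" "splittings w I' \<noteq> {}"
  shows "splittings w (I \<union> I') \<noteq> {}"
proof -
  have "card (splittings w I) * card (splittings w I') > 0"
    using assms(4,5) finite_splittings[OF assms(1)] finite_splittings[OF assms(2)] by (simp add: card_gt_0_iff)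
  then show ?thesis using card_splittings_Un[OF assms(1-3), of w] by force
qed

section \<open>Adding four coordinates in types C and D\<close>

definition old_new_pairs :: "nat \<Rightarrow> (nat \<times> nat) set" where
  "old_new_pairs n = {n + 1, n + 2, n + 3, n + 4} \<times> {1..n}"

definition new_pairs :: "nat \<Rightarrow> (nat \<times> nat) set" where
  "new_pairs n = {(n + 2, n + 1), (n + 3, n + 1), (n + 3, n + 2), (n + 4, n + 1), (n + 4, n + 2), (n + 4, n + 3)}"

lemma finite_layers [simp]: "finite (old_new_pairs n)" "finite (new_pairs n)"
  by (simp_all add: old_new_pairs_def new_pairs_def)

lemma pairs_below_add_4: "pairs_below (n + 4) = pairs_below n \<union> (old_new_pairs n \<union> new_pairs n)"
proof (rule set_eqI, clarify)
  fix b a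
  consider "b \<le> n" | "b = n + 1" | "b = n + 2" | "b = n + 3" | "b = n + 4" | "b > n + 4" by linarith
  then show "(b, a) \<in> pairs_below (n + 4) \<longleftrightarrow> (b, a) \<in> pairs_below n \<union> (old_new_pairs n \<union> new_pairs n)"
    by cases (simp_all add: old_new_pairs_def new_pairs_def, presburger+)
qed

text \<open>Equal signs on a sum and a difference root of a and b leave plus or minus
  \<open>2e\<^sub>a\<close>; the signs +, -, +, - for the four new b cancel these.\<close>

lemma old_new_splittings: "splittings (signed_root c) (UNIV \<times> old_new_pairs n) \<noteq> {}"
proof -
  let ?B = "{n + 1, n + 2, n + 3, n + 4}"
  let ?t = "\<lambda>b. if b = n + 1 \<or> b = n + 3 then 1 else - 1 :: int"
  let ?s = "\<lambda>(s :: bool, b, a :: nat). ?t b"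
  have "{x \<in> UNIV \<times> old_new_pairs n. ?s x = 1} \<in> splittings (signed_root c) (UNIV \<times> old_new_pairs n)"
  proof (rule splittings_signing)
    show "?s x = 1 \<or> ?s x = - 1" for x by (cases x) auto
    fix i
    have "(\<Sum>x\<in>UNIV \<times> old_new_pairs n. ?s x * signed_root c x i) =
        (\<Sum>(b, a)\<in>old_new_pairs n. ?t b * (2 * unit_root a i))"
      unfolding sum_UNIV_bool[OF finite_layers(1)]
    proof (rule sum.cong[OF refl])
      fix x assume "x \<in> old_new_pairs n"
      then obtain b a where "x = (b, a)" "a < b" by (auto simp: old_new_pairs_def)
      then show "?s (True, x) * signed_root c (True, x) i + ?s (False, x) * signed_root c (False, x) i =
          (case x of (b, a) \<Rightarrow> ?t b * (2 * unit_root a i))"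
        by (simp add: signed_root_simps)
    qed
    also have "\<dots> = (\<Sum>b\<in>?B. ?t b * (\<Sum>a=1..n. 2 * unit_root a i))"
      unfolding old_new_pairs_def sum_distrib_left by (rule sum.cartesian_product[symmetric])
    also have "\<dots> = 0" by simp
    finally show "(\<Sum>x\<in>UNIV \<times> old_new_pairs n. ?s x * signed_root c x i) = 0" .
  qed simp
  then show ?thesis by blast
qed

text \<open>A sign pattern on the pair \<open>e\<^sub>a + e\<^sub>b, e\<^sub>a - e\<^sub>b\<close> contributes \<open>\<plusminus>2e\<^sub>a\<close> or \<open>\<plusminus>2e\<^sub>b\<close>; the patterns below are chosen so
  that the contributions cancel at each of the four new coordinates.\<close>

lemma new_splittings_D: "splittings (signed_root 2) (UNIV \<times> new_pairs n) \<noteq> {}"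
proof -
  let ?s = "\<lambda>(s, b, a). if (b, a) = (n + 2, n + 1) \<or> (b, a) = (n + 3, n + 2) \<or> (b, a) = (n + 4, n + 1) \<and> s
      \<or> (b, a) = (n + 4, n + 3) \<and> \<not> s then 1 else - 1 :: int"
  have "{x \<in> UNIV \<times> new_pairs n. ?s x = 1} \<in> splittings (signed_root 2) (UNIV \<times> new_pairs n)"
  proof (rule splittings_signing)
    show "?s x = 1 \<or> ?s x = - 1" for x by (cases x) auto
    show "(\<Sum>x\<in>UNIV \<times> new_pairs n. ?s x * signed_root 2 x i) = 0" for i
      unfolding sum_UNIV_bool[OF finite_layers(2)] by (simp add: new_pairs_def signed_root_def)
  qed simp
  then show ?thesis by blast
qed

lemma type_D_step:
  "2 * card (splittings (signed_root 2) (signed_pairs n)) \<le> card (splittings (signed_root 2) (signed_pairs (n + 4)))"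
proof -
  have e: "signed_pairs (n + 4) = signed_pairs n \<union> (UNIV \<times> old_new_pairs n \<union> UNIV \<times> new_pairs n)"
    unfolding pairs_below_add_4 by blast
  have "splittings (signed_root 2) ((UNIV :: bool set) \<times> old_new_pairs n \<union> UNIV \<times> new_pairs n) \<noteq> {}"
    by (rule splittings_Un_nonempty[OF _ _ _ old_new_splittings new_splittings_D])
      (auto simp: old_new_pairs_def new_pairs_def)
  then show ?thesis unfolding e
    by (intro card_splittings_Un_double) (auto simp: old_new_pairs_def new_pairs_def)
qed

text \<open>The recursion starts from zero or one coordinate, where there are no roots.\<close>

lemma type_D_lower_bound:
  assumes "r \<le> 1" shows "card (splittings (signed_root 2) (signed_pairs (4 * q + r))) \<ge> 2 ^ q"
proof (induction q)
  case 0
  have "pairs_below r = {}" using assms by (auto simp: pairs_below_def)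
  then show ?case by (simp add: splittings_empty)
next
  case (Suc q)
  have e: "4 * Suc q + r = 4 * q + r + 4" by simp
  show ?case unfolding e power_Suc using Suc type_D_step[of "4 * q + r"] by linarith
qed

definition new_diagonal :: "nat \<Rightarrow> (bool \<times> nat \<times> nat) set" where
  "new_diagonal n = {(True, n + 1, n + 1), (True, n + 2, n + 2), (True, n + 3, n + 3), (True, n + 4, n + 4)}"

text \<open>All four \<open>2e\<^sub>b\<close> get the sign -, and the six pairs of new coordinates
  are signed to leave one \<open>2e\<^sub>b\<close> for each b.\<close>

lemma new_splittings_C: "splittings (signed_root 2) (UNIV \<times> new_pairs n \<union> new_diagonal n) \<noteq> {}"
proof -
  let ?s = "\<lambda>(s, b, a). if (b, a) = (n + 2, n + 1) \<or> (b, a) = (n + 4, n + 1) \<or> (b, a) = (n + 3, n + 2)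
      \<or> (b, a) = (n + 4, n + 3) \<or> (b, a) = (n + 4, n + 2) \<and> s then 1 else - 1 :: int"
  let ?I = "UNIV \<times> new_pairs n \<union> new_diagonal n"
  have "{x \<in> ?I. ?s x = 1} \<in> splittings (signed_root 2) ?I"
  proof (rule splittings_signing)
    show "finite ?I" by (simp add: new_diagonal_def)
    show "?s x = 1 \<or> ?s x = - 1" for x by (cases x) auto
    fix i
    have "(\<Sum>x\<in>?I. ?s x * signed_root 2 x i) =
        (\<Sum>x\<in>UNIV \<times> new_pairs n. ?s x * signed_root 2 x i) + (\<Sum>x\<in>new_diagonal n. ?s x * signed_root 2 x i)"
      by (rule sum.union_disjoint) (auto simp: new_pairs_def new_diagonal_def)
    also have "\<dots> = 0"
      unfolding sum_UNIV_bool[OF finite_layers(2)] by (simp add: new_pairs_def new_diagonal_def signed_root_def)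
    finally show "(\<Sum>x\<in>?I. ?s x * signed_root 2 x i) = 0" .
  qed
  then show ?thesis by blast
qed

abbreviation type_C_indices :: "nat \<Rightarrow> (bool \<times> nat \<times> nat) set" where
  "type_C_indices n \<equiv> signed_pairs n \<union> diagonal_indices n"

lemma type_C_step:
  "2 * card (splittings (signed_root 2) (type_C_indices n)) \<le> card (splittings (signed_root 2) (type_C_indices (n + 4)))"
proof -
  have "{1..n + 4} = {1..n} \<union> {n + 1, n + 2, n + 3, n + 4}" by auto
  then have "diagonal_indices (n + 4) = diagonal_indices n \<union> new_diagonal n"
    unfolding diagonal_indices_def new_diagonal_def by (simp add: image_Un)
  then have e: "type_C_indices (n + 4) =
      type_C_indices n \<union> (UNIV \<times> old_new_pairs n \<union> (UNIV \<times> new_pairs n \<union> new_diagonal n))"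
    unfolding pairs_below_add_4 by blast
  have "splittings (signed_root 2) (UNIV \<times> old_new_pairs n \<union> (UNIV \<times> new_pairs n \<union> new_diagonal n)) \<noteq> {}"
    by (rule splittings_Un_nonempty[OF _ _ _ old_new_splittings new_splittings_C])
      (auto simp: old_new_pairs_def new_pairs_def new_diagonal_def)
  then show ?thesis unfolding e
    by (intro card_splittings_Un_double) (auto simp: old_new_pairs_def new_pairs_def new_diagonal_def)
qed

lemma type_C_lower_bound_0: "card (splittings (signed_root 2) (type_C_indices (4 * q))) \<ge> 2 ^ q"
proof (induction q)
  case 0
  have "type_C_indices 0 = {}" by (auto simp: pairs_below_def diagonal_indices_def)
  then show ?case by (simp add: splittings_empty)
next
  case (Suc q)
  have e: "4 * Suc q = 4 * q + 4" by simp
  show ?case unfolding e power_Suc using Suc type_C_step[of "4 * q"] by linarith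
qed

text \<open>The exponent is one more than the number of steps because rank 3 already has a splitting
  and its complement: pairs leave \<open>2e\<^sub>1\<close>, \<open>2e\<^sub>2\<close>,
  \<open>2e\<^sub>3\<close>, and the diagonal roots cancel them.\<close>

lemma type_C_lower_bound_3: "card (splittings (signed_root 2) (type_C_indices (4 * q + 3))) \<ge> 2 ^ Suc q"
proof (induction q)
  case 0
  let ?I = "type_C_indices 3"
  let ?s = "\<lambda>(s, b, a). if (b, a) = (2, 1) \<or> (b, a) = (3, 2) \<or> (b, a) = (3, 1) \<and> s then 1 else - 1 :: int"
  have p: "pairs_below 3 = {(2, 1), (3, 1), (3, 2)}" by auto
  have d: "diagonal_indices 3 = {(True, 1, 1), (True, 2, 2), (True, 3, 3)}" by auto
  have "{x \<in> ?I. ?s x = 1} \<in> splittings (signed_root 2) ?I"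
  proof (rule splittings_signing)
    show "finite ?I" by simp
    show "?s x = 1 \<or> ?s x = - 1" for x by (cases x) auto
    fix i
    have "(\<Sum>x\<in>?I. ?s x * signed_root 2 x i) =
        (\<Sum>x\<in>signed_pairs 3. ?s x * signed_root 2 x i) + (\<Sum>x\<in>diagonal_indices 3. ?s x * signed_root 2 x i)"
      by (rule sum.union_disjoint) auto
    also have "\<dots> = 0"
      unfolding sum_UNIV_bool[OF finite_pairs_below] unfolding p d by (simp add: signed_root_def)
    finally show "(\<Sum>x\<in>?I. ?s x * signed_root 2 x i) = 0" .
  qed
  then have "splittings (signed_root 2) ?I \<noteq> {}" by blast
  moreover have "(True, 1, 1) \<in> ?I" by simp
  then have "?I \<noteq> {}" by blast
  ultimately have "card (splittings (signed_root 2) ?I) \<ge> 2" by (intro card_splittings_ge_2) simp_all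
  then show ?case by simp
next
  case (Suc q)
  have e: "4 * Suc q + 3 = 4 * q + 3 + 4" by simp
  show ?case unfolding e power_Suc[of _ "Suc q"] using Suc type_C_step[of "4 * q + 3"] by linarith
qed

text \<open>The coordinate sum is 2 for indices with first component True and 0 for differences.
  Half of it is balanced by every splitting, so an odd number of True indices is an
  obstruction.\<close>

lemma type_CD_parity:
  assumes I: "I \<subseteq> type_C_indices n" and odd: "odd (card {x \<in> I. fst x})"
  shows "splittings (signed_root 2) I = {}"
proof (rule splittings_parity[where f = "\<lambda>x. if fst x then 1 else 0"])
  show fin: "finite I" using I finite_subset by fastforce
  show "odd (\<Sum>x\<in>I. if fst x then 1 else 0 :: int)"
    using odd fin by (simp add: sum.If_cases Int_def)
  have F: "(\<Sum>j=1..n. signed_root 2 x j) = 2 * (if fst x then 1 else 0)" if "x \<in> I" for x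
  proof -
    obtain s b a where x: "x = (s, b, a)" by (cases x)
    then have "1 \<le> a" "a \<le> b" "b \<le> n" "a = b \<longrightarrow> s" using that I by auto
    then show ?thesis
      unfolding x by (cases "a = b"; cases s)
        (simp_all add: signed_root_def unit_root_def sum.distrib sum_subtractf sum_distrib_left[symmetric])
  qed
  fix D assume D: "D \<in> splittings (signed_root 2) I"
  have G: "2 * (\<Sum>x\<in>X. if fst x then 1 else 0) = (\<Sum>j=1..n. \<Sum>x\<in>X. signed_root 2 x j)" if "X \<subseteq> I" for X
    unfolding sum_distrib_left using that F by (subst sum.swap) (auto intro!: sum.cong)
  have "(\<Sum>j=1..n. \<Sum>x\<in>D. signed_root 2 x j) = (\<Sum>j=1..n. \<Sum>x\<in>I - D. signed_root 2 x j)"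
    using D by (simp add: splittings_def)
  moreover have "D \<subseteq> I" using D by (simp add: splittings_def)
  ultimately show "(\<Sum>x\<in>D. if fst x then 1 else 0 :: int) = (\<Sum>x\<in>I - D. if fst x then 1 else 0)"
    using G[of D] G[of "I - D"] by auto
qed

lemma odd_triangle:
  assumes "n mod 4 = 2 \<or> n mod 4 = 3" "2 * c = n * (n - 1)" shows "odd (c::nat)"
proof
  assume "even c"
  then obtain d where d: "c = 2 * d" by blast
  obtain q where "n = 4 * q + 2 \<or> n = 4 * q + 3" using assms(1) by (metis mult_div_mod_eq)
  then show False
  proof
    assume "n = 4 * q + 2"
    then have "2 * (2 * d) = (4 * q + 2) * (4 * q + 1)" using assms(2) d by simp
    then have "2 * d = (2 * q + 1) * (4 * q + 1)" by simp
    then show False by (metis even_mult_iff dvd_triv_left even_plus_one_iff even_numeral dvd_mult2 mult.commute)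
  next
    assume "n = 4 * q + 3"
    then have "2 * (2 * d) = (4 * q + 3) * (4 * q + 2)" using assms(2) d by simp
    then have "2 * d = (4 * q + 3) * (2 * q + 1)" by simp
    moreover have "odd ((4 * q + 3) * (2 * q + 1))" by simp
    ultimately show False by (metis dvd_triv_left)
  qed
qed

lemma type_D_parity:
  assumes "n mod 4 = 2 \<or> n mod 4 = 3" shows "splittings (signed_root 2) (signed_pairs n) = {}"
proof (rule type_CD_parity[where n = n])
  have "{x \<in> signed_pairs n. fst x} = {True} \<times> pairs_below n" by auto
  then show "odd (card {x \<in> signed_pairs n. fst x})"
    using odd_triangle[OF assms card_pairs_below] by (simp add: card_cartesian_product)
qed simp

lemma type_C_parity:
  assumes "n mod 4 = 1 \<or> n mod 4 = 2" shows "splittings (signed_root 2) (type_C_indices n) = {}"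
proof (rule type_CD_parity[where n = n])
  have e: "{x \<in> type_C_indices n. fst x} = {True} \<times> pairs_below n \<union> diagonal_indices n" by auto
  have "card (diagonal_indices n) = n"
    unfolding diagonal_indices_def by (subst card_image) (auto simp: inj_on_def)
  then have c: "card {x \<in> type_C_indices n. fst x} = card (pairs_below n) + n"
    unfolding e by (subst card_Un_disjoint) (auto simp: card_cartesian_product)
  \<comment> \<open>The diagonal turns n (n - 1) / 2 into the next triangular number, hence the
    shift to n + 1.\<close>
  have "2 * (card (pairs_below n) + n) = Suc n * (Suc n - 1)"
    using card_pairs_below[of n] by (cases n) auto
  moreover have "Suc n mod 4 = 2 \<or> Suc n mod 4 = 3" using assms by (auto simp: mod_Suc)
  ultimately show "odd (card {x \<in> type_C_indices n. fst x})" unfolding c using odd_triangle by blast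
qed simp

text \<open>At the first coordinate the sum and difference roots of each pair together contribute 0
  or 2, while \<open>e\<^sub>1\<close> contributes 1.\<close>

lemma type_B_parity:
  assumes "n \<ge> 1" shows "splittings (signed_root 1) (type_C_indices n) = {}"
proof (rule splittings_parity[where f = "\<lambda>x. signed_root 1 x 1"])
  have "(\<Sum>x\<in>type_C_indices n. signed_root 1 x 1) =
      (\<Sum>x\<in>signed_pairs n. signed_root 1 x 1) + (\<Sum>x\<in>diagonal_indices n. signed_root 1 x 1)"
    by (rule sum.union_disjoint) auto
  also have "(\<Sum>x\<in>signed_pairs n. signed_root 1 x 1) = (\<Sum>(b, a)\<in>pairs_below n. 2 * unit_root a 1)"
    unfolding sum_UNIV_bool[OF finite_pairs_below]
    by (rule sum.cong) (auto simp: signed_root_simps)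
  also have "\<dots> = 2 * (\<Sum>(b, a)\<in>pairs_below n. unit_root a 1)"
    by (simp add: sum_distrib_left case_prod_unfold)
  also have "(\<Sum>x\<in>diagonal_indices n. signed_root 1 x 1) = (\<Sum>b=1..n. unit_root b 1)"
    unfolding diagonal_indices_def by (subst sum.reindex) (auto simp: inj_on_def signed_root_def)
  also have "\<dots> = 1" using assms by (simp add: unit_root_def)
  finally show "odd (\<Sum>x\<in>type_C_indices n. signed_root 1 x 1)" by simp
qed (auto simp: splittings_def)

section \<open>Exceptional types\<close>

definition vec_of :: "int list \<Rightarrow> nat \<Rightarrow> int" where
  "vec_of l i = (if 1 \<le> i \<and> i \<le> length l then l ! (i - 1) else 0)"

lemma vec_of_Suc: "vec_of l (Suc i) = (if i < length l then l ! i else 0)"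
  by (auto simp: vec_of_def)

lemma vec_of_inject:
  assumes "vec_of l = vec_of l'" "length l = length l'" shows "l = l'"
proof (rule nth_equalityI[OF assms(2)])
  fix i assume "i < length l"
  then show "l ! i = l' ! i" using fun_cong[OF assms(1), of "Suc i"] assms(2) by (simp add: vec_of_Suc)
qed

definition scalar_prod :: "int list \<Rightarrow> int list \<Rightarrow> int" where
  "scalar_prod xs ys = sum_list (map2 (*) xs ys)"

text \<open>Column i holds the values of the simple roots on the i-th coroot, so a pairing becomes a
  scalar product of lists.\<close>

definition matrix_columns :: "(nat \<Rightarrow> nat \<Rightarrow> int) \<Rightarrow> nat \<Rightarrow> int list list" where
  "matrix_columns A n = map (\<lambda>i. map (\<lambda>j. A (Suc j) (Suc i)) [0..<n]) [0..<n]"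

definition raise_at :: "int list list \<Rightarrow> int list \<Rightarrow> nat \<Rightarrow> int list list" where
  "raise_at cols l i = (if scalar_prod l (cols ! i) < 0 then [l[i := l ! i - scalar_prod l (cols ! i)]] else [])"

definition next_level :: "int list list \<Rightarrow> int list list \<Rightarrow> int list list" where
  "next_level cols lev = remdups (concat (map (\<lambda>l. concat (map (raise_at cols l) [0..<length cols])) lev))"

text \<open>The number bounds the levels; the result is \<open>Some\<close> only if the last level
  is empty, which certifies that the enumeration is complete.\<close>

fun root_levels :: "int list list \<Rightarrow> nat \<Rightarrow> int list list \<Rightarrow> int list list option" where
  "root_levels cols 0 lev = (if lev = [] then Some [] else None)"
| "root_levels cols (Suc m) lev = map_option (append lev) (root_levels cols m (next_level cols lev))"

definition unit_lists :: "nat \<Rightarrow> int list list" where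
  "unit_lists n = map (\<lambda>i. map (\<lambda>j. if j = i then 1 else 0) [0..<n]) [0..<n]"

lemma pairing_vec_of:
  assumes "length l = n" "i < n"
  shows "pairing A n (vec_of l) (Suc i) = scalar_prod l (matrix_columns A n ! i)"
proof -
  have "pairing A n (vec_of l) (Suc i) = (\<Sum>j<n. vec_of l (Suc j) * A (Suc j) (Suc i))"
    unfolding pairing_def by (rule sum.reindex_bij_witness[of _ Suc "\<lambda>j. j - 1"]) auto
  also have "\<dots> = (\<Sum>j<n. l ! j * A (Suc j) (Suc i))"
    using assms by (intro sum.cong) (auto simp: vec_of_Suc)
  also have "\<dots> = scalar_prod l (matrix_columns A n ! i)"
    using assms by (simp add: scalar_prod_def matrix_columns_def sum_list_sum_nth atLeast0LessThan)
  finally show ?thesis .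
qed

lemma reflection_vec_of:
  assumes "length l = n" "i < n"
  shows "simple_reflection A n (Suc i) (vec_of l) = vec_of (l[i := l ! i - scalar_prod l (matrix_columns A n ! i)])"
proof
  fix j
  show "simple_reflection A n (Suc i) (vec_of l) j = vec_of (l[i := l ! i - scalar_prod l (matrix_columns A n ! i)]) j"
  proof (cases j)
    case (Suc m)
    then show ?thesis
      using assms by (simp add: simple_reflection_def pairing_vec_of vec_of_Suc nth_list_update)
  qed (simp add: simple_reflection_def vec_of_def)
qed

lemma vec_of_unit_lists: "vec_of ` set (unit_lists n) = unit_root ` {1..n}"
proof -
  have "vec_of (map (\<lambda>j. if j = i then 1 else 0) [0..<n]) = unit_root (Suc i)" if "i < n" for i
    using that by (auto simp: vec_of_def unit_root_def fun_eq_iff)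
  then have "vec_of ` set (unit_lists n) = (\<lambda>i. unit_root (Suc i)) ` {0..<n}"
    unfolding unit_lists_def set_map image_image set_upt by (intro image_cong refl) simp
  also have "\<dots> = unit_root ` Suc ` {0..<n}" by (simp only: image_image)
  also have "Suc ` {0..<n} = {1..n}" by (simp add: image_Suc_atLeastLessThan atLeastLessThanSuc_atLeastAtMost)
  finally show ?thesis .
qed

lemma set_next_level:
  "set (next_level (matrix_columns A n) lev) =
    {l[i := l ! i - scalar_prod l (matrix_columns A n ! i)] | l i. l \<in> set lev \<and> i < n \<and> scalar_prod l (matrix_columns A n ! i) < 0}"
proof -
  have "length (matrix_columns A n) = n" by (simp add: matrix_columns_def)
  then have "set (next_level (matrix_columns A n) lev) = (\<Union>l\<in>set lev. \<Union>i\<in>{..<n}. set (raise_at (matrix_columns A n) l i))"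
    by (simp add: next_level_def atLeast0LessThan)
  then show ?thesis by (auto simp: raise_at_def split: if_splits)
qed

lemma root_levels_sound:
  "root_levels (matrix_columns A n) m lev = Some L \<Longrightarrow> (\<And>l. l \<in> set lev \<Longrightarrow> length l = n \<and> vec_of l \<in> positive_roots A n) \<Longrightarrow>
    l \<in> set L \<Longrightarrow> length l = n \<and> vec_of l \<in> positive_roots A n"
proof (induction m arbitrary: lev L)
  case (Suc m)
  let ?c = "matrix_columns A n"
  obtain L' where L': "root_levels ?c m (next_level ?c lev) = Some L'" "L = lev @ L'" using Suc.prems(1) by auto
  have "length l = n \<and> vec_of l \<in> positive_roots A n" if l: "l \<in> set (next_level ?c lev)" for l
  proof -
    obtain l' i where l': "l = l'[i := l' ! i - scalar_prod l' (?c ! i)]" "l' \<in> set lev" "i < n" "scalar_prod l' (?c ! i) < 0"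
      using l unfolding set_next_level by blast
    then have k: "length l' = n" "vec_of l' \<in> positive_roots A n" using Suc.prems(2) by auto
    have "simple_reflection A n (Suc i) (vec_of l') \<in> positive_roots A n"
      using k l'(3,4) by (intro positive_roots.raise) (auto simp: pairing_vec_of)
    then show ?thesis using k l' by (simp add: reflection_vec_of)
  qed
  then show ?case using Suc.IH[OF L'(1)] Suc.prems(2,3) L'(2) by auto
qed (auto split: if_splits)

lemma root_levels_closed:
  "root_levels (matrix_columns A n) m lev = Some L \<Longrightarrow> set (next_level (matrix_columns A n) L) \<subseteq> set L"
proof (induction m arbitrary: lev L)
  case (Suc m)
  let ?c = "matrix_columns A n"
  obtain L' where L': "root_levels ?c m (next_level ?c lev) = Some L'" "L = lev @ L'" using Suc.prems(1) by auto
  have "set (next_level ?c lev) \<subseteq> set L'" using L'(1) by (cases m) (auto split: if_splits)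
  moreover have "set (next_level ?c L) = set (next_level ?c lev) \<union> set (next_level ?c L')"
    unfolding set_next_level L'(2) by auto
  ultimately show ?case using Suc.IH[OF L'(1)] L'(2) by auto
qed (auto simp: set_next_level split: if_splits)

text \<open>Every listed vector arises by raising steps, and the list contains the simple roots and
  is closed under raising.\<close>

lemma positive_roots_root_levels:
  assumes "root_levels (matrix_columns A n) m (unit_lists n) = Some L"
  shows "positive_roots A n = vec_of ` set L" and "\<And>l. l \<in> set L \<Longrightarrow> length l = n"
proof -
  have u: "length l = n \<and> vec_of l \<in> positive_roots A n" if "l \<in> set (unit_lists n)" for l
  proof -
    have "vec_of l \<in> unit_root ` {1..n}" using that vec_of_unit_lists by blast
    then have "vec_of l \<in> positive_roots A n" by (elim imageE) (simp only:, rule positive_roots.unit)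
    then show ?thesis using that by (auto simp: unit_lists_def)
  qed
  note s = root_levels_sound[OF assms u]
  show len: "length l = n" if "l \<in> set L" for l using s[OF _ that] by blast
  have sub: "set (unit_lists n) \<subseteq> set L" using assms by (cases m) (auto split: if_splits)
  show "positive_roots A n = vec_of ` set L"
  proof
    show "vec_of ` set L \<subseteq> positive_roots A n" using s by blast
    show "positive_roots A n \<subseteq> vec_of ` set L"
    proof
      fix k assume "k \<in> positive_roots A n"
      then show "k \<in> vec_of ` set L"
      proof induction
        case (unit i)
        then show ?case using sub vec_of_unit_lists[of n] by blast
      next
        case (raise k i)
        then obtain l where l: "l \<in> set L" "k = vec_of l" by blast
        obtain j where j: "i = Suc j" "j < n" using raise.hyps(2) by (cases i) auto
        have "scalar_prod l (matrix_columns A n ! j) < 0"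
          using raise.hyps(3) pairing_vec_of[OF len[OF l(1)] j(2)] l j by simp
        then have "l[j := l ! j - scalar_prod l (matrix_columns A n ! j)] \<in> set (next_level (matrix_columns A n) L)"
          unfolding set_next_level using l(1) j(2) by blast
        then have "l[j := l ! j - scalar_prod l (matrix_columns A n ! j)] \<in> set L"
          using root_levels_closed[OF assms] by blast
        then show ?case using reflection_vec_of[OF len[OF l(1)] j(2)] l j by auto
      qed
    qed
  qed
qed

subsection \<open>Counting splittings with generating functions\<close>

text \<open>Polynomials in nested Horner form: \<open>X a p\<close> stands for \<open>a + x p\<close>, where \<open>a\<close> has one variable fewer.
  All recursion equations are unconditional, which keeps rewriting with them fast.\<close>

datatype tree = Z | K num | X tree tree

text \<open>The clauses that mix \<open>K\<close> and \<open>X\<close> are defaults for trees of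
  different arity; \<open>arity\<close> excludes them in the correctness proofs.\<close>

fun add where
  "add Z q = q"
| "add (K a) Z = K a" | "add (K a) (K b) = K (a + b)" | "add (K a) (X b q) = Z"
| "add (X a p) Z = X a p" | "add (X a p) (K b) = Z" | "add (X a p) (X b q) = X (add a b) (add p q)"

fun prefix where
  "prefix 0 t = t"
| "prefix (Suc n) t = X Z (prefix n t)"

text \<open>Multiplication by the monomial with exponent list v; \<open>shift_coeffs\<close>
  multiplies the coefficients of the outermost variable.\<close>

fun shift and shift_coeffs where
  "shift [] t = t"
| "shift (v # vs) t = prefix v (shift_coeffs vs t)"
| "shift_coeffs vs Z = Z"
| "shift_coeffs vs (K a) = Z"
| "shift_coeffs vs (X a p) = X (shift vs a) (shift_coeffs vs p)"

text \<open>Multiplies t by the product of the factors \<open>1 + x^v\<close>.\<close>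

fun subset_sums where
  "subset_sums [] t = t"
| "subset_sums (v # vs) t = subset_sums vs (add t (shift v t))"

fun monomial where
  "monomial [] = K num.One"
| "monomial (v # vs) = prefix v (X (monomial vs) Z)"

text \<open>The sum over all exponents of the product of the two coefficients, returned as a
  constant.\<close>

fun matches where
  "matches Z q = Z"
| "matches (K a) Z = Z" | "matches (K a) (K b) = K (a * b)" | "matches (K a) (X b q) = Z"
| "matches (X a p) Z = Z" | "matches (X a p) (K b) = Z" | "matches (X a p) (X b q) = add (matches a b) (matches p q)"

fun arity :: "nat \<Rightarrow> tree \<Rightarrow> bool" where
  "arity n Z = True"
| "arity n (K c) = (n = 0)"
| "arity n (X a p) = (n > 0 \<and> arity (n - 1) a \<and> arity n p)"

fun incr :: "nat list \<Rightarrow> nat list" where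
  "incr [] = []"
| "incr (k # r) = Suc k # r"

text \<open>The meaning of a tree: the sum over exponent lists x of the coefficient times f x.
  Correctness is stated through this functional instead of single coefficients.\<close>

fun tsum :: "tree \<Rightarrow> (nat list \<Rightarrow> nat) \<Rightarrow> nat" where
  "tsum Z f = 0"
| "tsum (K c) f = numeral c * f []"
| "tsum (X a p) f = tsum a (\<lambda>x. f (0 # x)) + tsum p (\<lambda>x. f (incr x))"

lemma length_incr [simp]: "length (incr x) = length x"
  by (cases x) auto

lemma incr_funpow: "(incr ^^ n) (k # r) = (n + k) # r"
  by (induction n) auto

lemma tsum_cong: "arity n t \<Longrightarrow> (\<And>x. length x = n \<Longrightarrow> f x = g x) \<Longrightarrow> tsum t f = tsum t g"
proof (induction t arbitrary: n f g)
  case (X a p)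
  have "tsum a (\<lambda>x. f (0 # x)) = tsum a (\<lambda>x. g (0 # x))"
    using X.prems by (intro X.IH(1)[of "n - 1"]) auto
  moreover have "tsum p (\<lambda>x. f (incr x)) = tsum p (\<lambda>x. g (incr x))"
    using X.prems by (intro X.IH(2)[of n]) auto
  ultimately show ?case by simp
qed auto

lemma tsum_plus: "tsum t (\<lambda>x. f x + g x) = tsum t f + tsum t g"
  by (induction t arbitrary: f g) (simp_all add: algebra_simps)

lemma tsum_0: "tsum t (\<lambda>x. 0) = 0"
  by (induction t) simp_all

lemma arity_add: "arity n s \<Longrightarrow> arity n t \<Longrightarrow> arity n (add s t)"
  by (induction s t arbitrary: n rule: add.induct) auto

lemma tsum_add: "arity n s \<Longrightarrow> arity n t \<Longrightarrow> tsum (add s t) f = tsum s f + tsum t f"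
proof (induction s t arbitrary: n f rule: add.induct)
  case (7 a p b q)
  then show ?case using "7.IH"(1)[of "n - 1"] "7.IH"(2)[of n] by simp
next
  case (3 a b)
  show ?case by (simp only: add.simps tsum.simps numeral_add distrib_right)
qed auto

lemma arity_prefix: "0 < n \<Longrightarrow> arity n t \<Longrightarrow> arity n (prefix k t)"
  by (induction k) auto

lemma tsum_prefix: "tsum (prefix k t) f = tsum t (\<lambda>x. f ((incr ^^ k) x))"
  by (induction k arbitrary: f) simp_all

lemma arity_shift:
  "length vs = n \<Longrightarrow> arity n t \<Longrightarrow> arity n (shift vs t)"
  "length vs = n \<Longrightarrow> arity (Suc n) t \<Longrightarrow> arity (Suc n) (shift_coeffs vs t)"
  by (induction vs t and vs t arbitrary: n and n rule: shift_shift_coeffs.induct) (auto intro!: arity_prefix)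

lemma tsum_shift:
  "length vs = n \<Longrightarrow> arity n t \<Longrightarrow> tsum (shift vs t) f = tsum t (\<lambda>x. f (map2 (+) vs x))"
  "length vs = n \<Longrightarrow> arity (Suc n) t \<Longrightarrow> tsum (shift_coeffs vs t) f = tsum t (\<lambda>x. f (hd x # map2 (+) vs (tl x)))"
proof (induction vs t and vs t arbitrary: n f and n f rule: shift_shift_coeffs.induct)
  case (1 t)
  then have "arity 0 t" by simp
  then have "tsum t f = tsum t (\<lambda>x. f (map2 (+) [] x))" by (rule tsum_cong) simp
  then show ?case by simp
next
  case (2 v vs t)
  then have ar: "arity (Suc (length vs)) t" by auto
  have "tsum (shift (v # vs) t) f = tsum t (\<lambda>x. f ((incr ^^ v) (hd x # map2 (+) vs (tl x))))"
    using 2 ar by (simp add: tsum_prefix)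
  also have "\<dots> = tsum t (\<lambda>x. f (map2 (+) (v # vs) x))"
  proof (rule tsum_cong[OF ar])
    fix x :: "nat list" assume "length x = Suc (length vs)"
    then show "f ((incr ^^ v) (hd x # map2 (+) vs (tl x))) = f (map2 (+) (v # vs) x)"
      by (cases x) (simp_all add: incr_funpow)
  qed
  finally show ?case .
next
  case (5 vs a p)
  have "tsum (shift_coeffs vs p) (\<lambda>x. f (incr x)) = tsum p (\<lambda>x. f (incr (hd x # map2 (+) vs (tl x))))"
    using 5 by simp
  also have "\<dots> = tsum p (\<lambda>x. f (hd (incr x) # map2 (+) vs (tl (incr x))))"
  proof (rule tsum_cong[of "Suc n"])
    fix x :: "nat list" assume "length x = Suc n"
    then show "f (incr (hd x # map2 (+) vs (tl x))) = f (hd (incr x) # map2 (+) vs (tl (incr x)))"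
      by (cases x) simp_all
  qed (use 5 in simp)
  finally show ?case using 5 by simp
qed auto

fun sublist_sums :: "nat list list \<Rightarrow> (nat list \<Rightarrow> nat) \<Rightarrow> nat list \<Rightarrow> nat" where
  "sublist_sums [] f x = f x"
| "sublist_sums (v # vs) f x = sublist_sums vs f x + sublist_sums vs f (map2 (+) v x)"

text \<open>Each factor \<open>1 + x^v\<close> is dual to one branching of
  \<open>sublist_sums\<close>.\<close>

lemma tsum_subset_sums:
  "arity n t \<Longrightarrow> (\<And>v. v \<in> set vs \<Longrightarrow> length v = n) \<Longrightarrow> arity n (subset_sums vs t) \<and> tsum (subset_sums vs t) f = tsum t (sublist_sums vs f)"
proof (induction vs arbitrary: t)
  case (Cons v vs)
  have v: "length v = n" using Cons.prems by simp
  have ar: "arity n (shift v t)" "arity n (add t (shift v t))"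
    using arity_shift(1)[OF v Cons.prems(1)] arity_add Cons.prems(1) by blast+
  have "sublist_sums (v # vs) f = (\<lambda>x. sublist_sums vs f x + sublist_sums vs f (map2 (+) v x))" by auto
  then have "tsum (add t (shift v t)) (sublist_sums vs f) = tsum t (sublist_sums (v # vs) f)"
    using tsum_add[OF Cons.prems(1) ar(1)] tsum_shift(1)[OF v Cons.prems(1)] by (simp add: tsum_plus)
  then show ?case using Cons.IH[OF ar(2)] Cons.prems(2) by (simp del: sublist_sums.simps)
next
  case Nil
  have "sublist_sums [] f = f" by (rule ext) simp
  then show ?case using Nil by (simp del: sublist_sums.simps)
qed

lemma monomial: "arity (length d) (monomial d) \<and> tsum (monomial d) f = f d"
  by (induction d arbitrary: f) (auto simp: tsum_prefix incr_funpow intro!: arity_prefix)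

fun tree_value :: "tree \<Rightarrow> nat" where
  "tree_value Z = 0" | "tree_value (K c) = numeral c" | "tree_value (X a p) = 0"

lemma arity_matches: "arity 0 (matches s t)"
  by (induction s t rule: matches.induct) (auto intro: arity_add)

lemma tree_value_add: "arity 0 s \<Longrightarrow> arity 0 t \<Longrightarrow> tree_value (add s t) = tree_value s + tree_value t"
  by (induction s t rule: add.induct) auto

lemma tree_value_matches:
  "arity n s \<Longrightarrow> arity n t \<Longrightarrow> tree_value (matches s t) = tsum s (\<lambda>x. tsum t (\<lambda>y. if x = y then 1 else 0))"
proof (induction s t arbitrary: n rule: matches.induct)
  case (7 a p b q)
  then have n: "n > 0" and ar: "arity (n - 1) a" "arity n p" "arity (n - 1) b" "arity n q" by auto
  have 1: "tsum q (\<lambda>y. if 0 # x = incr y then 1 else 0) = 0" for x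
  proof -
    have "tsum q (\<lambda>y. if 0 # x = incr y then 1 else 0) = tsum q (\<lambda>y. 0)"
    proof (rule tsum_cong[OF ar(4)])
      fix y :: "nat list" assume "length y = n"
      then show "(if 0 # x = incr y then 1 else 0 :: nat) = 0" by (cases y) simp_all
    qed
    then show ?thesis by (simp add: tsum_0)
  qed
  have 2: "tsum b (\<lambda>y. if incr x = 0 # y then 1 else 0) = 0" if "length x = n" for x
  proof -
    have "incr x \<noteq> 0 # y" for y by (cases x) auto
    then show ?thesis by (simp add: tsum_0)
  qed
  have 3: "tsum q (\<lambda>y. if incr x = incr y then 1 else 0) = tsum q (\<lambda>y. if x = y then 1 else 0)" if "length x = n" for x
  proof (rule tsum_cong[OF ar(4)])
    fix y :: "nat list" assume "length y = n"
    then show "(if incr x = incr y then 1 else 0 :: nat) = (if x = y then 1 else 0)"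
      using that n by (cases x; cases y) auto
  qed
  have "tsum p (\<lambda>x. tsum b (\<lambda>y. if incr x = 0 # y then 1 else 0) + tsum q (\<lambda>y. if incr x = incr y then 1 else 0)) =
      tsum p (\<lambda>x. tsum q (\<lambda>y. if x = y then 1 else 0))"
    by (rule tsum_cong[OF ar(2)]) (simp add: 2 3)
  then show ?case
    using "7.IH"(1)[OF ar(1,3)] "7.IH"(2)[OF ar(2,4)] by (simp add: tree_value_add arity_matches 1)
qed (auto simp: tsum_0)

abbreviation nvec :: "nat list \<Rightarrow> nat \<Rightarrow> int" where "nvec x \<equiv> vec_of (map int x)"

lemma nvec_add: "length v = length x \<Longrightarrow> nvec (map2 (+) v x) = (\<lambda>i. nvec v i + nvec x i)"
proof
  fix i assume l: "length v = length x"
  show "nvec (map2 (+) v x) i = nvec v i + nvec x i"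
    by (cases i) (use l in \<open>simp_all add: vec_of_Suc, simp_all add: vec_of_def\<close>)
qed

lemma nvec_inject: "nvec x = nvec y \<Longrightarrow> length x = length y \<Longrightarrow> x = y"
  using vec_of_inject[of "map int x" "map int y"] by (simp add: inj_map_eq_map)

text \<open>For distinct lists of equal length, sublists correspond to subsets of the vectors they
  encode.\<close>

lemma sublist_sums_sum:
  assumes "distinct vs" "\<And>v. v \<in> set vs \<Longrightarrow> length v = n" "length x = n"
    and "\<And>y. length y = n \<Longrightarrow> f y = G (nvec y)"
  shows "sublist_sums vs f x = (\<Sum>D\<in>Pow (nvec ` set vs). G (\<lambda>i. nvec x i + (\<Sum>k\<in>D. k i)))"
  using assms
proof (induction vs arbitrary: x)
  case (Cons v vs)
  let ?P = "nvec ` set vs"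
  have v: "length v = n" using Cons.prems by simp
  have nv: "nvec v \<notin> ?P"
  proof
    assume "nvec v \<in> ?P"
    then obtain u where "u \<in> set vs" "nvec v = nvec u" by blast
    then show False using nvec_inject[of v u] Cons.prems(1,2) by auto
  qed
  have disj: "Pow ?P \<inter> insert (nvec v) ` Pow ?P = {}" using nv by auto
  have inj: "inj_on (insert (nvec v)) (Pow ?P)"
    by (rule inj_on_inverseI[where g = "\<lambda>D. D - {nvec v}"]) (use nv in auto)
  have IH: "sublist_sums vs f y = (\<Sum>D\<in>Pow ?P. G (\<lambda>i. nvec y i + (\<Sum>k\<in>D. k i)))" if "length y = n" for y
    using Cons that by auto
  have "(\<Sum>D\<in>Pow (nvec ` set (v # vs)). G (\<lambda>i. nvec x i + (\<Sum>k\<in>D. k i))) =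
      (\<Sum>D\<in>Pow ?P. G (\<lambda>i. nvec x i + (\<Sum>k\<in>D. k i))) + (\<Sum>D\<in>Pow ?P. G (\<lambda>i. nvec x i + (\<Sum>k\<in>insert (nvec v) D. k i)))"
    by (simp add: Pow_insert sum.union_disjoint[OF _ _ disj] sum.reindex[OF inj])
  also have "(\<Sum>D\<in>Pow ?P. G (\<lambda>i. nvec x i + (\<Sum>k\<in>insert (nvec v) D. k i))) =
      (\<Sum>D\<in>Pow ?P. G (\<lambda>i. nvec (map2 (+) v x) i + (\<Sum>k\<in>D. k i)))"
  proof (rule sum.cong[OF refl])
    fix D assume "D \<in> Pow ?P"
    then have "finite D" "nvec v \<notin> D" using nv finite_subset[of D ?P] by auto
    then show "G (\<lambda>i. nvec x i + (\<Sum>k\<in>insert (nvec v) D. k i)) = G (\<lambda>i. nvec (map2 (+) v x) i + (\<Sum>k\<in>D. k i))"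
      using nvec_add[of v x] v Cons.prems(3) by (simp add: algebra_simps)
  qed
  finally show ?case using IH[of x] IH[of "map2 (+) v x"] v Cons.prems(3) by simp
qed simp

text \<open>A signing is recorded by its positive roots D in P1 and its negative roots E in P2. It
  has sum zero iff 2 sum D - sum P1 = 2 sum E - sum P2; the offsets a, b turn this into an equality
  of sums without subtraction.\<close>

lemma card_splittings_two_parts:
  fixes P1 P2 :: "(nat \<Rightarrow> int) set"
  assumes fin: "finite P1" "finite P2" "P1 \<inter> P2 = {}"
    and bal: "\<And>i. 2 * a i + (\<Sum>k\<in>P1. k i) = 2 * b i + (\<Sum>k\<in>P2. k i)"
  shows "card (zero_sum_splittings (P1 \<union> P2)) =
    card {(D, E). D \<subseteq> P1 \<and> E \<subseteq> P2 \<and> (\<lambda>i. a i + (\<Sum>k\<in>D. k i)) = (\<lambda>i. b i + (\<Sum>k\<in>E. k i))}"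
proof (rule bij_betw_same_card[of "\<lambda>D. (D \<inter> P1, P2 - D)"], rule bij_betwI[where g = "\<lambda>(D, E). D \<union> (P2 - E)"])
  have key: "D \<union> (P2 - E) \<in> zero_sum_splittings (P1 \<union> P2) \<longleftrightarrow>
      (\<lambda>i. a i + (\<Sum>k\<in>D. k i)) = (\<lambda>i. b i + (\<Sum>k\<in>E. k i))" if D: "D \<subseteq> P1" and E: "E \<subseteq> P2" for D E
  proof -
    have f: "finite D" "finite E" "finite (P1 - D)" "finite (P2 - E)" using finite_subset[OF D] finite_subset[OF E] fin by auto
    have e: "P1 \<union> P2 - (D \<union> (P2 - E)) = (P1 - D) \<union> E" using D E fin(3) by auto
    have d: "D \<inter> (P2 - E) = {}" "(P1 - D) \<inter> E = {}" using D E fin(3) by auto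
    have "(\<Sum>k\<in>D \<union> (P2 - E). k i) = (\<Sum>k\<in>(P1 - D) \<union> E. k i) \<longleftrightarrow> a i + (\<Sum>k\<in>D. k i) = b i + (\<Sum>k\<in>E. k i)" for i
    proof -
      have "(\<Sum>k\<in>P1. k i) = (\<Sum>k\<in>P1 - D. k i) + (\<Sum>k\<in>D. k i)" "(\<Sum>k\<in>P2. k i) = (\<Sum>k\<in>P2 - E. k i) + (\<Sum>k\<in>E. k i)"
        using sum.subset_diff[OF D fin(1)] sum.subset_diff[OF E fin(2)] by auto
      then show ?thesis
        unfolding sum.union_disjoint[OF f(1,4) d(1)] sum.union_disjoint[OF f(3,2) d(2)] using bal[of i] by linarith
    qed
    then show ?thesis unfolding zero_sum_splittings_def mem_Collect_eq e fun_eq_iff using D by auto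
  qed
  have inverse: "D \<inter> P1 \<union> (P2 - (P2 - D)) = D" if "D \<subseteq> P1 \<union> P2" for D using that fin(3) by auto
  show "(\<lambda>D. (D \<inter> P1, P2 - D)) \<in> zero_sum_splittings (P1 \<union> P2) \<rightarrow>
      {(D, E). D \<subseteq> P1 \<and> E \<subseteq> P2 \<and> (\<lambda>i. a i + (\<Sum>k\<in>D. k i)) = (\<lambda>i. b i + (\<Sum>k\<in>E. k i))}"
  proof
    fix D assume D: "D \<in> zero_sum_splittings (P1 \<union> P2)"
    then have "D \<subseteq> P1 \<union> P2" by (simp add: zero_sum_splittings_def)
    then show "(D \<inter> P1, P2 - D) \<in> {(D, E). D \<subseteq> P1 \<and> E \<subseteq> P2 \<and> (\<lambda>i. a i + (\<Sum>k\<in>D. k i)) = (\<lambda>i. b i + (\<Sum>k\<in>E. k i))}"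
      using key[of "D \<inter> P1" "P2 - D"] inverse D by auto
  qed
  show "(\<lambda>(D, E). D \<union> (P2 - E)) \<in> {(D, E). D \<subseteq> P1 \<and> E \<subseteq> P2 \<and> (\<lambda>i. a i + (\<Sum>k\<in>D. k i)) = (\<lambda>i. b i + (\<Sum>k\<in>E. k i))}
      \<rightarrow> zero_sum_splittings (P1 \<union> P2)"
    using key by auto
  show "(\<lambda>(D, E). D \<union> (P2 - E)) (D \<inter> P1, P2 - D) = D" if "D \<in> zero_sum_splittings (P1 \<union> P2)" for D
    using inverse[of D] that by (simp add: zero_sum_splittings_def)
  show "((\<lambda>(D, E). D \<union> (P2 - E)) y \<inter> P1, P2 - (\<lambda>(D, E). D \<union> (P2 - E)) y) = y"
    if "y \<in> {(D, E). D \<subseteq> P1 \<and> E \<subseteq> P2 \<and> (\<lambda>i. a i + (\<Sum>k\<in>D. k i)) = (\<lambda>i. b i + (\<Sum>k\<in>E. k i))}" for y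
    using that fin(3) by auto
qed

lemma sum_nvec:
  assumes "distinct vs" "\<And>v. v \<in> set vs \<Longrightarrow> length v = n"
  shows "(\<Sum>k\<in>nvec ` set vs. k i) = (\<Sum>v\<leftarrow>vs. nvec v i)"
proof -
  have "inj_on nvec (set vs)" using assms(2) nvec_inject by (intro inj_onI) metis
  then show ?thesis by (simp add: sum.reindex sum_list_distinct_conv_sum_set[OF assms(1)])
qed

definition vsum :: "nat list list \<Rightarrow> nat list \<Rightarrow> nat list" where
  "vsum vs d = fold (map2 (+)) vs d"

lemma nvec_vsum:
  "(\<And>v. v \<in> set vs \<Longrightarrow> length v = length d) \<Longrightarrow> nvec (vsum vs d) i = nvec d i + (\<Sum>v\<leftarrow>vs. nvec v i)"
proof (induction vs arbitrary: d)
  case (Cons v vs)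
  then have "nvec (vsum vs (map2 (+) v d)) i = nvec (map2 (+) v d) i + (\<Sum>v\<leftarrow>vs. nvec v i)" by simp
  then show ?case using Cons.prems nvec_add[of v d] by (simp add: vsum_def)
qed (simp add: vsum_def)

text \<open>Expanding each part separately avoids running through all signings. The offsets d and e
  become starting monomials, so all exponents stay natural numbers.\<close>

theorem card_splittings_matches:
  assumes P: "positive_roots A n = nvec ` set (vs @ ws)" and dist: "distinct (vs @ ws)"
    and len: "list_all (\<lambda>v. length v = n) (d # e # vs @ ws)"
    and bal: "vsum (d # d # vs) (replicate n 0) = vsum (e # e # ws) (replicate n 0)"
    and m: "matches (subset_sums vs (monomial d)) (subset_sums ws (monomial e)) = K c"
  shows "card (zero_sum_splittings (positive_roots A n)) = numeral c"
proof -
  let ?P1 = "nvec ` set vs" and ?P2 = "nvec ` set ws"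
  have l: "length d = n" "length e = n" "\<And>v. v \<in> set vs \<Longrightarrow> length v = n" "\<And>v. v \<in> set ws \<Longrightarrow> length v = n"
    using len by (auto simp: list_all_iff)
  have dd: "distinct vs" "distinct ws" "set vs \<inter> set ws = {}" using dist by auto
  have disj: "?P1 \<inter> ?P2 = {}"
  proof (rule ccontr)
    assume "?P1 \<inter> ?P2 \<noteq> {}"
    then obtain v w where "v \<in> set vs" "w \<in> set ws" "nvec v = nvec w" by blast
    then show False using nvec_inject[of v w] l(3,4) dd(3) by auto
  qed
  have z: "vec_of (replicate n 0) i = 0" for i
    by (cases i) (simp_all add: vec_of_Suc, simp add: vec_of_def)
  have b: "2 * nvec d i + (\<Sum>k\<in>?P1. k i) = 2 * nvec e i + (\<Sum>k\<in>?P2. k i)" for i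
  proof -
    have "nvec (vsum (d # d # vs) (replicate n 0)) i = 2 * nvec d i + (\<Sum>v\<leftarrow>vs. nvec v i)"
      by (subst nvec_vsum) (auto simp: l z)
    moreover have "nvec (vsum (e # e # ws) (replicate n 0)) i = 2 * nvec e i + (\<Sum>v\<leftarrow>ws. nvec v i)"
      by (subst nvec_vsum) (auto simp: l z)
    ultimately show ?thesis using bal sum_nvec[OF dd(1) l(3)] sum_nvec[OF dd(2) l(4)] by simp
  qed
  define F where "F u = (\<Sum>E\<in>Pow ?P2. if u = (\<lambda>i. nvec e i + (\<Sum>k\<in>E. k i)) then 1 else 0 :: nat)" for u
  have inner: "sublist_sums ws (\<lambda>y. if x = y then 1 else 0) e = F (nvec x)" if x: "length x = n" for x
  proof -
    have "sublist_sums ws (\<lambda>y. if x = y then 1 else 0) e =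
        (\<Sum>E\<in>Pow ?P2. (\<lambda>u. if nvec x = u then 1 else 0) (\<lambda>i. nvec e i + (\<Sum>k\<in>E. k i)))"
      using nvec_inject x by (intro sublist_sums_sum[OF dd(2) l(4) l(2)]) auto
    then show ?thesis by (simp add: F_def)
  qed
  have ar: "arity n (subset_sums vs (monomial d))" "arity n (subset_sums ws (monomial e))"
    using tsum_subset_sums[of n "monomial d" vs] tsum_subset_sums[of n "monomial e" ws] monomial[of d] monomial[of e] l by auto
  have ts: "tsum (subset_sums ws (monomial e)) g = sublist_sums ws g e" "tsum (subset_sums vs (monomial d)) g = sublist_sums vs g d" for g
    using tsum_subset_sums[of n "monomial d" vs] tsum_subset_sums[of n "monomial e" ws] monomial[of d] monomial[of e] l by auto
  have "numeral c = sublist_sums vs (\<lambda>x. sublist_sums ws (\<lambda>y. if x = y then 1 else 0) e) d"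
    using tree_value_matches[OF ar] m ts by simp
  also have "\<dots> = (\<Sum>D\<in>Pow ?P1. F (\<lambda>i. nvec d i + (\<Sum>k\<in>D. k i)))"
    by (rule sublist_sums_sum[OF dd(1) _ l(1)]) (simp_all only: l(3) inner)
  also have "\<dots> = (\<Sum>(D, E)\<in>Pow ?P1 \<times> Pow ?P2.
      if (\<lambda>i. nvec d i + (\<Sum>k\<in>D. k i)) = (\<lambda>i. nvec e i + (\<Sum>k\<in>E. k i)) then 1 else 0)"
    unfolding F_def by (rule sum.cartesian_product)
  also have "\<dots> = card {x \<in> Pow ?P1 \<times> Pow ?P2. case x of (D, E) \<Rightarrow>
      (\<lambda>i. nvec d i + (\<Sum>k\<in>D. k i)) = (\<lambda>i. nvec e i + (\<Sum>k\<in>E. k i))}"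
    unfolding case_prod_unfold by (simp flip: sum.inter_filter)
  also have "{x \<in> Pow ?P1 \<times> Pow ?P2. case x of (D, E) \<Rightarrow>
      (\<lambda>i. nvec d i + (\<Sum>k\<in>D. k i)) = (\<lambda>i. nvec e i + (\<Sum>k\<in>E. k i))} =
    {(D, E). D \<subseteq> ?P1 \<and> E \<subseteq> ?P2 \<and> (\<lambda>i. nvec d i + (\<Sum>k\<in>D. k i)) = (\<lambda>i. nvec e i + (\<Sum>k\<in>E. k i))}" by auto
  also have "card \<dots> = card (zero_sum_splittings (?P1 \<union> ?P2))"
    by (rule card_splittings_two_parts[symmetric, OF _ _ disj b]) simp_all
  finally show ?thesis unfolding P by (simp add: image_Un)
qed

text \<open>The literals 1 to 9 cover the nonzero exponents of the lists below, so evaluation never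
  passes through \<open>Suc\<close>.\<close>

lemma prefix_numeral:
  "prefix 1 t = X Z t" "prefix 2 t = X Z (prefix 1 t)" "prefix 3 t = X Z (prefix 2 t)"
  "prefix 4 t = X Z (prefix 3 t)" "prefix 5 t = X Z (prefix 4 t)" "prefix 6 t = X Z (prefix 5 t)"
  "prefix 7 t = X Z (prefix 6 t)" "prefix 8 t = X Z (prefix 7 t)" "prefix 9 t = X Z (prefix 8 t)"
  by (simp_all add: eval_nat_numeral)

lemmas tree_eval = add.simps prefix.simps(1) prefix_numeral shift.simps shift_coeffs.simps subset_sums.simps
  monomial.simps matches.simps add_num_simps mult_num_simps

fun triple :: "int list \<times> int list \<Rightarrow> int list list" where
  "triple (u, v) = [u, v, map2 (+) u v]"

text \<open>In each triple, u and v balance u + v. Every triple has two opposite signings, so each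
  contributes a factor 2.\<close>

lemma card_splittings_triples:
  assumes "distinct (concat (map triple ps))" and "\<And>u v. (u, v) \<in> set ps \<Longrightarrow> length u = n \<and> length v = n"
  shows "2 ^ length ps \<le> card (zero_sum_splittings (vec_of ` set (concat (map triple ps))))"
  using assms
proof (induction ps)
  case Nil
  then show ?case by (simp add: zero_sum_splittings_eq splittings_empty)
next
  case (Cons p ps)
  obtain u v where p: "p = (u, v)" by (cases p)
  let ?R = "set (concat (map triple ps))"
  have l: "length u = n" "length v = n" using Cons.prems(2) p by auto
  have lR: "length x = n" if "x \<in> ?R" for x
    using that Cons.prems(2) by fastforce
  have d: "u \<noteq> v" "map2 (+) u v \<noteq> u" "map2 (+) u v \<noteq> v" "set (triple p) \<inter> ?R = {}"
    using Cons.prems(1) p by auto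
  have IH: "2 ^ length ps \<le> card (zero_sum_splittings (vec_of ` ?R))"
    using Cons.prems by (intro Cons.IH) auto
  let ?T = "vec_of ` set (triple p)"
  have lT: "length x = n" if "x \<in> set (triple p)" for x
    using that l p by auto
  have "inj_on vec_of (set (triple p) \<union> ?R)"
  proof (rule inj_onI)
    fix x y assume "x \<in> set (triple p) \<union> ?R" "y \<in> set (triple p) \<union> ?R" "vec_of x = vec_of y"
    moreover then have "length x = n" "length y = n" using lR lT by blast+
    ultimately show "x = y" using vec_of_inject by simp
  qed
  then have disj: "vec_of ` ?R \<inter> ?T = {}"
    using d(4) by (auto simp: inj_on_def)
  have ne: "vec_of u \<noteq> vec_of v" "vec_of (map2 (+) u v) \<noteq> vec_of u" "vec_of (map2 (+) u v) \<noteq> vec_of v"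
    using vec_of_inject l d by auto
  have s: "vec_of (map2 (+) u v) i = vec_of u i + vec_of v i" for i
    by (cases i) (use l in \<open>simp_all add: vec_of_Suc, simp add: vec_of_def\<close>)
  have "?T - {vec_of u, vec_of v} = {vec_of (map2 (+) u v)}" using ne p by auto
  then have "{vec_of u, vec_of v} \<in> splittings (\<lambda>k. k) ?T"
    unfolding splittings_def using ne s p by auto
  then have "2 * card (splittings (\<lambda>k. k) (vec_of ` ?R)) \<le> card (splittings (\<lambda>k. k) (vec_of ` ?R \<union> ?T))"
    using disj p by (intro card_splittings_Un_double) auto
  moreover have "vec_of ` set (concat (map triple (p # ps))) = vec_of ` ?R \<union> ?T" by auto
  ultimately show ?case using IH by (simp add: zero_sum_splittings_eq)
qed

section \<open>Root lists and counts for the five exceptional types\<close>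

definition G2_roots :: "int list list" where
  "G2_roots = [
     [1, 0], [0, 1], [1, 1], [3, 1], [2, 1], [3, 2]]"

lemma G2_columns: "matrix_columns (cartan_matrix Type_G2) 2 = [
     [2, -3], [-1, 2]]"
  by (simp add: matrix_columns_def upt_rec e_matrix_def chain_matrix_def doubleton_eq_iff)

text \<open>Three levels suffice although the highest root has height 5, because one reflection adds
  3 to the first coordinate.\<close>

lemma G2_levels: "root_levels (matrix_columns (cartan_matrix Type_G2) 2) 3 (unit_lists 2) = Some G2_roots"
  unfolding G2_columns by code_simp

lemmas G2_positive_roots = positive_roots_root_levels[OF G2_levels]

definition G2_part1 :: "nat list list" where
  "G2_part1 = [
     [0, 1], [1, 0], [1, 1], [2, 1], [3, 1], [3, 2]]"

definition G2_part2 :: "nat list list" where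
  "G2_part2 = []"

text \<open>With an empty second part, [5, 3] is half the sum of the positive roots, and its
  coefficient in the full product is counted.\<close>

lemma G2_matches:
  "matches (subset_sums G2_part1 (monomial [0, 0])) (subset_sums G2_part2 (monomial [5, 3])) =
    K (num.Bit0 (num.Bit0 num.One))"
  unfolding G2_part1_def G2_part2_def by (simp only: tree_eval)

lemma G2_count: "card (zero_sum_splittings (positive_roots (cartan_matrix Type_G2) 2)) = 4"
proof (rule card_splittings_matches[OF _ _ _ _ G2_matches])
  have "list_all (\<lambda>l. List.member (map (map int) (G2_part1 @ G2_part2)) l) G2_roots"
    "list_all (\<lambda>l. List.member G2_roots (map int l)) (G2_part1 @ G2_part2)"
    by code_simp+
  then have "set G2_roots = map int ` set (G2_part1 @ G2_part2)"
    by (auto simp: list_all_iff)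
  then show "positive_roots (cartan_matrix Type_G2) 2 = nvec ` set (G2_part1 @ G2_part2)"
    unfolding G2_positive_roots(1) by (simp only: image_image)
qed code_simp+

definition F4_roots :: "int list list" where
  "F4_roots = [
     [1, 0, 0, 0], [0, 1, 0, 0], [0, 0, 1, 0], [0, 0, 0, 1], [1, 1, 0, 0], [0, 1, 2, 0], [0, 1, 1, 0],
     [0, 0, 1, 1], [1, 1, 2, 0], [0, 1, 2, 2], [1, 1, 1, 0], [0, 1, 1, 1], [1, 2, 2, 0], [1, 1, 2, 2],
     [1, 1, 1, 1], [0, 1, 2, 1], [1, 2, 2, 2], [1, 1, 2, 1], [1, 2, 4, 2], [1, 2, 2, 1], [1, 3, 4, 2],
     [1, 2, 3, 1], [2, 3, 4, 2], [1, 2, 3, 2]]"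

lemma F4_columns: "matrix_columns (cartan_matrix Type_F4) 4 = [
     [2, -1, 0, 0], [-1, 2, -1, 0], [0, -2, 2, -1], [0, 0, -1, 2]]"
  by (simp add: matrix_columns_def upt_rec e_matrix_def chain_matrix_def doubleton_eq_iff)

lemma F4_levels: "root_levels (matrix_columns (cartan_matrix Type_F4) 4) 8 (unit_lists 4) = Some F4_roots"
  unfolding F4_columns by code_simp

lemmas F4_positive_roots = positive_roots_root_levels[OF F4_levels]

definition F4_part1 :: "nat list list" where
  "F4_part1 = [
     [0, 0, 0, 1], [0, 0, 1, 0], [0, 0, 1, 1], [0, 1, 0, 0], [0, 1, 1, 0], [0, 1, 1, 1], [0, 1, 2, 1],
     [0, 1, 2, 0], [0, 1, 2, 2], [1, 0, 0, 0], [1, 1, 1, 0], [1, 1, 1, 1]]"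

definition F4_part2 :: "nat list list" where
  "F4_part2 = [
     [1, 1, 0, 0], [1, 1, 2, 0], [1, 1, 2, 1], [1, 1, 2, 2], [1, 2, 2, 0], [1, 2, 2, 1], [2, 3, 4, 2],
     [1, 2, 2, 2], [1, 2, 4, 2], [1, 3, 4, 2], [1, 2, 3, 1], [1, 2, 3, 2]]"

text \<open>The offset [5, 7, 9, 4] is half the difference of the sums of the two parts. The
  constant is 34432 in binary, least significant digit outermost.\<close>

lemma F4_matches:
  "matches (subset_sums F4_part1 (monomial [5, 7, 9, 4])) (subset_sums F4_part2 (monomial [0, 0, 0, 0])) =
    K (num.Bit0 (num.Bit0 (num.Bit0 (num.Bit0 (num.Bit0 (num.Bit0 (num.Bit0 (num.Bit1 (num.Bit0 (num.Bit1 (num.Bit1 (num.Bit0 (num.Bit0 (num.Bit0 (num.Bit0 num.One)))))))))))))))"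
  unfolding F4_part1_def F4_part2_def by (simp only: tree_eval)

lemma F4_count: "card (zero_sum_splittings (positive_roots (cartan_matrix Type_F4) 4)) = 34432"
proof (rule card_splittings_matches[OF _ _ _ _ F4_matches])
  have "list_all (\<lambda>l. List.member (map (map int) (F4_part1 @ F4_part2)) l) F4_roots"
    "list_all (\<lambda>l. List.member F4_roots (map int l)) (F4_part1 @ F4_part2)"
    by code_simp+
  then have "set F4_roots = map int ` set (F4_part1 @ F4_part2)"
    by (auto simp: list_all_iff)
  then show "positive_roots (cartan_matrix Type_F4) 4 = nvec ` set (F4_part1 @ F4_part2)"
    unfolding F4_positive_roots(1) by (simp only: image_image)
qed code_simp+

definition E6_roots :: "int list list" where
  "E6_roots = [
     [1, 0, 0, 0, 0, 0], [0, 1, 0, 0, 0, 0], [0, 0, 1, 0, 0, 0], [0, 0, 0, 1, 0, 0], [0, 0, 0, 0, 1, 0],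
     [0, 0, 0, 0, 0, 1], [1, 0, 1, 0, 0, 0], [0, 1, 0, 1, 0, 0], [0, 0, 1, 1, 0, 0], [0, 0, 0, 1, 1, 0],
     [0, 0, 0, 0, 1, 1], [1, 0, 1, 1, 0, 0], [0, 1, 1, 1, 0, 0], [0, 1, 0, 1, 1, 0], [0, 0, 1, 1, 1, 0],
     [0, 0, 0, 1, 1, 1], [1, 1, 1, 1, 0, 0], [1, 0, 1, 1, 1, 0], [0, 1, 1, 1, 1, 0], [0, 1, 0, 1, 1, 1],
     [0, 0, 1, 1, 1, 1], [1, 1, 1, 1, 1, 0], [0, 1, 1, 2, 1, 0], [1, 0, 1, 1, 1, 1], [0, 1, 1, 1, 1, 1],
     [1, 1, 1, 2, 1, 0], [1, 1, 1, 1, 1, 1], [0, 1, 1, 2, 1, 1], [1, 1, 2, 2, 1, 0], [1, 1, 1, 2, 1, 1],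
     [0, 1, 1, 2, 2, 1], [1, 1, 2, 2, 1, 1], [1, 1, 1, 2, 2, 1], [1, 1, 2, 2, 2, 1], [1, 1, 2, 3, 2, 1],
     [1, 2, 2, 3, 2, 1]]"

lemma E6_columns: "matrix_columns (cartan_matrix Type_E6) 6 = [
     [2, 0, -1, 0, 0, 0], [0, 2, 0, -1, 0, 0], [-1, 0, 2, -1, 0, 0], [0, -1, -1, 2, -1, 0],
     [0, 0, 0, -1, 2, -1], [0, 0, 0, 0, -1, 2]]"
  by (simp add: matrix_columns_def upt_rec e_matrix_def chain_matrix_def doubleton_eq_iff)

text \<open>In a simply laced type each raising step adds 1 to the height, so the number of levels
  is the height of the highest root: 11 here, 17 for E7 and 29 for E8.\<close>

lemma E6_levels: "root_levels (matrix_columns (cartan_matrix Type_E6) 6) 11 (unit_lists 6) = Some E6_roots"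
  unfolding E6_columns by code_simp

lemmas E6_positive_roots = positive_roots_root_levels[OF E6_levels]

text \<open>The 20 positive roots with first coefficient 0, a system of type D5; the 16 roots of the
  other part have first coefficient 1.\<close>

definition E6_part1 :: "nat list list" where
  "E6_part1 = [
     [0, 0, 0, 0, 0, 1], [0, 0, 0, 0, 1, 0], [0, 0, 0, 0, 1, 1], [0, 0, 0, 1, 0, 0], [0, 0, 0, 1, 1, 0],
     [0, 0, 0, 1, 1, 1], [0, 0, 1, 0, 0, 0], [0, 0, 1, 1, 0, 0], [0, 0, 1, 1, 1, 0], [0, 0, 1, 1, 1, 1],
     [0, 1, 0, 0, 0, 0], [0, 1, 0, 1, 0, 0], [0, 1, 0, 1, 1, 0], [0, 1, 0, 1, 1, 1], [0, 1, 1, 1, 0, 0],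
     [0, 1, 1, 1, 1, 0], [0, 1, 1, 2, 1, 0], [0, 1, 1, 1, 1, 1], [0, 1, 1, 2, 1, 1], [0, 1, 1, 2, 2, 1]]"

definition E6_part2 :: "nat list list" where
  "E6_part2 = [
     [1, 0, 0, 0, 0, 0], [1, 0, 1, 0, 0, 0], [1, 0, 1, 1, 0, 0], [1, 0, 1, 1, 1, 0], [1, 0, 1, 1, 1, 1],
     [1, 1, 1, 1, 0, 0], [1, 1, 1, 1, 1, 0], [1, 1, 1, 1, 1, 1], [1, 1, 1, 2, 1, 0], [1, 1, 1, 2, 1, 1],
     [1, 1, 1, 2, 2, 1], [1, 1, 2, 2, 1, 0], [1, 1, 2, 2, 1, 1], [1, 1, 2, 2, 2, 1], [1, 1, 2, 3, 2, 1],
     [1, 2, 2, 3, 2, 1]]"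

text \<open>The offset is half the difference of the sums of the two parts. Its first entry 8 forces
  exactly half of the 16 roots of the second part into E.\<close>

lemma E6_matches:
  "matches (subset_sums E6_part1 (monomial [8, 1, 5, 3, 1, 0])) (subset_sums E6_part2 (monomial [0, 0, 0, 0, 0, 0])) =
    K (num.Bit0 (num.Bit0 (num.Bit0 (num.Bit0 (num.Bit0 (num.Bit0 (num.Bit0 (num.Bit1 (num.Bit1 (num.Bit1 (num.Bit0 (num.Bit0 (num.Bit0 (num.Bit0 (num.Bit0 (num.Bit0 (num.Bit1 (num.Bit0 (num.Bit0 (num.Bit0 (num.Bit1 (num.Bit0 (num.Bit1 num.One)))))))))))))))))))))))"
  unfolding E6_part1_def E6_part2_def by (simp only: tree_eval)

lemma E6_count: "card (zero_sum_splittings (positive_roots (cartan_matrix Type_E6) 6)) = 13697920"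
proof (rule card_splittings_matches[OF _ _ _ _ E6_matches])
  have "list_all (\<lambda>l. List.member (map (map int) (E6_part1 @ E6_part2)) l) E6_roots"
    "list_all (\<lambda>l. List.member E6_roots (map int l)) (E6_part1 @ E6_part2)"
    by code_simp+
  then have "set E6_roots = map int ` set (E6_part1 @ E6_part2)"
    by (auto simp: list_all_iff)
  then show "positive_roots (cartan_matrix Type_E6) 6 = nvec ` set (E6_part1 @ E6_part2)"
    unfolding E6_positive_roots(1) by (simp only: image_image)
qed code_simp+

definition E7_roots :: "int list list" where
  "E7_roots = [
     [1, 0, 0, 0, 0, 0, 0], [0, 1, 0, 0, 0, 0, 0], [0, 0, 1, 0, 0, 0, 0], [0, 0, 0, 1, 0, 0, 0],
     [0, 0, 0, 0, 1, 0, 0], [0, 0, 0, 0, 0, 1, 0], [0, 0, 0, 0, 0, 0, 1], [1, 0, 1, 0, 0, 0, 0],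
     [0, 1, 0, 1, 0, 0, 0], [0, 0, 1, 1, 0, 0, 0], [0, 0, 0, 1, 1, 0, 0], [0, 0, 0, 0, 1, 1, 0],
     [0, 0, 0, 0, 0, 1, 1], [1, 0, 1, 1, 0, 0, 0], [0, 1, 1, 1, 0, 0, 0], [0, 1, 0, 1, 1, 0, 0],
     [0, 0, 1, 1, 1, 0, 0], [0, 0, 0, 1, 1, 1, 0], [0, 0, 0, 0, 1, 1, 1], [1, 1, 1, 1, 0, 0, 0],
     [1, 0, 1, 1, 1, 0, 0], [0, 1, 1, 1, 1, 0, 0], [0, 1, 0, 1, 1, 1, 0], [0, 0, 1, 1, 1, 1, 0],
     [0, 0, 0, 1, 1, 1, 1], [1, 1, 1, 1, 1, 0, 0], [0, 1, 1, 2, 1, 0, 0], [1, 0, 1, 1, 1, 1, 0],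
     [0, 1, 1, 1, 1, 1, 0], [0, 1, 0, 1, 1, 1, 1], [0, 0, 1, 1, 1, 1, 1], [1, 1, 1, 2, 1, 0, 0],
     [1, 1, 1, 1, 1, 1, 0], [0, 1, 1, 2, 1, 1, 0], [1, 0, 1, 1, 1, 1, 1], [0, 1, 1, 1, 1, 1, 1],
     [1, 1, 2, 2, 1, 0, 0], [1, 1, 1, 2, 1, 1, 0], [0, 1, 1, 2, 2, 1, 0], [1, 1, 1, 1, 1, 1, 1],
     [0, 1, 1, 2, 1, 1, 1], [1, 1, 2, 2, 1, 1, 0], [1, 1, 1, 2, 2, 1, 0], [1, 1, 1, 2, 1, 1, 1],
     [0, 1, 1, 2, 2, 1, 1], [1, 1, 2, 2, 2, 1, 0], [1, 1, 2, 2, 1, 1, 1], [1, 1, 1, 2, 2, 1, 1],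
     [0, 1, 1, 2, 2, 2, 1], [1, 1, 2, 3, 2, 1, 0], [1, 1, 2, 2, 2, 1, 1], [1, 1, 1, 2, 2, 2, 1],
     [1, 2, 2, 3, 2, 1, 0], [1, 1, 2, 3, 2, 1, 1], [1, 1, 2, 2, 2, 2, 1], [1, 2, 2, 3, 2, 1, 1],
     [1, 1, 2, 3, 2, 2, 1], [1, 2, 2, 3, 2, 2, 1], [1, 1, 2, 3, 3, 2, 1], [1, 2, 2, 3, 3, 2, 1],
     [1, 2, 2, 4, 3, 2, 1], [1, 2, 3, 4, 3, 2, 1], [2, 2, 3, 4, 3, 2, 1]]"

lemma E7_columns: "matrix_columns (cartan_matrix Type_E7) 7 = [
     [2, 0, -1, 0, 0, 0, 0], [0, 2, 0, -1, 0, 0, 0], [-1, 0, 2, -1, 0, 0, 0], [0, -1, -1, 2, -1, 0, 0],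
     [0, 0, 0, -1, 2, -1, 0], [0, 0, 0, 0, -1, 2, -1], [0, 0, 0, 0, 0, -1, 2]]"
  by (simp add: matrix_columns_def upt_rec e_matrix_def chain_matrix_def doubleton_eq_iff)

lemma E7_levels: "root_levels (matrix_columns (cartan_matrix Type_E7) 7) 17 (unit_lists 7) = Some E7_roots"
  unfolding E7_columns by code_simp

lemmas E7_positive_roots = positive_roots_root_levels[OF E7_levels]

text \<open>The sum of the positive roots has the odd coefficient 49 at the second simple
  root.\<close>

lemma E7_parity: "zero_sum_splittings (positive_roots (cartan_matrix Type_E7) 7) = {}"
  unfolding zero_sum_splittings_eq
proof (rule splittings_parity[where f = "\<lambda>k. k 2"])
  have "distinct E7_roots" by code_simp
  moreover have "inj_on vec_of (set E7_roots)"
    using vec_of_inject E7_positive_roots(2) by (intro inj_onI) metis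
  ultimately have "(\<Sum>k\<in>positive_roots (cartan_matrix Type_E7) 7. k 2) = (\<Sum>l\<leftarrow>E7_roots. vec_of l 2)"
    unfolding E7_positive_roots(1) by (simp add: sum.reindex sum_list_distinct_conv_sum_set)
  also have "\<dots> = 49" by (simp add: E7_roots_def vec_of_def)
  finally show "odd (\<Sum>k\<in>positive_roots (cartan_matrix Type_E7) 7. k 2)" by simp
  show "finite (positive_roots (cartan_matrix Type_E7) 7)" unfolding E7_positive_roots(1) by simp
qed (auto simp: splittings_def)

definition E8_roots :: "int list list" where
  "E8_roots = [
     [1, 0, 0, 0, 0, 0, 0, 0], [0, 1, 0, 0, 0, 0, 0, 0], [0, 0, 1, 0, 0, 0, 0, 0], [0, 0, 0, 1, 0, 0, 0, 0],
     [0, 0, 0, 0, 1, 0, 0, 0], [0, 0, 0, 0, 0, 1, 0, 0], [0, 0, 0, 0, 0, 0, 1, 0], [0, 0, 0, 0, 0, 0, 0, 1],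
     [1, 0, 1, 0, 0, 0, 0, 0], [0, 1, 0, 1, 0, 0, 0, 0], [0, 0, 1, 1, 0, 0, 0, 0], [0, 0, 0, 1, 1, 0, 0, 0],
     [0, 0, 0, 0, 1, 1, 0, 0], [0, 0, 0, 0, 0, 1, 1, 0], [0, 0, 0, 0, 0, 0, 1, 1], [1, 0, 1, 1, 0, 0, 0, 0],
     [0, 1, 1, 1, 0, 0, 0, 0], [0, 1, 0, 1, 1, 0, 0, 0], [0, 0, 1, 1, 1, 0, 0, 0], [0, 0, 0, 1, 1, 1, 0, 0],
     [0, 0, 0, 0, 1, 1, 1, 0], [0, 0, 0, 0, 0, 1, 1, 1], [1, 1, 1, 1, 0, 0, 0, 0], [1, 0, 1, 1, 1, 0, 0, 0],
     [0, 1, 1, 1, 1, 0, 0, 0], [0, 1, 0, 1, 1, 1, 0, 0], [0, 0, 1, 1, 1, 1, 0, 0], [0, 0, 0, 1, 1, 1, 1, 0],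
     [0, 0, 0, 0, 1, 1, 1, 1], [1, 1, 1, 1, 1, 0, 0, 0], [0, 1, 1, 2, 1, 0, 0, 0], [1, 0, 1, 1, 1, 1, 0, 0],
     [0, 1, 1, 1, 1, 1, 0, 0], [0, 1, 0, 1, 1, 1, 1, 0], [0, 0, 1, 1, 1, 1, 1, 0], [0, 0, 0, 1, 1, 1, 1, 1],
     [1, 1, 1, 2, 1, 0, 0, 0], [1, 1, 1, 1, 1, 1, 0, 0], [0, 1, 1, 2, 1, 1, 0, 0], [1, 0, 1, 1, 1, 1, 1, 0],
     [0, 1, 1, 1, 1, 1, 1, 0], [0, 1, 0, 1, 1, 1, 1, 1], [0, 0, 1, 1, 1, 1, 1, 1], [1, 1, 2, 2, 1, 0, 0, 0],
     [1, 1, 1, 2, 1, 1, 0, 0], [0, 1, 1, 2, 2, 1, 0, 0], [1, 1, 1, 1, 1, 1, 1, 0], [0, 1, 1, 2, 1, 1, 1, 0],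
     [1, 0, 1, 1, 1, 1, 1, 1], [0, 1, 1, 1, 1, 1, 1, 1], [1, 1, 2, 2, 1, 1, 0, 0], [1, 1, 1, 2, 2, 1, 0, 0],
     [1, 1, 1, 2, 1, 1, 1, 0], [0, 1, 1, 2, 2, 1, 1, 0], [1, 1, 1, 1, 1, 1, 1, 1], [0, 1, 1, 2, 1, 1, 1, 1],
     [1, 1, 2, 2, 2, 1, 0, 0], [1, 1, 2, 2, 1, 1, 1, 0], [1, 1, 1, 2, 2, 1, 1, 0], [0, 1, 1, 2, 2, 2, 1, 0],
     [1, 1, 1, 2, 1, 1, 1, 1], [0, 1, 1, 2, 2, 1, 1, 1], [1, 1, 2, 3, 2, 1, 0, 0], [1, 1, 2, 2, 2, 1, 1, 0],
     [1, 1, 1, 2, 2, 2, 1, 0], [1, 1, 2, 2, 1, 1, 1, 1], [1, 1, 1, 2, 2, 1, 1, 1], [0, 1, 1, 2, 2, 2, 1, 1],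
     [1, 2, 2, 3, 2, 1, 0, 0], [1, 1, 2, 3, 2, 1, 1, 0], [1, 1, 2, 2, 2, 2, 1, 0], [1, 1, 2, 2, 2, 1, 1, 1],
     [1, 1, 1, 2, 2, 2, 1, 1], [0, 1, 1, 2, 2, 2, 2, 1], [1, 2, 2, 3, 2, 1, 1, 0], [1, 1, 2, 3, 2, 2, 1, 0],
     [1, 1, 2, 3, 2, 1, 1, 1], [1, 1, 2, 2, 2, 2, 1, 1], [1, 1, 1, 2, 2, 2, 2, 1], [1, 2, 2, 3, 2, 2, 1, 0],
     [1, 1, 2, 3, 3, 2, 1, 0], [1, 2, 2, 3, 2, 1, 1, 1], [1, 1, 2, 3, 2, 2, 1, 1], [1, 1, 2, 2, 2, 2, 2, 1],
     [1, 2, 2, 3, 3, 2, 1, 0], [1, 2, 2, 3, 2, 2, 1, 1], [1, 1, 2, 3, 3, 2, 1, 1], [1, 1, 2, 3, 2, 2, 2, 1],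
     [1, 2, 2, 4, 3, 2, 1, 0], [1, 2, 2, 3, 3, 2, 1, 1], [1, 2, 2, 3, 2, 2, 2, 1], [1, 1, 2, 3, 3, 2, 2, 1],
     [1, 2, 3, 4, 3, 2, 1, 0], [1, 2, 2, 4, 3, 2, 1, 1], [1, 2, 2, 3, 3, 2, 2, 1], [1, 1, 2, 3, 3, 3, 2, 1],
     [2, 2, 3, 4, 3, 2, 1, 0], [1, 2, 3, 4, 3, 2, 1, 1], [1, 2, 2, 4, 3, 2, 2, 1], [1, 2, 2, 3, 3, 3, 2, 1],
     [2, 2, 3, 4, 3, 2, 1, 1], [1, 2, 3, 4, 3, 2, 2, 1], [1, 2, 2, 4, 3, 3, 2, 1], [2, 2, 3, 4, 3, 2, 2, 1],
     [1, 2, 3, 4, 3, 3, 2, 1], [1, 2, 2, 4, 4, 3, 2, 1], [2, 2, 3, 4, 3, 3, 2, 1], [1, 2, 3, 4, 4, 3, 2, 1],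
     [2, 2, 3, 4, 4, 3, 2, 1], [1, 2, 3, 5, 4, 3, 2, 1], [2, 2, 3, 5, 4, 3, 2, 1], [1, 3, 3, 5, 4, 3, 2, 1],
     [2, 2, 4, 5, 4, 3, 2, 1], [2, 3, 3, 5, 4, 3, 2, 1], [2, 3, 4, 5, 4, 3, 2, 1], [2, 3, 4, 6, 4, 3, 2, 1],
     [2, 3, 4, 6, 5, 3, 2, 1], [2, 3, 4, 6, 5, 4, 2, 1], [2, 3, 4, 6, 5, 4, 3, 1], [2, 3, 4, 6, 5, 4, 3, 2]]"

lemma E8_columns: "matrix_columns (cartan_matrix Type_E8) 8 = [
     [2, 0, -1, 0, 0, 0, 0, 0], [0, 2, 0, -1, 0, 0, 0, 0], [-1, 0, 2, -1, 0, 0, 0, 0],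
     [0, -1, -1, 2, -1, 0, 0, 0], [0, 0, 0, -1, 2, -1, 0, 0], [0, 0, 0, 0, -1, 2, -1, 0],
     [0, 0, 0, 0, 0, -1, 2, -1], [0, 0, 0, 0, 0, 0, -1, 2]]"
  by (simp add: matrix_columns_def upt_rec e_matrix_def chain_matrix_def doubleton_eq_iff)

lemma E8_levels: "root_levels (matrix_columns (cartan_matrix Type_E8) 8) 29 (unit_lists 8) = Some E8_roots"
  unfolding E8_columns by code_simp

lemmas E8_positive_roots = positive_roots_root_levels[OF E8_levels]

text \<open>The orbits of the tenth power of a Coxeter element, which has order 3 and no eigenvalue 1, split the
  roots into triples with sum zero; up to sign each triple is \<open>u, v, u + v\<close>.\<close>

definition E8_triples :: "(int list \<times> int list) list" where
  "E8_triples = [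
     ([1, 0, 0, 0, 0, 0, 0, 0], [0, 1, 1, 2, 1, 1, 1, 0]),
     ([0, 1, 0, 0, 0, 0, 0, 0], [1, 1, 2, 3, 2, 2, 1, 1]),
     ([0, 0, 1, 0, 0, 0, 0, 0], [1, 1, 1, 2, 2, 1, 1, 1]),
     ([0, 0, 0, 1, 0, 0, 0, 0], [1, 1, 1, 1, 1, 1, 1, 1]),
     ([0, 0, 0, 0, 1, 0, 0, 0], [0, 0, 1, 1, 0, 0, 0, 0]),
     ([0, 0, 0, 0, 0, 1, 0, 0], [0, 1, 0, 1, 1, 0, 0, 0]),
     ([0, 0, 0, 0, 0, 0, 1, 0], [1, 0, 1, 1, 1, 1, 0, 0]),
     ([0, 0, 0, 0, 0, 0, 0, 1], [0, 1, 1, 1, 1, 1, 1, 0]),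
     ([1, 0, 1, 0, 0, 0, 0, 0], [1, 2, 2, 4, 3, 2, 2, 1]),
     ([0, 1, 0, 1, 0, 0, 0, 0], [0, 0, 1, 1, 1, 1, 0, 0]),
     ([0, 0, 0, 1, 1, 0, 0, 0], [1, 1, 2, 2, 1, 1, 1, 1]),
     ([0, 0, 0, 0, 1, 1, 0, 0], [0, 1, 1, 2, 1, 0, 0, 0]),
     ([0, 0, 0, 0, 0, 1, 1, 0], [1, 1, 1, 2, 2, 1, 0, 0]),
     ([0, 0, 0, 0, 0, 0, 1, 1], [1, 1, 2, 2, 2, 2, 1, 0]),
     ([1, 0, 1, 1, 0, 0, 0, 0], [0, 1, 1, 2, 2, 1, 1, 0]),
     ([0, 1, 1, 1, 0, 0, 0, 0], [1, 1, 2, 3, 3, 2, 1, 1]),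
     ([0, 0, 0, 1, 1, 1, 0, 0], [1, 2, 2, 3, 2, 1, 1, 1]),
     ([0, 0, 0, 0, 1, 1, 1, 0], [1, 1, 2, 3, 2, 1, 0, 0]),
     ([0, 0, 0, 0, 0, 1, 1, 1], [1, 2, 2, 3, 3, 2, 1, 0]),
     ([1, 1, 1, 1, 0, 0, 0, 0], [1, 2, 3, 5, 4, 3, 2, 1]),
     ([1, 0, 1, 1, 1, 0, 0, 0], [0, 1, 0, 1, 1, 1, 1, 0]),
     ([0, 1, 1, 1, 1, 0, 0, 0], [1, 1, 1, 2, 2, 2, 1, 1]),
     ([0, 0, 0, 1, 1, 1, 1, 0], [2, 2, 3, 4, 3, 2, 1, 1]),
     ([0, 0, 0, 0, 1, 1, 1, 1], [1, 2, 3, 4, 3, 2, 1, 0]),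
     ([1, 1, 1, 1, 1, 0, 0, 0], [1, 2, 2, 4, 3, 3, 2, 1]),
     ([0, 1, 1, 1, 1, 1, 0, 0], [1, 0, 1, 1, 1, 1, 1, 1]),
     ([0, 0, 1, 1, 1, 1, 1, 0], [1, 1, 1, 2, 1, 1, 0, 0]),
     ([0, 0, 0, 1, 1, 1, 1, 1], [2, 3, 4, 5, 4, 3, 2, 1]),
     ([1, 1, 1, 2, 1, 0, 0, 0], [0, 1, 1, 2, 2, 2, 1, 0]),
     ([1, 1, 1, 1, 1, 1, 0, 0], [1, 1, 2, 3, 2, 2, 2, 1]),
     ([0, 1, 0, 1, 1, 1, 1, 1], [1, 1, 2, 2, 2, 1, 1, 0]),
     ([0, 0, 1, 1, 1, 1, 1, 1], [1, 2, 2, 3, 2, 2, 1, 0]),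
     ([1, 1, 2, 2, 1, 0, 0, 0], [1, 2, 2, 4, 4, 3, 2, 1]),
     ([1, 1, 1, 1, 1, 1, 1, 0], [0, 1, 1, 2, 1, 1, 1, 1]),
     ([1, 1, 2, 2, 1, 1, 0, 0], [1, 1, 2, 3, 3, 2, 2, 1]),
     ([1, 1, 2, 2, 2, 1, 0, 0], [1, 1, 1, 2, 2, 2, 2, 1]),
     ([1, 1, 2, 2, 1, 1, 1, 0], [0, 1, 1, 2, 2, 1, 1, 1]),
     ([0, 1, 1, 2, 2, 2, 1, 1], [1, 2, 2, 3, 2, 1, 1, 0]),
     ([1, 2, 2, 3, 2, 1, 0, 0], [1, 1, 2, 3, 3, 3, 2, 1]),
     ([0, 1, 1, 2, 2, 2, 2, 1], [2, 2, 3, 4, 3, 2, 1, 0])]"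

text \<open>The triples use each of the 120 positive roots exactly once, so there are 40 of them and
  at least \<open>2^40\<close> splittings.\<close>

lemma E8_lower_bound: "card (zero_sum_splittings (positive_roots (cartan_matrix Type_E8) 8)) \<ge> 369600"
proof -
  let ?M = "concat (map triple E8_triples)"
  have "list_all (\<lambda>l. List.member ?M l) E8_roots" "list_all (\<lambda>l. List.member E8_roots l) ?M"
    by code_simp+
  then have "set E8_roots = set ?M" by (auto simp: list_all_iff)
  then have P: "positive_roots (cartan_matrix Type_E8) 8 = vec_of ` set ?M" unfolding E8_positive_roots(1) by simp
  have "2 ^ length E8_triples \<le> card (zero_sum_splittings (vec_of ` set ?M))"
  proof (rule card_splittings_triples)
    show "distinct ?M" by code_simp
    have "list_all (\<lambda>(u, v). length u = 8 \<and> length v = 8) E8_triples" by code_simp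
    then show "length u = 8 \<and> length v = 8" if "(u, v) \<in> set E8_triples" for u v
      using that by (auto simp: list_all_iff)
  qed
  moreover have "length E8_triples = 40" by code_simp
  ultimately show ?thesis unfolding P by simp
qed

section \<open>The main theorem\<close>

theorem theorem6:
  fixes br :: "complex ^ 'n::finite \<Rightarrow> complex ^ 'n \<Rightarrow> complex ^ 'n"
    and g h :: "(complex ^ 'n) set"
    and c :: "complex ^ 'n \<Rightarrow> complex ^ 's::finite \<Rightarrow> complex ^ 's"
  assumes "complex_simple_lie_algebra br"
    and "compact_real_form br g"
    and "maximal_torus_algebra br g h"
    and "spinor_module br g h c"
  shows
    "(\<forall>n\<ge>1. has_cartan_type br (vec.span h) (Type_A n) \<longrightarrow>
        (admits_invariant_spinors br g h c \<longleftrightarrow> even n) \<and>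
        (even n \<longrightarrow> vec.dim (invariant_spinors br g h c) \<ge> 2 ^ (n div 2))) \<and>
     (\<forall>n\<ge>2. has_cartan_type br (vec.span h) (Type_B n) \<longrightarrow>
        \<not> admits_invariant_spinors br g h c) \<and>
     (\<forall>n\<ge>3. has_cartan_type br (vec.span h) (Type_C n) \<longrightarrow>
        (admits_invariant_spinors br g h c \<longleftrightarrow> n mod 4 = 0 \<or> n mod 4 = 3) \<and>
        (n mod 4 = 0 \<or> n mod 4 = 3 \<longrightarrow>
           vec.dim (invariant_spinors br g h c) \<ge> 2 ^ ((n + 1) div 4))) \<and>
     (\<forall>n\<ge>4. has_cartan_type br (vec.span h) (Type_D n) \<longrightarrow>
        (admits_invariant_spinors br g h c \<longleftrightarrow> n mod 4 = 0 \<or> n mod 4 = 1) \<and>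
        (n mod 4 = 0 \<or> n mod 4 = 1 \<longrightarrow>
           vec.dim (invariant_spinors br g h c) \<ge> 2 ^ ((n + 1) div 4))) \<and>
     (has_cartan_type br (vec.span h) Type_E6 \<longrightarrow>
        admits_invariant_spinors br g h c \<and>
        vec.dim (invariant_spinors br g h c) = 13697920) \<and>
     (has_cartan_type br (vec.span h) Type_E7 \<longrightarrow>
        \<not> admits_invariant_spinors br g h c) \<and>
     (has_cartan_type br (vec.span h) Type_E8 \<longrightarrow>
        admits_invariant_spinors br g h c \<and>
        vec.dim (invariant_spinors br g h c) \<ge> 369600) \<and>
     (has_cartan_type br (vec.span h) Type_F4 \<longrightarrow>
        admits_invariant_spinors br g h c \<and>
        vec.dim (invariant_spinors br g h c) = 34432) \<and>
     (has_cartan_type br (vec.span h) Type_G2 \<longrightarrow>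
        vec.dim (invariant_spinors br g h c) = 4)"
proof -
  note dim = dim_invariant_spinors_cartan_type(1)[OF assms]
    and admits = dim_invariant_spinors_cartan_type(2)[OF assms]
  let ?d = "vec.dim (invariant_spinors br g h c)" and ?a = "admits_invariant_spinors br g h c"
    and ?type = "has_cartan_type br (vec.span h)"
  have A: "(?a \<longleftrightarrow> even n) \<and> (even n \<longrightarrow> ?d \<ge> 2 ^ (n div 2))" if "?type (Type_A n)" for n
  proof -
    have d: "?d = card (splittings diff_root (pairs_below (Suc n)))"
      unfolding dim[OF that] cartan_rank.simps by (rule type_A_splittings)
    show ?thesis
    proof (cases "even n")
      case True
      then obtain m where m: "n = 2 * m" by blast
      have b: "?d \<ge> 2 ^ m"
        using type_A_lower_bound[of m] unfolding d m by simp
      then have "?d \<noteq> 0" by (metis le_zero_eq power_not_zero zero_neq_numeral)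
      then show ?thesis using b True m unfolding admits[OF that] by simp
    next
      case False
      then show ?thesis
        using type_A_parity[of n] unfolding admits[OF that] d by simp
    qed
  qed
  have B: "\<not> ?a" if "n \<ge> 2" "?type (Type_B n)" for n
    using type_B_parity[of n] that type_B_splittings[of n] dim[OF that(2)] unfolding admits[OF that(2)] by simp
  have C: "(?a \<longleftrightarrow> n mod 4 = 0 \<or> n mod 4 = 3) \<and> (n mod 4 = 0 \<or> n mod 4 = 3 \<longrightarrow> ?d \<ge> 2 ^ ((n + 1) div 4))"
    if n: "n \<ge> 3" and t: "?type (Type_C n)" for n
  proof -
    have d: "?d = card (splittings (signed_root 2) (type_C_indices n))"
      unfolding dim[OF t] cartan_rank.simps using n by (intro type_C_splittings) simp
    show ?thesis
    proof (cases "n mod 4 = 0 \<or> n mod 4 = 3")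
      case True
      define q where "q = n div 4"
      \<comment> \<open>The exponent is q in the first residue class and q + 1 in the second, as
        rank 3 already contributes a factor 2.\<close>
      have "n = 4 * q \<and> (n + 1) div 4 = q \<or> n = 4 * q + 3 \<and> (n + 1) div 4 = q + 1"
        using True unfolding q_def by presburger
      then have b: "2 ^ ((n + 1) div 4) \<le> ?d"
        unfolding d using type_C_lower_bound_0[of q] type_C_lower_bound_3[of q] by (elim disjE conjE) simp_all
      then have "?d \<noteq> 0" by (metis le_zero_eq power_not_zero zero_neq_numeral)
      then show ?thesis using True b unfolding admits[OF t] by blast
    next
      case False
      then have "n mod 4 = 1 \<or> n mod 4 = 2" using mod_less_divisor[of 4 n] by linarith
      then show ?thesis using False type_C_parity[of n] unfolding admits[OF t] d by simp
    qed
  qed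
  have D: "(?a \<longleftrightarrow> n mod 4 = 0 \<or> n mod 4 = 1) \<and> (n mod 4 = 0 \<or> n mod 4 = 1 \<longrightarrow> ?d \<ge> 2 ^ ((n + 1) div 4))"
    if n: "n \<ge> 4" and t: "?type (Type_D n)" for n
  proof -
    have d: "?d = card (splittings (signed_root 2) (signed_pairs n))"
      unfolding dim[OF t] cartan_rank.simps using n by (intro type_D_splittings) simp
    show ?thesis
    proof (cases "n mod 4 = 0 \<or> n mod 4 = 1")
      case True
      define q r where "q = n div 4" and "r = n mod 4"
      have r: "r \<le> 1" "n = 4 * q + r" using True by (auto simp: q_def r_def)
      have "(n + 1) div 4 = q" using r by presburger
      then have b: "2 ^ ((n + 1) div 4) \<le> ?d"
        unfolding d using type_D_lower_bound[OF r(1), of q] r(2) by simp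
      then have "?d \<noteq> 0" by (metis le_zero_eq power_not_zero zero_neq_numeral)
      then show ?thesis using True b unfolding admits[OF t] by blast
    next
      case False
      then have "n mod 4 = 2 \<or> n mod 4 = 3" using mod_less_divisor[of 4 n] by linarith
      then show ?thesis using False type_D_parity[of n] unfolding admits[OF t] d by simp
    qed
  qed
  have E6: "?a \<and> ?d = 13697920" if "?type Type_E6"
    using E6_count dim[OF that] unfolding admits[OF that] by simp
  have E7: "\<not> ?a" if "?type Type_E7"
    using E7_parity dim[OF that] unfolding admits[OF that] by simp
  have E8: "?a \<and> ?d \<ge> 369600" if "?type Type_E8"
    using E8_lower_bound dim[OF that] unfolding admits[OF that] by simp
  have F4: "?a \<and> ?d = 34432" if "?type Type_F4"
    using F4_count dim[OF that] unfolding admits[OF that] by simp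
  have G2: "?d = 4" if "?type Type_G2"
    using G2_count dim[OF that] by simp
  show ?thesis using A B C D E6 E7 E8 F4 G2 by blast
qed

end
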